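(* Let $r\geqslant 2$ be an integer, let $q$ be a power of a prime $p$, and let $K=\mathbb{F}_q(t)$. Let $\mathbf a,\mathbf b\in K$ be two $\mathbb{F}_q$-linearly independent elements. Then there exist positive constants $N_0$ and $c_0$ (depending only on $q$, $r$ and the degrees of $\mathbf a$ and $\mathbf b$) such that for each integer $\ell\geqslant N_0$ and for each generator $\tau$ of the field extension $\mathbb{F}_{q^\ell}/\mathbb{F}_q$, the specializations $\mathbf a(\tau),\mathbf b(\tau)\in\overline{\mathbb{F}_q}$ are well defined, and for all except at most $N_0$ values of $\lambda\in\overline{\mathbb{F}_q}$, at least one of the two points $\mathbf a(\tau)$ or $\mathbf b(\tau)$ is a torsion point whose order has degree at least $c_0\log\log \ell$ for the Drinfeld module $\Phi^{(\tau,\lambda)}:\mathbb{F}_q[T]\to \mathrm{End}_{\overline{\mathbb{F}_q}}(\mathbb{G}_a)$ given by $\Phi^{(\tau,\lambda)}_T(x)=\tau x+\lambda x^q+x^{q^r}$.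
   Context: For $\mathbf a=P(t)/Q(t)\in\mathbb{F}_q(t)$ with $P,Q$ coprime, $Q\neq 0$, and $\tau\in\overline{\mathbb{F}_q}$ with $Q(\tau)\neq 0$, the specialization is $\mathbf a(\tau)=P(\tau)/Q(\tau)$; the degree of $\mathbf a$ is $\max\{\deg P,\deg Q\}$. An $\mathbb{F}_q[T]$-Drinfeld module $\Phi$ over a field $L\supseteq\mathbb{F}_q$ is a ring homomorphism $\Phi:\mathbb{F}_q[T]\to\mathrm{End}_L(\mathbb{G}_a)$ (into $\mathbb{F}_q$-linear additive polynomials under composition) determined by the additive polynomial $\Phi_T$ of degree $>1$; thus $\Phi_{\sum c_iT^i}(x)=\sum c_i\Phi_T^{\circ i}(x)$. A point $\mathbf c\in\overline L$ is torsion if $\Phi_{P(T)}(\mathbf c)=0$ for some nonzero $P\in\mathbb{F}_q[T]$; its order is the monic polynomial $P(T)$ of minimal degree with $\Phi_{P(T)}(\mathbf c)=0$. (Every element of $\overline{\mathbb{F}_q}$ is torsion for a Drinfeld module defined over $\overline{\mathbb{F}_q}$.) *)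

theory Defs
  imports "HOL-Algebra.Algebraic_Closure_Type" "HOL-Algebra.Generated_Fields" "HOL-Algebra.Sylow"
    "HOL-Library.Cardinality"
begin

text \<open>
  The finite field \<open>\<F>\<^sub>q\<close> is an arbitrary type \<open>'a :: finite_field\<close>, with \<open>q = CARD('a)\<close>. Its algebraic
  closure is the type \<open>'a alg_closure\<close>, with embedding \<^const>\<open>to_ac\<close>, and the rational function
  field \<open>\<F>\<^sub>q(t)\<close> is the type \<open>'a poly fract\<close>. Names of polynomial operations are qualified since
  \<open>HOL-Algebra\<close> reuses them.
\<close>

section \<open>Rational functions and their specializations\<close>

text \<open>The denominator is taken to be monic, which makes the coprime representation unique.\<close>

definition rat_quot :: "'a::field poly fract \<Rightarrow> 'a poly \<times> 'a poly" where
  "rat_quot a = (THE (P, Q). a = Fract P Q \<and> coprime P Q \<and> Polynomial.lead_coeff Q = 1)"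

definition rat_num :: "'a::field poly fract \<Rightarrow> 'a poly" where
  "rat_num a = fst (rat_quot a)"

definition rat_den :: "'a::field poly fract \<Rightarrow> 'a poly" where
  "rat_den a = snd (rat_quot a)"

definition rat_degree :: "'a::field poly fract \<Rightarrow> nat" where
  "rat_degree a = max (Polynomial.degree (rat_num a)) (Polynomial.degree (rat_den a))"

definition eval_ac :: "'a::field poly \<Rightarrow> 'a alg_closure \<Rightarrow> 'a alg_closure" where
  "eval_ac P \<tau> = poly (map_poly to_ac P) \<tau>"

definition specializable :: "'a::field poly fract \<Rightarrow> 'a alg_closure \<Rightarrow> bool" where
  "specializable a \<tau> \<longleftrightarrow> eval_ac (rat_den a) \<tau> \<noteq> 0"

definition specialize :: "'a::field poly fract \<Rightarrow> 'a alg_closure \<Rightarrow> 'a alg_closure" where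
  "specialize a \<tau> = eval_ac (rat_num a) \<tau> / eval_ac (rat_den a) \<tau>"

definition const_fract :: "'a::field \<Rightarrow> 'a poly fract" where
  "const_fract c = Fract [:c:] 1"

definition lin_indep_pair :: "'a::field poly fract \<Rightarrow> 'a poly fract \<Rightarrow> bool" where
  "lin_indep_pair a b \<longleftrightarrow>
     (\<forall>c d. const_fract c * a + const_fract d * b = 0 \<longrightarrow> c = 0 \<and> d = 0)"

lemma coprime_poly_dvd_mult:
  fixes P Q R :: "'a::field poly"
  assumes "coprime P Q" "Q dvd P * R"
  shows "Q dvd R"
proof (cases "Q = 0")
  case True
  with assms(1) have "is_unit P" by simp
  with assms(2) True show ?thesis by auto
next
  case False
  define I where "I = {s * P + t * Q | s t. True}"
  have QI: "Q \<in> I" and PI: "P \<in> I"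
    unfolding I_def by (auto intro: exI[of _ 0] exI[of _ 1])
  have "\<exists>g. (g \<in> I \<and> g \<noteq> 0) \<and> (\<forall>h. h \<in> I \<and> h \<noteq> 0 \<longrightarrow> Polynomial.degree g \<le> Polynomial.degree h)"
    using ex_has_least_nat[of "\<lambda>g. g \<in> I \<and> g \<noteq> 0" Q Polynomial.degree] QI False by blast
  then obtain g where g: "g \<in> I" "g \<noteq> 0"
    "\<And>h. h \<in> I \<Longrightarrow> h \<noteq> 0 \<Longrightarrow> Polynomial.degree g \<le> Polynomial.degree h" by blast
  from g(1) obtain s t where st: "g = s * P + t * Q" unfolding I_def by blast
  have "g dvd h" if "h \<in> I" for h
  proof -
    from that obtain u v where uv: "h = u * P + v * Q" unfolding I_def by blast
    have "h mod g = h - (h div g) * g" by (simp add: minus_div_mult_eq_mod)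
    also have "\<dots> = (u - (h div g) * s) * P + (v - (h div g) * t) * Q"
      by (subst (1) uv, subst (2) st) (simp add: algebra_simps)
    finally have mI: "h mod g \<in> I" unfolding I_def by blast
    have "h mod g = 0"
      using g(3)[OF mI] degree_mod_less[OF g(2), of h] by (metis not_le)
    thus ?thesis by (simp add: dvd_eq_mod_eq_0)
  qed
  hence "is_unit g" using PI QI assms(1) by (auto simp: coprime_def)
  moreover have "Q dvd g * R"
  proof -
    have "g * R = s * (P * R) + Q * (t * R)" by (simp add: st algebra_simps)
    thus ?thesis using assms(2) by simp
  qed
  ultimately show ?thesis by (metis dvd_mult_unit_iff')
qed

lemma monic_eq_if_dvd_dvd:
  fixes P Q :: "'a::field poly"
  assumes "P dvd Q" "Q dvd P" "Polynomial.lead_coeff P = 1" "Polynomial.lead_coeff Q = 1"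
  shows "P = Q"
proof -
  from assms(1) obtain R where R: "Q = P * R" by blast
  have "Q \<noteq> 0" "P \<noteq> 0" using assms by auto
  have "Polynomial.degree P = Polynomial.degree Q"
    using assms \<open>Q \<noteq> 0\<close> \<open>P \<noteq> 0\<close> by (simp add: dvd_imp_degree_le le_antisym)
  hence "Polynomial.degree R = 0"
    using R \<open>Q \<noteq> 0\<close> by (metis add_eq_self_zero degree_mult_eq mult_zero_left mult_zero_right)
  then obtain c where "R = [:c:]" by (metis degree_eq_zeroE)
  hence "Q = Polynomial.smult c P" using R by simp
  moreover from this have "c = 1" using assms by (cases "c = 0") auto
  ultimately show ?thesis by simp
qed

lemma rat_quot_unique:
  fixes P Q :: "'a::field poly"
  assumes "Fract P Q = Fract P' Q'" "coprime P Q" "coprime P' Q'"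
    "Polynomial.lead_coeff Q = 1" "Polynomial.lead_coeff Q' = 1"
  shows "P = P' \<and> Q = Q'"
proof -
  have nz: "Q \<noteq> 0" "Q' \<noteq> 0" using assms by auto
  have eq: "P * Q' = P' * Q" using assms(1) nz by (simp add: eq_fract)
  have "Q dvd Q'" using coprime_poly_dvd_mult[OF assms(2)] eq by simp
  moreover have "Q' dvd Q" using coprime_poly_dvd_mult[OF assms(3)] eq by (metis dvd_triv_right)
  ultimately have "Q = Q'" using monic_eq_if_dvd_dvd assms by blast
  thus ?thesis using eq nz by simp
qed

lemma rat_quot_Fract:
  fixes P Q :: "'a::field poly"
  assumes "coprime P Q" "Q \<noteq> 0"
  defines "c \<equiv> inverse (Polynomial.lead_coeff Q)"
  shows "rat_quot (Fract P Q) = (Polynomial.smult c P, Polynomial.smult c Q)"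
proof -
  have c: "c \<noteq> 0" using assms by simp
  have *: "Fract P Q = Fract (Polynomial.smult c P) (Polynomial.smult c Q)"
    "coprime (Polynomial.smult c P) (Polynomial.smult c Q)"
    "Polynomial.lead_coeff (Polynomial.smult c Q) = 1"
    using assms c by (auto simp: eq_fract coprime_def dvd_smult_iff)
  show ?thesis unfolding rat_quot_def
    by (rule the_equality) (use * rat_quot_unique in \<open>auto, blast+\<close>)
qed

lemma rat_degree_Fract:
  fixes P Q :: "'a::field poly"
  assumes "coprime P Q" "Q \<noteq> 0"
  shows "rat_degree (Fract P Q) = max (Polynomial.degree P) (Polynomial.degree Q)"
  using assms by (simp add: rat_degree_def rat_num_def rat_den_def rat_quot_Fract)

lemma eval_ac_smult: "eval_ac (Polynomial.smult c P) \<tau> = to_ac c * eval_ac P \<tau>"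
proof -
  have "map_poly to_ac (Polynomial.smult c P) = Polynomial.smult (to_ac c) (map_poly to_ac P)"
    by (rule poly_eqI) (simp add: coeff_map_poly)
  thus ?thesis by (simp add: eval_ac_def)
qed

lemma specializable_Fract:
  assumes "coprime P Q" "Q \<noteq> 0"
  shows "specializable (Fract P Q) \<tau> \<longleftrightarrow> eval_ac Q \<tau> \<noteq> 0"
  using assms by (simp add: specializable_def rat_den_def rat_quot_Fract eval_ac_smult)

lemma specialize_Fract:
  assumes "coprime P Q" "Q \<noteq> 0"
  shows "specialize (Fract P Q) \<tau> = eval_ac P \<tau> / eval_ac Q \<tau>"
  using assms by (simp add: specialize_def rat_num_def rat_den_def rat_quot_Fract eval_ac_smult)

lemma ex_coprime_Fract:
  fixes a :: "'a::field poly fract"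
  obtains P Q where "a = Fract P Q" "coprime P Q" "Q \<noteq> 0"
proof -
  define S where "S = (\<lambda>(P, Q). Q \<noteq> 0 \<and> a = Fract P Q)"
  obtain P0 Q0 where "S (P0, Q0)" by (cases a) (auto simp: S_def)
  then obtain P Q where PQ: "S (P, Q)"
    and min: "\<And>P' Q'. S (P', Q') \<Longrightarrow> Polynomial.degree Q \<le> Polynomial.degree Q'"
    using ex_has_least_nat[of S "(P0, Q0)" "\<lambda>x. Polynomial.degree (snd x)"] by force
  have "is_unit d" if d: "d dvd P" "d dvd Q" for d
  proof -
    from d obtain P' Q' where e: "P = d * P'" "Q = d * Q'" by blast
    have nz: "d \<noteq> 0" "Q' \<noteq> 0" using PQ e by (auto simp: S_def)
    have "S (P', Q')" using PQ e nz by (auto simp: S_def eq_fract)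
    from min[OF this] nz have "Polynomial.degree d = 0" by (simp add: e degree_mult_eq)
    thus ?thesis using nz by (auto elim!: degree_eq_zeroE simp: is_unit_pCons_iff)
  qed
  hence "coprime P Q" by (rule coprimeI)
  with PQ that show ?thesis by (auto simp: S_def)
qed

section \<open>Generators of finite extensions\<close>

text \<open>
  Inside the algebraic closure, the field with \<open>q\<^sup>l\<close> elements is the set of roots of
  \<open>X^(q^l) - X\<close>. An element \<open>\<tau>\<close> generates it over \<open>\<F>\<^sub>q\<close> if \<open>\<F>\<^sub>q(\<tau>)\<close> is equal to it as a field; \<open>\<tau>\<close> is
  not required to generate its multiplicative group.
\<close>

definition fin_ext :: "nat \<Rightarrow> 'a::finite_field alg_closure set" where
  "fin_ext l = {x. x ^ (CARD('a) ^ l) = x}"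

definition is_generator :: "nat \<Rightarrow> 'a::finite_field alg_closure \<Rightarrow> bool" where
  "is_generator l \<tau> \<longleftrightarrow> generate_field ring_of_type_algebra (insert \<tau> (range to_ac)) = fin_ext l"

section \<open>Drinfeld modules\<close>

text \<open>
  Since the algebraic closure is infinite, additivity and \<open>\<F>\<^sub>q\<close>-linearity of a polynomial may be
  expressed by its values.
\<close>

definition fq_linear :: "'a::finite_field alg_closure poly \<Rightarrow> bool" where
  "fq_linear f \<longleftrightarrow> (\<forall>x y. poly f (x + y) = poly f x + poly f y) \<and>
     (\<forall>c x. poly f (to_ac c * x) = to_ac c * poly f x)"

text \<open>
  \<open>drinfeld \<phi>\<close> is the Drinfeld module \<open>\<Phi>\<close> with \<open>\<Phi>\<^sub>T = \<phi>\<close>; the power in the definition is the iterated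
  composition \<open>\<phi> \<circ> \<dots> \<circ> \<phi>\<close>. It is meaningful for \<open>\<phi>\<close> \<open>\<F>\<^sub>q\<close>-linear of degree greater than 1.
\<close>

definition drinfeld :: "'a::finite_field alg_closure poly \<Rightarrow> 'a poly \<Rightarrow> 'a alg_closure poly" where
  "drinfeld \<phi> P = (\<Sum>i\<le>Polynomial.degree P.
     Polynomial.smult (to_ac (Polynomial.coeff P i)) ((pcompose \<phi> ^^ i) [:0, 1:]))"

definition is_torsion ::
    "('a::finite_field poly \<Rightarrow> 'a alg_closure poly) \<Rightarrow> 'a alg_closure \<Rightarrow> bool" where
  "is_torsion \<Phi> c \<longleftrightarrow> (\<exists>P. P \<noteq> 0 \<and> poly (\<Phi> P) c = 0)"

text \<open>Only meaningful for torsion points; see lemma \<open>torsion_order\<close> below.\<close>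

definition torsion_order ::
    "('a::finite_field poly \<Rightarrow> 'a alg_closure poly) \<Rightarrow> 'a alg_closure \<Rightarrow> 'a poly" where
  "torsion_order \<Phi> c = (THE P. Polynomial.lead_coeff P = 1 \<and> poly (\<Phi> P) c = 0 \<and>
     (\<forall>Q. Q \<noteq> 0 \<and> poly (\<Phi> Q) c = 0 \<longrightarrow> Polynomial.degree P \<le> Polynomial.degree Q))"

definition drinfeld_T ::
    "nat \<Rightarrow> 'a::finite_field alg_closure \<Rightarrow> 'a alg_closure \<Rightarrow> 'a alg_closure poly" where
  "drinfeld_T r \<tau> lam = Polynomial.monom \<tau> 1 + Polynomial.monom lam (CARD('a))
                      + Polynomial.monom 1 (CARD('a) ^ r)"

lemma funpow_pcompose:
  fixes \<phi> :: "'a::comm_semiring_1 poly"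
  shows "poly ((pcompose \<phi> ^^ i) [:0, 1:]) x = (poly \<phi> ^^ i) x"
  by (induction i) (auto simp: poly_pcompose)

lemma poly_drinfeld:
  assumes "Polynomial.degree P \<le> n"
  shows "poly (drinfeld \<phi> P) x = (\<Sum>i\<le>n. to_ac (Polynomial.coeff P i) * (poly \<phi> ^^ i) x)"
proof -
  have "(\<Sum>i\<le>n. to_ac (Polynomial.coeff P i) * (poly \<phi> ^^ i) x)
      = (\<Sum>i\<le>Polynomial.degree P. to_ac (Polynomial.coeff P i) * (poly \<phi> ^^ i) x)"
    by (rule sum.mono_neutral_right) (use assms in \<open>auto simp: coeff_eq_0\<close>)
  thus ?thesis by (simp add: drinfeld_def poly_sum funpow_pcompose)
qed

lemma poly_drinfeld_add: "poly (drinfeld \<phi> (P + Q)) x = poly (drinfeld \<phi> P) x + poly (drinfeld \<phi> Q) x"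
proof -
  let ?n = "max (Polynomial.degree P) (Polynomial.degree Q)"
  show ?thesis
    by (simp add: poly_drinfeld[of _ ?n] degree_add_le_max sum.distrib algebra_simps)
qed

lemma poly_drinfeld_smult: "poly (drinfeld \<phi> (Polynomial.smult c P)) x = to_ac c * poly (drinfeld \<phi> P) x"
  by (simp add: poly_drinfeld[of _ "Polynomial.degree P"] degree_smult_le sum_distrib_left mult.assoc)

lemma poly_drinfeld_pCons:
  "poly (drinfeld \<phi> (pCons c P)) x = to_ac c * x + poly (drinfeld \<phi> P) (poly \<phi> x)"
proof -
  have "Polynomial.degree (pCons c P) \<le> Suc (Polynomial.degree P)" by (simp add: degree_pCons_le)
  from poly_drinfeld[OF this] show ?thesis
    by (simp add: poly_drinfeld[of P "Polynomial.degree P"] sum.atMost_Suc_shift funpow_swap1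
        del: sum.atMost_Suc)
qed

lemma infinite_alg_closed: "infinite (UNIV :: 'a::alg_closed_field set)"
proof
  assume fin: "finite (UNIV :: 'a set)"
  define p :: "'a poly" where "p = (\<Prod>a\<in>UNIV. [:-a, 1:]) + 1"
  have "Polynomial.degree (\<Prod>a\<in>(UNIV::'a set). [:-a, 1:]) = card (UNIV :: 'a set)"
    by (subst degree_prod_sum_eq) auto
  moreover have "card (UNIV :: 'a set) > 0" using fin by (simp add: card_gt_0_iff)
  ultimately have "Polynomial.degree p > 0"
    unfolding p_def by (subst degree_add_eq_left) auto
  then obtain x where "poly p x = 0" using alg_closed_imp_poly_has_root by blast
  moreover have "poly (\<Prod>a\<in>(UNIV::'a set). [:-a, 1:]) x = 0"
    using fin by (auto simp: poly_prod prod_zero_iff)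
  ultimately show False by (simp add: p_def)
qed

lemma poly_eqI_infinite:
  fixes f g :: "'a::alg_closed_field poly"
  assumes "\<And>x. poly f x = poly g x"
  shows "f = g"
proof (rule ccontr)
  assume "f \<noteq> g"
  hence "finite {x. poly (f - g) x = 0}" by (intro poly_roots_finite) simp
  moreover have "{x. poly (f - g) x = 0} = UNIV" using assms by simp
  ultimately show False using infinite_alg_closed[where ?'a = 'a] by simp
qed

lemma fq_linear_add: "fq_linear f \<Longrightarrow> poly f (x + y) = poly f x + poly f y"
  and fq_linear_scale: "fq_linear f \<Longrightarrow> poly f (to_ac c * x) = to_ac c * poly f x"
  by (auto simp: fq_linear_def)

lemma fq_linear_zero: "fq_linear f \<Longrightarrow> poly f 0 = 0"
  using fq_linear_scale[of f 0 0] by simp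

lemma poly_drinfeld_0 [simp]: "drinfeld \<phi> 0 = 0"
  by (simp add: drinfeld_def)

text \<open>For \<open>\<F>\<^sub>q\<close>-linear \<open>\<phi>\<close>, \<open>drinfeld \<phi>\<close> is a ring homomorphism into the \<open>\<F>\<^sub>q\<close>-linear polynomials under composition.\<close>

lemma fq_linear_drinfeld: "fq_linear \<phi> \<Longrightarrow> fq_linear (drinfeld \<phi> P)"
proof (induction P rule: pCons_induct)
  case 0
  show ?case by (simp add: fq_linear_def)
next
  case (pCons c P)
  hence "fq_linear (drinfeld \<phi> P)" by blast
  with pCons.prems show ?case
    unfolding fq_linear_def by (simp add: poly_drinfeld_pCons distrib_left mult.left_commute)
qed

lemma poly_drinfeld_comm:
  assumes "fq_linear \<phi>"
  shows "poly (drinfeld \<phi> P) (poly \<phi> x) = poly \<phi> (poly (drinfeld \<phi> P) x)"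
proof (induction P arbitrary: x rule: pCons_induct)
  case 0
  show ?case using assms by (simp add: fq_linear_zero)
next
  case (pCons c P)
  thus ?case
    using assms by (simp add: poly_drinfeld_pCons fq_linear_add fq_linear_scale)
qed

lemma drinfeld_1: "drinfeld \<phi> 1 = [:0, 1:]"
  by (simp add: drinfeld_def)

lemma drinfeld_X: "drinfeld \<phi> [:0, 1:] = \<phi>"
  by (rule poly_eqI_infinite) (simp add: poly_drinfeld_pCons)

lemma drinfeld_add: "drinfeld \<phi> (P + Q) = drinfeld \<phi> P + drinfeld \<phi> Q"
  by (rule poly_eqI_infinite) (simp add: poly_drinfeld_add)

lemma drinfeld_mult:
  assumes "fq_linear \<phi>"
  shows "drinfeld \<phi> (P * Q) = pcompose (drinfeld \<phi> P) (drinfeld \<phi> Q)"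
proof (rule poly_eqI_infinite)
  fix x
  have "poly (drinfeld \<phi> (P * Q)) x = poly (drinfeld \<phi> P) (poly (drinfeld \<phi> Q) x)"
  proof (induction P arbitrary: x rule: pCons_induct)
    case (pCons c P)
    thus ?case
      by (simp add: poly_drinfeld_add poly_drinfeld_smult poly_drinfeld_pCons
          poly_drinfeld_comm[OF assms])
  qed simp
  thus "poly (drinfeld \<phi> (P * Q)) x = poly (pcompose (drinfeld \<phi> P) (drinfeld \<phi> Q)) x"
    by (simp add: poly_pcompose)
qed

lemma torsion_order:
  assumes "is_torsion (drinfeld \<phi>) c"
  defines "P \<equiv> torsion_order (drinfeld \<phi>) c"
  shows "Polynomial.lead_coeff P = 1" "poly (drinfeld \<phi> P) c = 0"
    "\<And>Q. Q \<noteq> 0 \<Longrightarrow> poly (drinfeld \<phi> Q) c = 0 \<Longrightarrow> Polynomial.degree P \<le> Polynomial.degree Q"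
proof -
  let ?A = "\<lambda>P. P \<noteq> 0 \<and> poly (drinfeld \<phi> P) c = 0"
  let ?M = "\<lambda>P. Polynomial.lead_coeff P = 1 \<and> poly (drinfeld \<phi> P) c = 0 \<and>
     (\<forall>Q. ?A Q \<longrightarrow> Polynomial.degree P \<le> Polynomial.degree Q)"
  from assms(1) obtain P1 where "?A P1" by (auto simp: is_torsion_def)
  then obtain P0 where P0: "?A P0" "\<And>Q. ?A Q \<Longrightarrow> Polynomial.degree P0 \<le> Polynomial.degree Q"
    using ex_has_least_nat[of ?A P1 Polynomial.degree] by blast
  have M: "?M (Polynomial.smult (inverse (Polynomial.lead_coeff P0)) P0)"
    using P0 by (auto simp: poly_drinfeld_smult)
  have uniq: "R = S" if "?M R" "?M S" for R S
  proof (rule ccontr)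
    assume ne: "R \<noteq> S"
    have nz: "R \<noteq> 0" "S \<noteq> 0" using that by auto
    hence deg: "Polynomial.degree R = Polynomial.degree S" using that by (meson le_antisym)
    have "poly (drinfeld \<phi> (R + Polynomial.smult (-1) S)) c = 0"
      using that by (simp only: poly_drinfeld_add poly_drinfeld_smult) simp
    hence "?A (R - S)" using ne by simp
    hence le: "Polynomial.degree R \<le> Polynomial.degree (R - S)" using that by blast
    have "Polynomial.coeff (R - S) (Polynomial.degree R) = 0" using that deg by simp
    moreover have "Polynomial.degree (R - S) \<le> Polynomial.degree R"
      by (rule degree_diff_le) (use deg in auto)
    ultimately have "Polynomial.lead_coeff (R - S) = 0" using le by (metis le_antisym)
    thus False using ne by (metis leading_coeff_0_iff right_minus_eq)
  qed
  have "?M P" unfolding P_def torsion_order_def by (rule theI2[where P = ?M, OF M]) (use uniq[OF _ M] in \<open>blast+\<close>)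
  thus "Polynomial.lead_coeff P = 1" "poly (drinfeld \<phi> P) c = 0"
    "\<And>Q. Q \<noteq> 0 \<Longrightarrow> poly (drinfeld \<phi> Q) c = 0 \<Longrightarrow> Polynomial.degree P \<le> Polynomial.degree Q"
    by blast+
qed

lemma finite_field_card:
  obtains n where "n > 0" "CARD('a::finite_field) = CHAR('a) ^ n"
proof -
  let ?p = "CHAR('a)" and ?R = "ring_of_type_algebra :: 'a ring"
  have gt1: "CARD('a) > 1"
    using card_mono[of "UNIV :: 'a set" "{0, 1}"] by simp
  have "r = ?p" if r: "prime r" "r dvd CARD('a)" for r
  proof -
    interpret ring ?R by (rule ring_from_type_algebra)
    let ?a = "multiplicity r CARD('a)"
    have a: "?a > 0" using r gt1 by (simp add: prime_multiplicity_gt_zero_iff)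
    obtain m where m: "CARD('a) = r ^ ?a * m" using multiplicity_dvd[of r "CARD('a)"] by blast
    have "group (add_monoid ?R)" by (rule add.group_axioms)
    moreover have "Coset.order (add_monoid ?R) = r ^ ?a * m"
      using m by (simp add: Coset.order_def ring_of_type_algebra_def)
    ultimately obtain H where H: "subgroup H (add_monoid ?R)" "card H = r ^ ?a"
      using sylow_thm[of r "add_monoid ?R" ?a m] r(1)
      by (auto simp: ring_of_type_algebra_def)
    have "card H > 1" using H a r(1) by (metis one_less_power prime_gt_1_nat)
    hence "\<not> H \<subseteq> {0}" using card_mono[of "{0}" H] by auto
    then obtain x where x: "x \<in> H" "x \<noteq> 0" by blast
    have add: "x + y \<in> H" and sub: "y - x \<in> H" if "y \<in> H" for y
    proof -
      show "x + y \<in> H" using subgroup.m_closed[OF H(1) x(1) that] by (simp add: ring_of_type_algebra_def)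
      have "inv\<^bsub>add_monoid ?R\<^esub> x \<in> H" by (rule subgroup.m_inv_closed[OF H(1) x(1)])
      moreover have "inv\<^bsub>add_monoid ?R\<^esub> x = - x"
        by (rule add.inv_equality[unfolded a_inv_def]) (auto simp: ring_of_type_algebra_def)
      ultimately have "- x \<in> H" by simp
      from subgroup.m_closed[OF H(1) that this] show "y - x \<in> H" by (simp add: ring_of_type_algebra_def)
    qed
    have "(\<Sum>y\<in>H. y) = (\<Sum>y\<in>H. x + y)"
      by (rule sum.reindex_bij_witness[of _ "\<lambda>y. x + y" "\<lambda>y. y - x"]) (auto simp: add sub)
    also have "\<dots> = of_nat (card H) * x + (\<Sum>y\<in>H. y)" by (simp add: sum.distrib)
    finally have "of_nat (r ^ ?a) = (0::'a)" using x(2) H(2) by simp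
    hence "?p dvd r ^ ?a" by (simp only: of_nat_eq_0_iff_char_dvd)
    hence "?p dvd r" using prime_dvd_power by blast
    thus ?thesis using r(1) primes_dvd_imp_eq[of ?p r] by simp
  qed
  hence sub: "prime_factors CARD('a) \<subseteq> {?p}" by auto
  define n where "n = multiplicity ?p CARD('a)"
  have "CARD('a) = (\<Prod>r\<in>prime_factors CARD('a). r ^ multiplicity r CARD('a))"
    using gt1 by (simp add: prime_factorization_nat)
  also have "\<dots> = (\<Prod>r\<in>{?p}. r ^ multiplicity r CARD('a))"
    by (rule prod.mono_neutral_left) (use sub in \<open>auto simp: in_prime_factors_iff not_dvd_imp_multiplicity_0\<close>)
  finally have eq: "CARD('a) = ?p ^ n" by (simp add: n_def)
  have "n > 0" using eq gt1 by (cases n) auto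
  with eq that show ?thesis by blast
qed

lemma fq_linear_drinfeld_T:
  fixes \<tau> lam :: "'a::finite_field alg_closure"
  shows "fq_linear (drinfeld_T r \<tau> lam)"
proof -
  let ?q = "CARD('a)"
  obtain n where n: "?q = CHAR('a) ^ n" by (rule finite_field_card)
  have add: "(x + y) ^ (?q ^ k) = x ^ (?q ^ k) + y ^ (?q ^ k)" for x y :: "'a alg_closure" and k
    using freshmans_dream'[of "CHAR('a) ^ (n * k)" "n * k" x y] by (simp add: n power_mult)
  have sc: "to_ac c ^ (?q ^ k) = to_ac c" for c :: 'a and k
    by (metis finite_field_power_card_power_eq_same to_ac_power)
  show ?thesis
    using add[of _ _ 1] add[of _ _ r] sc[of _ 1] sc[of _ r]
    by (simp add: fq_linear_def drinfeld_T_def poly_monom power_mult_distrib algebra_simps)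
qed

lemma degree_drinfeld_T:
  fixes \<tau> lam :: "'a::finite_field alg_closure"
  assumes "r \<ge> 2"
  shows "Polynomial.degree (drinfeld_T r \<tau> lam) = CARD('a) ^ r"
proof -
  have q: "CARD('a) > 1"
    using card_mono[of "UNIV :: 'a set" "{0, 1}"] by simp
  have lt: "CARD('a) < CARD('a) ^ r" using power_strict_increasing[of 1 r "CARD('a)"] q assms by simp
  have "Polynomial.degree (Polynomial.monom \<tau> 1 + Polynomial.monom lam (CARD('a))) \<le> CARD('a)"
    by (rule degree_add_le) (use q in \<open>auto intro: order_trans[OF degree_monom_le]\<close>)
  thus ?thesis unfolding drinfeld_T_def
    by (subst degree_add_eq_right) (use lt in \<open>auto simp: degree_monom_eq\<close>)
qed

end

theory Submission
  imports Defs "HOL-Computational_Algebra.Polynomial_Factorial"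
begin

text \<open>
  Replacing \<open>a\<close>, \<open>b\<close> by \<open>\<F>\<^sub>q\<close>-linear combinations, we may assume that the degree of \<open>a\<close> at infinity is
  smaller than that of \<open>b\<close>. As a polynomial in \<open>\<lambda>\<close>, the point \<open>\<Phi>\<^bsub>T^(i+1)\<^esub>(a)\<close> has degree \<open>d = q^(r i)\<close> and
  leading coefficient \<open>a^(q d)\<close>, and its values at the parameters \<open>\<lambda>\<close> for which \<open>a\<close> is torsion are bounded
  at every place. So at a place \<open>v\<close> these parameters lie in a set of capacity \<open>|a|\<^sub>v^(-q)\<close>. Using \<open>a\<close> at
  the finite places and \<open>b\<close> at infinity, the parameters for which both points are torsion lie in an adelic
  set of capacity less than 1. As in the theorem of Fekete, there is then a nonzero polynomial \<open>G\<close> in \<open>\<lambda>\<close>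
  whose values at all these parameters are integral at the finite places and less than 1 at infinity;
  a pigeonhole argument replaces the theorem of Minkowski. By the product formula, \<open>G\<close> vanishes there.
  Extensions of places are avoided by working with lattices in \<open>K[\<lambda>] / (h)\<close>, where \<open>h\<close> is the greatest common
  divisor of \<open>\<Phi>\<^sub>L(a)\<close> and \<open>\<Phi>\<^sub>L(b)\<close>; the conclusion becomes that \<open>h\<close> divides a power of \<open>G\<close>.

  Another pigeonhole argument represents \<open>h\<close>, up to a factor in \<open>K\<close>, as a combination of the two numerators
  with coefficients of degree at most \<open>q^(O(r deg L))\<close> in \<open>t\<close>. Its leading coefficient survives \<open>t = \<tau>\<close> if \<open>l\<close>
  is larger than that. Taking for \<open>L\<close> a multiple of the two orders, all exceptional \<open>\<lambda>\<close> are roots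
  of \<open>G(\<tau>, \<lambda>)\<close>. The constants are uniform since only finitely many \<open>a\<close>, \<open>b\<close> have given degrees.
\<close>

section \<open>Orbits\<close>

text \<open>
  \<open>orb q Q t l x\<close> is the orbit of \<open>x\<close> under \<open>\<Phi>\<^sub>T(x) = t x + l x\<^sup>q + x\<^sup>Q\<close>, with \<open>Q\<close> in the role of \<open>q\<^sup>r\<close>;
  \<open>hom_orb\<close> is the same orbit for a fraction with denominator \<open>c\<close>, multiplied by the power of \<open>c\<close>
  that makes it polynomial.
\<close>

primrec orb :: "nat \<Rightarrow> nat \<Rightarrow> 'b::comm_ring_1 \<Rightarrow> 'b \<Rightarrow> 'b \<Rightarrow> nat \<Rightarrow> 'b" where
  "orb q Q t l x 0 = x"
| "orb q Q t l x (Suc i) = t * orb q Q t l x i + l * orb q Q t l x i ^ q + orb q Q t l x i ^ Q"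

primrec hom_orb :: "nat \<Rightarrow> nat \<Rightarrow> 'b::comm_ring_1 \<Rightarrow> 'b \<Rightarrow> 'b \<Rightarrow> 'b \<Rightarrow> nat \<Rightarrow> 'b" where
  "hom_orb q Q t l c x 0 = x"
| "hom_orb q Q t l c x (Suc i) = t * c ^ (Q ^ Suc i - Q ^ i) * hom_orb q Q t l c x i
     + l * c ^ (Q ^ Suc i - q * Q ^ i) * hom_orb q Q t l c x i ^ q + hom_orb q Q t l c x i ^ Q"

text \<open>Homogeneity: every summand of the recursion carries total weight
  \<open>Q ^ Suc i\<close> in \<open>c\<close>. Since \<open>q \<le> Q\<close>, the subtractions in
  the exponents are exact.\<close>

lemma hom_orb_eq:
  assumes "q \<le> Q" "0 < Q"
  shows "hom_orb q Q t l c (c * x) i = c ^ (Q ^ i) * orb q Q t l x i"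
proof (induction i)
  case (Suc i)
  have le: "Q ^ i \<le> Q ^ Suc i" "q * Q ^ i \<le> Q ^ Suc i" using assms by auto
  have e: "c ^ (Q ^ Suc i - Q ^ i) * c ^ (Q ^ i) = c ^ (Q ^ Suc i)"
    "c ^ (Q ^ Suc i - q * Q ^ i) * (c ^ (Q ^ i)) ^ q = c ^ (Q ^ Suc i)"
    "(c ^ (Q ^ i)) ^ Q = c ^ (Q ^ Suc i)"
    using le by (simp_all add: mult.commute flip: power_add power_mult)
  let ?o = "orb q Q t l x i"
  have "hom_orb q Q t l c (c * x) (Suc i) = t * (c ^ (Q ^ Suc i - Q ^ i) * c ^ (Q ^ i)) * ?o
     + l * (c ^ (Q ^ Suc i - q * Q ^ i) * (c ^ (Q ^ i)) ^ q) * ?o ^ q + (c ^ (Q ^ i)) ^ Q * ?o ^ Q"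
    by (simp add: Suc power_mult_distrib algebra_simps del: power_Suc)
  also have "\<dots> = c ^ (Q ^ Suc i) * orb q Q t l x (Suc i)"
    unfolding e by (simp add: algebra_simps)
  finally show ?case .
qed simp

text \<open>The recursion uses ring operations only. It is transported along the embedding into
  polynomials over the fraction field and along evaluation at \<tau> and \<lambda>.\<close>

lemma hom_orb_hom:
  assumes "\<And>x y. h (x + y) = h x + h y" "\<And>x y. h (x * y) = h x * h y" "h 1 = 1"
  shows "h (hom_orb q Q t l c x i) = hom_orb q Q (h t) (h l) (h c) (h x) i"
proof -
  have "h (x ^ k) = h x ^ k" for x k by (induction k) (auto simp: assms)
  thus ?thesis by (induction i) (auto simp: assms)
qed

text \<open>Under these hypotheses x -> t x + l x^q + x^Q is additive and commutes with the
  constants, so it carries a combination of one stretch of the orbit to the same combination of the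
  next.\<close>

lemma orb_sum:
  fixes t l x :: "'b::comm_ring_1"
  assumes add: "\<And>(f::nat \<Rightarrow> 'b) A. sum f A ^ q = (\<Sum>i\<in>A. f i ^ q)" "\<And>(f::nat \<Rightarrow> 'b) A. sum f A ^ Q = (\<Sum>i\<in>A. f i ^ Q)"
    and const: "\<And>i. c i ^ q = c i" "\<And>i. c i ^ Q = c i"
  shows "(\<Sum>i\<in>A. c i * orb q Q t l x (Suc (i + k))) =
    (let e = \<Sum>i\<in>A. c i * orb q Q t l x (i + k) in t * e + l * e ^ q + e ^ Q)"
  unfolding Let_def add
  by (simp add: power_mult_distrib const sum.distrib sum_distrib_left algebra_simps)

abbreviation orbp :: "nat \<Rightarrow> nat \<Rightarrow> 'b::idom \<Rightarrow> 'b \<Rightarrow> nat \<Rightarrow> 'b poly" where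
  "orbp q Q t a \<equiv> orb q Q [:t:] [:0, 1:] [:a:]"

text \<open>The first step is linear in \<lambda> with leading coefficient \<open>a ^ q\<close>.
  Afterwards the \<open>Q\<close>-th power dominates: the middle term has degree
  \<open>1 + q * Q ^ i\<close>, which \<open>q + 2 \<le> Q\<close> keeps below
  \<open>Q ^ Suc i\<close>.\<close>

lemma degree_orbp:
  fixes a t :: "'b::idom"
  assumes a: "a \<noteq> 0" and q: "1 \<le> q" "q + 2 \<le> Q"
  shows "degree (orbp q Q t a (Suc i)) = Q ^ i \<and> lead_coeff (orbp q Q t a (Suc i)) = a ^ (q * Q ^ i)"
proof (induction i)
  case 0
  have "orbp q Q t a (Suc 0) = [:t * a + a ^ Q, a ^ q:]" by (simp add: poly_const_pow algebra_simps)
  thus ?case using a by simp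
next
  case (Suc i)
  let ?o = "orbp q Q t a (Suc i)"
  have nz: "?o \<noteq> 0" using Suc a by (metis leading_coeff_0_iff power_not_zero)
  have dQ: "degree (?o ^ Q) = Q ^ Suc i" using nz Suc by (simp add: degree_power_eq)
  have "degree ([:t:] * ?o) \<le> Q ^ i" using Suc degree_smult_le[of t ?o] by simp
  also have lt1: "Q ^ i < Q ^ Suc i" using q by simp
  finally have d1: "degree ([:t:] * ?o) < Q ^ Suc i" .
  have "degree ([:0, 1:] * ?o ^ q) = Suc (q * Q ^ i)"
    using nz Suc by (simp add: degree_mult_eq degree_power_eq del: mult_pCons_left)
  also have "\<dots> < (q + 2) * Q ^ i"
  proof -
    have "Q ^ i \<ge> 1" using q by simp
    thus ?thesis unfolding add_mult_distrib by linarith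
  qed
  also have "\<dots> \<le> Q ^ Suc i" unfolding power_Suc using q by (intro mult_right_mono) auto
  finally have d2: "degree ([:0, 1:] * ?o ^ q) < Q ^ Suc i" .
  have d: "degree ([:t:] * ?o + [:0, 1:] * ?o ^ q) < degree (?o ^ Q)"
    unfolding dQ by (rule degree_add_less[OF d1 d2])
  have e: "orbp q Q t a (Suc (Suc i)) = ([:t:] * ?o + [:0, 1:] * ?o ^ q) + ?o ^ Q"
    by (rule orb.simps)
  have "degree (orbp q Q t a (Suc (Suc i))) = Q ^ Suc i"
    unfolding e using d dQ by (subst degree_add_eq_right) auto
  moreover have "lead_coeff (orbp q Q t a (Suc (Suc i))) = lead_coeff (?o ^ Q)"
    unfolding e by (rule lead_coeff_add_le[OF d])
  moreover have "lead_coeff (?o ^ Q) = a ^ (q * Q ^ Suc i)"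
  proof -
    have "lead_coeff ?o = a ^ (q * Q ^ i)" using Suc by blast
    hence "lead_coeff (?o ^ Q) = (a ^ (q * Q ^ i)) ^ Q" by (simp only: lead_coeff_power)
    moreover have "q * Q ^ i * Q = q * Q ^ Suc i" by simp
    ultimately show ?thesis by (metis power_mult)
  qed
  ultimately show ?case by (metis)
qed

section \<open>Degree bounds in the field of rational functions\<close>

text \<open>\<open>ideg_le m x\<close> says that \<open>x\<close> has a zero of order at least \<open>- m\<close> at infinity.\<close>

definition ideg_le :: "int \<Rightarrow> 'a::field poly fract \<Rightarrow> bool" where
  "ideg_le m x \<longleftrightarrow> (\<exists>P Q. Q \<noteq> 0 \<and> x = Fract P Q \<and> (P = 0 \<or> int (degree P) - int (degree Q) \<le> m))"

lemma ideg_le_0 [simp]: "ideg_le m 0"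
  unfolding ideg_le_def by (rule exI[of _ 0], rule exI[of _ 1]) (simp add: fract_collapse)

text \<open>In this form the product formula enters: for negative \<open>m\<close>, a polynomial
  that is small at infinity must be zero.\<close>

lemma ideg_le_to_fract: "ideg_le m (to_fract p) \<longleftrightarrow> p = 0 \<or> int (degree p) \<le> m"
proof
  assume "ideg_le m (to_fract p)"
  then obtain P Q where *: "Q \<noteq> 0" "to_fract p = Fract P Q" "P = 0 \<or> int (degree P) - int (degree Q) \<le> m"
    unfolding ideg_le_def by blast
  hence "p * Q = P" by (simp add: to_fract_def eq_fract)
  thus "p = 0 \<or> int (degree p) \<le> m" using * by (cases "p = 0") (auto simp: degree_mult_eq)
next
  assume "p = 0 \<or> int (degree p) \<le> m"
  thus "ideg_le m (to_fract p)"
    unfolding ideg_le_def by (intro exI[of _ p] exI[of _ 1]) (auto simp: to_fract_def)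
qed

lemma ideg_le_mono: "ideg_le m x \<Longrightarrow> m \<le> m' \<Longrightarrow> ideg_le m' x"
  unfolding ideg_le_def by force

lemma ideg_le_add:
  assumes "ideg_le m x" "ideg_le m y"
  shows "ideg_le m (x + y)"
proof -
  obtain P Q where 1: "Q \<noteq> 0" "x = Fract P Q" "P = 0 \<or> int (degree P) - int (degree Q) \<le> m"
    using assms unfolding ideg_le_def by blast
  obtain P' Q' where 2: "Q' \<noteq> 0" "y = Fract P' Q'" "P' = 0 \<or> int (degree P') - int (degree Q') \<le> m"
    using assms unfolding ideg_le_def by blast
  have e: "x + y = Fract (P * Q' + P' * Q) (Q * Q')" using 1 2 by simp
  let ?N = "m + int (degree Q) + int (degree Q')"
  have h: "P * Q' = 0 \<or> int (degree (P * Q')) \<le> ?N" "P' * Q = 0 \<or> int (degree (P' * Q)) \<le> ?N"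
    using 1 2 by (cases "P = 0"; cases "P' = 0"; force simp: degree_mult_eq)+
  have "P * Q' + P' * Q = 0 \<or> int (degree (P * Q' + P' * Q)) \<le> ?N"
  proof (cases "P * Q' = 0 \<or> P' * Q = 0")
    case True
    thus ?thesis using h by auto
  next
    case False
    have "degree (P * Q' + P' * Q) \<le> max (degree (P * Q')) (degree (P' * Q))" by (rule degree_add_le_max)
    thus ?thesis using h False by linarith
  qed
  thus ?thesis unfolding ideg_le_def e using 1 2
    by (intro exI[of _ "P * Q' + P' * Q"] exI[of _ "Q * Q'"]) (auto simp: degree_mult_eq)
qed

lemma ideg_le_mult:
  assumes "ideg_le m x" "ideg_le m' y"
  shows "ideg_le (m + m') (x * y)"
proof -
  obtain P Q where 1: "Q \<noteq> 0" "x = Fract P Q" "P = 0 \<or> int (degree P) - int (degree Q) \<le> m"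
    using assms unfolding ideg_le_def by blast
  obtain P' Q' where 2: "Q' \<noteq> 0" "y = Fract P' Q'" "P' = 0 \<or> int (degree P') - int (degree Q') \<le> m'"
    using assms unfolding ideg_le_def by blast
  have e: "x * y = Fract (P * P') (Q * Q')" using 1 2 by simp
  have "P * P' = 0 \<or> int (degree (P * P')) - int (degree (Q * Q')) \<le> m + m'"
    using 1 2 by (cases "P = 0"; cases "P' = 0") (auto simp: degree_mult_eq)
  thus ?thesis unfolding ideg_le_def e using 1 2
    by (intro exI[of _ "P * P'"] exI[of _ "Q * Q'"]) simp
qed

lemma ideg_le_uminus: "ideg_le m x \<Longrightarrow> ideg_le m (- x)"
proof -
  assume x: "ideg_le m x"
  have "ideg_le 0 (to_fract (-1) :: 'a poly fract)" by (subst ideg_le_to_fract) simp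
  from ideg_le_mult[OF this x] show ?thesis by simp
qed

lemma ideg_le_diff: "ideg_le m x \<Longrightarrow> ideg_le m y \<Longrightarrow> ideg_le m (x - y)"
  by (metis ideg_le_add ideg_le_uminus add_uminus_conv_diff)

lemma ideg_le_power: "ideg_le m x \<Longrightarrow> ideg_le (m * int k) (x ^ k)"
proof (induction k)
  case 0
  show ?case using ideg_le_to_fract[of 0 1] by simp
next
  case (Suc k)
  from ideg_le_mult[OF Suc.prems Suc.IH[OF Suc.prems]] show ?case by (simp add: algebra_simps)
qed

lemma ideg_le_ex: obtains m where "m \<ge> 0" "ideg_le m x"
proof -
  obtain P Q where "x = Fract P Q" "Q \<noteq> 0" by (cases x)
  hence "ideg_le (int (degree P)) x" unfolding ideg_le_def by (intro exI[of _ P] exI[of _ Q]) auto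
  thus ?thesis using that[of "int (degree P)"] by simp
qed

text \<open>Division with remainder: it rounds an element of the field to a polynomial, with an
  error smaller than 1 at infinity.\<close>

lemma ideg_le_split:
  obtains p y where "x = to_fract p + y" "ideg_le (-1) y"
proof -
  obtain P Q where PQ: "x = Fract P Q" "Q \<noteq> 0" by (cases x)
  have "Fract (a * Q + b) Q = to_fract a + Fract b Q" for a b
    using PQ(2) by (simp add: to_fract_def)
  from this[of "P div Q" "P mod Q"] have "x = to_fract (P div Q) + Fract (P mod Q) Q"
    using PQ(1) by simp
  moreover have "ideg_le (-1) (Fract (P mod Q) Q)"
  proof -
    have "P mod Q = 0 \<or> int (degree (P mod Q)) - int (degree Q) \<le> -1"
    proof (cases "P mod Q = 0")
      case False
      hence "degree (P mod Q) < degree Q" using degree_mod_less[OF PQ(2), of P] by blast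
      thus ?thesis by linarith
    qed blast
    with PQ(2) show ?thesis
      unfolding ideg_le_def by (intro exI[of _ "P mod Q"] exI[of _ Q] conjI refl)
  qed
  ultimately show ?thesis using that by blast
qed

section \<open>An auxiliary polynomial\<close>

text \<open>\<open>Y\<close> plays the role of a basis with \<open>degree (Y j) = j\<close>. The set
  \<open>S\<close> need not be a ring: besides polynomials in t it will consist of the elements
  smaller than 1 at infinity, or of the polynomials of bounded degree.\<close>

definition lincomb :: "'k::comm_ring_1 set \<Rightarrow> (nat \<Rightarrow> 'k poly) \<Rightarrow> nat \<Rightarrow> 'k poly set" where
  "lincomb S Y N = {\<Sum>j<N. smult (c j) (Y j) | c. \<forall>j. c j \<in> S}"

lemma lincomb_add:
  assumes "\<And>x y. x \<in> S \<Longrightarrow> y \<in> S \<Longrightarrow> x + y \<in> S" "f \<in> lincomb S Y N" "g \<in> lincomb S Y N"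
  shows "f + g \<in> lincomb S Y N"
proof -
  obtain c d where "f = (\<Sum>j<N. smult (c j) (Y j))" "g = (\<Sum>j<N. smult (d j) (Y j))"
    "\<forall>j. c j \<in> S" "\<forall>j. d j \<in> S"
    using assms(2,3) unfolding lincomb_def by blast
  thus ?thesis unfolding lincomb_def using assms(1)
    by (intro CollectI exI[of _ "\<lambda>j. c j + d j"]) (auto simp: sum.distrib smult_add_left)
qed

lemma lincomb_uminus:
  assumes "\<And>x. x \<in> S \<Longrightarrow> - x \<in> S" "f \<in> lincomb S Y N"
  shows "- f \<in> lincomb S Y N"
proof -
  obtain c where "f = (\<Sum>j<N. smult (c j) (Y j))" "\<forall>j. c j \<in> S"
    using assms(2) unfolding lincomb_def by blast
  thus ?thesis unfolding lincomb_def using assms(1)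
    by (intro CollectI exI[of _ "\<lambda>j. - c j"]) (auto simp: sum_negf)
qed

lemma lincomb_diff:
  assumes "\<And>x y. x \<in> S \<Longrightarrow> y \<in> S \<Longrightarrow> x + y \<in> S" "\<And>x. x \<in> S \<Longrightarrow> - x \<in> S" 
    "f \<in> lincomb S Y N" "g \<in> lincomb S Y N"
  shows "f - g \<in> lincomb S Y N"
  using lincomb_add[OF assms(1,3) lincomb_uminus[OF assms(2,4)]] by simp

lemma lincomb_single:
  assumes "0 \<in> S" "c \<in> S" "j < N"
  shows "smult c (Y j) \<in> lincomb S Y N"
proof -
  have "smult c (Y j) = (\<Sum>i<N. smult (if i = j then c else 0) (Y i))"
    using assms(3) by (subst sum.remove[of _ j]) auto
  thus ?thesis unfolding lincomb_def using assms by (intro CollectI exI) auto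
qed

lemma lincomb_mono:
  assumes "0 \<in> S" "N \<le> N'" "f \<in> lincomb S Y N"
  shows "f \<in> lincomb S Y N'"
proof -
  obtain c where c: "f = (\<Sum>j<N. smult (c j) (Y j))" "\<forall>j. c j \<in> S"
    using assms(3) unfolding lincomb_def by blast
  have "f = (\<Sum>j<N'. smult (if j < N then c j else 0) (Y j))"
    unfolding c by (rule sum.mono_neutral_cong_left) (use assms in auto)
  thus ?thesis unfolding lincomb_def using assms c by (intro CollectI exI) auto
qed

lemma degree_lincomb:
  assumes "\<And>j. degree (Y j) = j" "f \<in> lincomb S Y (Suc N)"
  shows "degree f \<le> N"
proof -
  obtain c where c: "f = (\<Sum>j<Suc N. smult (c j) (Y j))" 
    using assms(2) unfolding lincomb_def by blast
  show ?thesis unfolding c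
    by (rule degree_sum_le) (auto intro: order_trans[OF degree_smult_le] simp: assms(1))
qed

lemma finite_degree_le: "finite {p :: 'a::{finite,zero} poly. degree p \<le> n}"
proof (rule finite_subset)
  show "{p :: 'a poly. degree p \<le> n} \<subseteq> Poly ` {xs. set xs \<subseteq> UNIV \<and> length xs \<le> Suc n}"
  proof
    fix p :: "'a poly"
    assume "p \<in> {p. degree p \<le> n}"
    hence "length (coeffs p) \<le> Suc n" by (cases "p = 0") (auto simp: length_coeffs)
    thus "p \<in> Poly ` {xs. set xs \<subseteq> UNIV \<and> length xs \<le> Suc n}" 
      by (intro image_eqI[of _ _ "coeffs p"]) auto
  qed
  show "finite (Poly ` {xs :: 'a list. set xs \<subseteq> UNIV \<and> length xs \<le> Suc n})"
    by (intro finite_imageI finite_lists_length_le) simp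
qed

text \<open>Division from the top degree down, with rounding: polynomial multiples of
  \<open>Y N\<close> are subtracted, and the rounding errors are expressed through
  \<open>Z N\<close>. For \<open>N \<ge> J\<close> the error is small enough for the second summand;
  the finitely many lower degrees leave a remainder \<open>w\<close> with coefficients of bounded
  degree.\<close>

lemma reduction_step:
  fixes Y Z :: "nat \<Rightarrow> 'a::field poly fract poly"
  assumes Y: "\<And>j. degree (Y j) = j" and Z: "\<And>j. degree (Z j) = j" "\<And>j. lead_coeff (Z j) \<noteq> 0"
    and U: "\<And>j. lead_coeff (Y j) = U j * lead_coeff (Z j)" "\<And>j. U j \<noteq> 0"
    and dU: "\<And>j. ideg_le (\<beta> j) (U j)" and J: "\<And>j. j \<ge> J \<Longrightarrow> \<beta> j \<le> 0"
    and B: "\<And>j. j < J \<Longrightarrow> \<beta> j \<le> int B"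
    and H: "H = 0 \<or> degree H < N"
  shows "\<exists>y \<in> lincomb (range to_fract) Y N. \<exists>z \<in> lincomb {x. ideg_le (-1) x} Z N.
     \<exists>w \<in> lincomb {to_fract p | p. degree p \<le> B} Z J. H = y + z + w"
  using H
proof (induction N arbitrary: H)
  case 0
  hence "H = 0" by simp
  moreover have "0 \<in> lincomb (range to_fract) Y 0" "0 \<in> lincomb {x. ideg_le (-1) x} Z 0"
    unfolding lincomb_def by (auto intro: exI[of _ "\<lambda>_. 0"])
  moreover have "0 \<in> lincomb {to_fract p | p. degree p \<le> B} Z J"
    unfolding lincomb_def by (auto intro!: exI[of _ "\<lambda>_. 0"] exI[of _ 0])
  ultimately show ?case by force
next
  case (Suc N)
  let ?A = "range (to_fract :: 'a poly \<Rightarrow> _)" and ?I = "{x :: 'a poly fract. ideg_le (-1) x}" 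
    and ?W = "{to_fract p | p :: 'a poly. degree p \<le> B}"
  have A: "0 \<in> ?A" "\<And>x y. x \<in> ?A \<Longrightarrow> y \<in> ?A \<Longrightarrow> x + y \<in> ?A"
    using rangeI[of "to_fract :: 'a poly \<Rightarrow> _" 0] by (auto simp flip: to_fract_add)
  have I: "0 \<in> ?I" "\<And>x y. x \<in> ?I \<Longrightarrow> y \<in> ?I \<Longrightarrow> x + y \<in> ?I" by (auto intro: ideg_le_add)
  have W: "0 \<in> ?W" "\<And>x y. x \<in> ?W \<Longrightarrow> y \<in> ?W \<Longrightarrow> x + y \<in> ?W"
  proof -
    show "0 \<in> ?W" by (intro CollectI exI[of _ 0]) auto
    fix x y assume "x \<in> ?W" "y \<in> ?W"
    then obtain p p' where "x = to_fract p" "y = to_fract p'" "degree p \<le> B" "degree p' \<le> B" by blast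
    thus "x + y \<in> ?W" by (intro CollectI exI[of _ "p + p'"]) (auto intro: degree_add_le)
  qed
  \<comment> \<open>The top coefficient of \<open>H\<close> in units of \<open>Z N\<close>. In these
    units that of \<open>Y N\<close> is \<open>U N\<close>, so \<open>k / U N\<close> rounded is the
    multiple of \<open>Y N\<close> to subtract.\<close>
  define k where "k = coeff H N / lead_coeff (Z N)"
  obtain p e where pe: "k / U N = to_fract p + e" "ideg_le (-1) e" by (rule ideg_le_split)
  have k: "k = to_fract p * U N + e * U N" using pe(1) U(2)[of N] by (simp add: field_simps)
  have de: "ideg_le (\<beta> N - 1) (e * U N)" using ideg_le_mult[OF pe(2) dU[of N]] by simp
  define H' where "H' = H - (smult (to_fract p) (Y N) + smult (e * U N) (Z N))"
  have c: "coeff (Y N) N = U N * lead_coeff (Z N)" "coeff (Z N) N = lead_coeff (Z N)"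
    "coeff H N = k * lead_coeff (Z N)"
    using U(1)[of N] Y[of N] Z[of N] by (simp_all add: k_def)
  have "coeff H' N = (k - to_fract p * U N - e * U N) * lead_coeff (Z N)"
    unfolding H'_def by (simp only: coeff_diff coeff_add coeff_smult c) (simp add: algebra_simps)
  also have "\<dots> = 0" using k by simp
  finally have "coeff H' N = 0" .
  moreover have "degree H' \<le> N" unfolding H'_def using Suc.prems Y Z
    by (intro degree_diff_le degree_add_le) (auto intro: order_trans[OF degree_smult_le])
  ultimately have "H' = 0 \<or> degree H' < N" by (metis leading_coeff_0_iff le_neq_implies_less)
  from Suc.IH[OF this] obtain y z w where yzw: "y \<in> lincomb ?A Y N" "z \<in> lincomb ?I Z N"
    "w \<in> lincomb ?W Z J" "H' = y + z + w" by blast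
  have y': "y + smult (to_fract p) (Y N) \<in> lincomb ?A Y (Suc N)"
    by (rule lincomb_add[OF A(2)]) (auto intro!: lincomb_mono[OF A(1) _ yzw(1)] lincomb_single A)
  have z1: "z \<in> lincomb ?I Z (Suc N)" by (rule lincomb_mono[OF I(1) _ yzw(2)]) simp
  show ?case
  proof (cases "N < J")
    case False
    have "ideg_le (-1) (e * U N)" by (rule ideg_le_mono[OF de]) (use J[of N] False in auto)
    hence "z + smult (e * U N) (Z N) \<in> lincomb ?I Z (Suc N)"
      by (intro lincomb_add[OF I(2)] z1 lincomb_single I) auto
    moreover have "H = (y + smult (to_fract p) (Y N)) + (z + smult (e * U N) (Z N)) + w"
      using yzw(4) unfolding H'_def by (simp add: algebra_simps)
    ultimately show ?thesis using y' yzw(3) by blast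
  next
    case True
    \<comment> \<open>Here \<open>U N\<close> may be large at infinity, so the error is rounded once
      more and its polynomial part goes into \<open>w\<close>.\<close>
    obtain p' e' where pe': "e * U N = to_fract p' + e'" "ideg_le (-1) e'" by (rule ideg_le_split)
    have "ideg_le (int B) (e * U N - e')"
      by (rule ideg_le_diff) (use B[OF True] in \<open>auto intro: ideg_le_mono[OF de] ideg_le_mono[OF pe'(2)]\<close>)
    hence "degree p' \<le> B" using pe'(1) by (auto simp: ideg_le_to_fract)
    hence "w + smult (to_fract p') (Z N) \<in> lincomb ?W Z J"
      by (intro lincomb_add[OF W(2)] yzw(3) lincomb_single W True) auto
    moreover have "z + smult e' (Z N) \<in> lincomb ?I Z (Suc N)"
      by (intro lincomb_add[OF I(2)] z1 lincomb_single I) (use pe' in auto)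
    moreover have "H = (y + smult (to_fract p) (Y N)) + (z + smult e' (Z N)) + (w + smult (to_fract p') (Z N))"
      using yzw(4) unfolding H'_def pe'(1) by (simp add: algebra_simps smult_add_left)
    ultimately show ?thesis using y' by blast
  qed
qed

text \<open>Starting from \<open>Y M - smult (U M) (Z M)\<close>, whose top terms cancel, the
  reduction gives for every large \<open>M\<close> some \<open>g M\<close> of degree
  \<open>M\<close> that lies in the first module and, up to an element of a finite set, in the
  second. For two values of \<open>M\<close> this element is the same, and the difference of the two
  polynomials lies in both modules.\<close>

lemma auxiliary_polynomial:
  fixes Y Z :: "nat \<Rightarrow> 'a::{field,finite} poly fract poly"
  assumes Y: "\<And>j. degree (Y j) = j" and Z: "\<And>j. degree (Z j) = j" "\<And>j. lead_coeff (Z j) \<noteq> 0"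
    and U: "\<And>j. lead_coeff (Y j) = U j * lead_coeff (Z j)" "\<And>j. U j \<noteq> 0"
    and dU: "\<And>j. ideg_le (\<beta> j) (U j)" and J: "\<And>j. j \<ge> J \<Longrightarrow> \<beta> j \<le> -1"
  shows "\<exists>N G. G \<noteq> 0 \<and> G \<in> lincomb (range to_fract) Y N \<and> G \<in> lincomb {x. ideg_le (-1) x} Z N"
proof -
  let ?A = "range (to_fract :: 'a poly \<Rightarrow> _)" and ?I = "{x :: 'a poly fract. ideg_le (-1) x}" 
  define B where "B = nat (Max (insert 0 (\<beta> ` {..<J})))"
  let ?W = "{to_fract p | p :: 'a poly. degree p \<le> B}"
  have B: "\<beta> j \<le> int B" if "j < J" for j
  proof -
    have "\<beta> j \<le> Max (insert 0 (\<beta> ` {..<J}))" using that by (intro Max_ge) auto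
    thus ?thesis unfolding B_def by linarith
  qed
  have J': "\<And>j. j \<ge> J \<Longrightarrow> \<beta> j \<le> 0" using J by force
  have A: "0 \<in> ?A" "1 \<in> ?A" "\<And>x y. x \<in> ?A \<Longrightarrow> y \<in> ?A \<Longrightarrow> x + y \<in> ?A" "\<And>x. x \<in> ?A \<Longrightarrow> - x \<in> ?A"
    using rangeI[of "to_fract :: 'a poly \<Rightarrow> _" 0] rangeI[of "to_fract :: 'a poly \<Rightarrow> _" 1]
    by (auto simp flip: to_fract_add to_fract_uminus)
  have I: "0 \<in> ?I" "\<And>x y. x \<in> ?I \<Longrightarrow> y \<in> ?I \<Longrightarrow> x + y \<in> ?I" "\<And>x. x \<in> ?I \<Longrightarrow> - x \<in> ?I" 
    by (auto intro: ideg_le_add ideg_le_uminus)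
  have "finite ?W" using finite_degree_le[where ?'a = 'a, of B] by (simp add: setcompr_eq_image)
  moreover have "lincomb ?W Z J \<subseteq> (\<lambda>c. \<Sum>j<J. smult (c j) (Z j)) ` (PiE {..<J} (\<lambda>_. ?W))"
  proof
    fix x assume "x \<in> lincomb ?W Z J"
    then obtain c where c: "x = (\<Sum>j<J. smult (c j) (Z j))" "\<forall>j. c j \<in> ?W" unfolding lincomb_def by blast
    thus "x \<in> (\<lambda>c. \<Sum>j<J. smult (c j) (Z j)) ` (PiE {..<J} (\<lambda>_. ?W))"
      by (intro image_eqI[of _ _ "restrict c {..<J}"]) (auto intro!: sum.cong)
  qed
  ultimately have fin: "finite (lincomb ?W Z J)"
    by (meson finite_PiE finite_imageI finite_lessThan finite_subset)
  define R where "R = (\<lambda>M g w. degree g = M \<and> g \<in> lincomb ?A Y (Suc M) \<and> w \<in> lincomb ?W Z J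
    \<and> g - w \<in> lincomb ?I Z (Suc M))"
  have "\<exists>g w. R M g w" if M: "M \<ge> J" "M > 0" for M
  proof -
    define H where "H = Y M - smult (U M) (Z M)"
    have "coeff H M = 0" unfolding H_def using U(1)[of M] Y[of M] Z[of M] by simp
    moreover have "degree H \<le> M" unfolding H_def using Y Z
      by (intro degree_diff_le) (auto intro: order_trans[OF degree_smult_le])
    ultimately have "H = 0 \<or> degree H < M" by (metis leading_coeff_0_iff le_neq_implies_less)
    from reduction_step[of Y Z U \<beta> J B, OF Y Z U dU J' B this]
    obtain y z w where yzw: "y \<in> lincomb ?A Y M" "z \<in> lincomb ?I Z M" "w \<in> lincomb ?W Z J" "H = y + z + w"
      by blast
    have "degree y < degree (Y M)"
      using degree_lincomb[of Y y ?A "M - 1"] Y yzw(1) M by (simp add: less_eq_Suc_le)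
    hence "degree (Y M - y) = M" by (metis Y degree_add_eq_left degree_minus uminus_add_conv_diff add.commute)
    moreover have "Y M - y \<in> lincomb ?A Y (Suc M)"
      using lincomb_single[OF A(1,2), of M "Suc M" Y] lincomb_mono[OF A(1) _ yzw(1), of "Suc M"]
      by (intro lincomb_diff A) auto
    \<comment> \<open>For \<open>M \<ge> J\<close> the coefficient \<open>U M\<close> is itself
      smaller than 1 at infinity.\<close>
    moreover have "smult (U M) (Z M) + z \<in> lincomb ?I Z (Suc M)"
      using lincomb_mono[OF I(1) _ yzw(2), of "Suc M"] ideg_le_mono[OF dU J[OF M(1)]]
      by (intro lincomb_add lincomb_single I) auto
    moreover have "Y M - y - w = smult (U M) (Z M) + z" using yzw(4) unfolding H_def by (simp add: algebra_simps)
    ultimately have "R M (Y M - y) w" using yzw(3) by (simp add: R_def)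
    thus ?thesis by blast
  qed
  hence "\<forall>M. \<exists>g w. M > J \<longrightarrow> R M g w" by (metis less_imp_le not_less_zero gr0I)
  then obtain g w where "\<And>M. M > J \<Longrightarrow> R M (g M) (w M)" by metis
  hence gw: "degree (g M) = M" "g M \<in> lincomb ?A Y (Suc M)" "w M \<in> lincomb ?W Z J" 
    "g M - w M \<in> lincomb ?I Z (Suc M)" if "M > J" for M
    using that unfolding R_def by blast+
  have "\<not> inj_on w {Suc J..}"
  proof
    assume inj: "inj_on w {Suc J..}"
    have "w ` {Suc J..} \<subseteq> lincomb ?W Z J" using gw(3) by auto
    hence "finite {Suc J..}" using fin inj by (meson finite_imageD finite_subset)
    thus False by (simp add: infinite_Ici)
  qed
  then obtain M M' where MM: "M > J" "M' > J" "M < M'" "w M = w M'"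
    unfolding inj_on_def by (metis atLeast_iff less_eq_Suc_le linorder_neqE_nat)
  have g: "degree (g M) = M" "degree (g M') = M'" using gw[of M] gw[of M'] MM by auto
  have "g M' - g M \<noteq> 0" using g MM by auto
  moreover have "g M' - g M \<in> lincomb ?A Y (Suc M')"
    using gw(2)[OF MM(1)] gw(2)[OF MM(2)] MM(3)
    by (intro lincomb_diff A lincomb_mono[OF A(1), of "Suc M" "Suc M'" "g M"]) auto
  moreover have "(g M' - w M') - (g M - w M) \<in> lincomb ?I Z (Suc M')"
    using gw(4)[OF MM(1)] gw(4)[OF MM(2)] MM(3)
    by (intro lincomb_diff[where f = "g M' - w M'" and g = "g M - w M"] I
        lincomb_mono[OF I(1), of "Suc M" "Suc M'" "g M - w M"]) auto
  ultimately show ?thesis using MM(4) by (intro exI[of _ "Suc M'"] exI[of _ "g M' - g M"]) simp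
qed

section \<open>Lattices modulo a polynomial\<close>

text \<open>The two instances below are the polynomials in t, which are integral at the finite
  places, and the valuation ring at infinity. Both have the whole field as field of
  fractions.\<close>

definition subr :: "'k::comm_ring_1 set \<Rightarrow> bool" where
  "subr A \<longleftrightarrow> 1 \<in> A \<and> (\<forall>x\<in>A. \<forall>y\<in>A. x + y \<in> A \<and> x * y \<in> A) \<and> (\<forall>x\<in>A. - x \<in> A)"

lemma subrD:
  assumes "subr A"
  shows "1 \<in> A" "0 \<in> A" "\<And>x y. x \<in> A \<Longrightarrow> y \<in> A \<Longrightarrow> x + y \<in> A"
    "\<And>x y. x \<in> A \<Longrightarrow> y \<in> A \<Longrightarrow> x * y \<in> A" "\<And>x. x \<in> A \<Longrightarrow> - x \<in> A" "\<And>x k. x \<in> A \<Longrightarrow> x ^ k \<in> A"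
proof -
  show *: "1 \<in> A" "\<And>x y. x \<in> A \<Longrightarrow> y \<in> A \<Longrightarrow> x + y \<in> A"
    "\<And>x y. x \<in> A \<Longrightarrow> y \<in> A \<Longrightarrow> x * y \<in> A" "\<And>x. x \<in> A \<Longrightarrow> - x \<in> A"
    using assms unfolding subr_def by auto
  show "0 \<in> A" using *(2)[OF *(1) *(4)[OF *(1)]] by simp
  show "x ^ k \<in> A" if "x \<in> A" for x k using that by (induction k) (auto intro: *)
qed

lemma common_denominator:
  fixes A :: "'k::field set"
  assumes A: "subr A" and frac: "\<And>x. \<exists>s\<in>A. s \<noteq> 0 \<and> s * x \<in> A" and B: "finite B"
  shows "\<exists>s\<in>A. s \<noteq> 0 \<and> (\<forall>x\<in>B. s * x \<in> A)"
  using B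
proof induction
  case empty
  show ?case using subrD(1)[OF A] by (intro bexI[of _ 1]) auto
next
  case (insert x B)
  then obtain s where s: "s \<in> A" "s \<noteq> 0" "\<forall>x\<in>B. s * x \<in> A" by blast
  obtain u where u: "u \<in> A" "u \<noteq> 0" "u * x \<in> A" using frac by blast
  have "s * u * y \<in> A" if "y \<in> insert x B" for y
  proof (cases "y = x")
    case True
    have "s * (u * x) \<in> A" by (rule subrD(4)[OF A s(1) u(3)])
    thus ?thesis using True by (simp add: mult.assoc)
  next
    case False
    hence "s * y \<in> A" using that s(3) by blast
    hence "u * (s * y) \<in> A" by (rule subrD(4)[OF A u(1)])
    thus ?thesis by (simp add: mult_ac)
  qed
  moreover have "s * u \<in> A" by (rule subrD(4)[OF A s(1) u(1)])
  ultimately show ?case using s u by (intro bexI[of _ "s * u"]) auto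
qed

inductive_set lat :: "'k::field set \<Rightarrow> 'k poly set \<Rightarrow> 'k poly \<Rightarrow> 'k poly set" for A V h where
  lat_0: "0 \<in> lat A V h"
| lat_gen: "f \<in> lat A V h \<Longrightarrow> v \<in> V \<Longrightarrow> c \<in> A \<Longrightarrow> smult c v + f \<in> lat A V h"
| lat_mod: "f \<in> lat A V h \<Longrightarrow> h * k + f \<in> lat A V h"

lemma lat_add:
  assumes "f \<in> lat A V h" "g \<in> lat A V h"
  shows "f + g \<in> lat A V h"
  using assms by induction (auto simp: add.assoc intro: lat.intros)

lemma lat_smult:
  assumes A: "subr A" and "c \<in> A" "f \<in> lat A V h"
  shows "smult c f \<in> lat A V h"
  using assms(3)
proof induction
  case (lat_gen f v d)
  have "smult (c * d) v + smult c f \<in> lat A V h"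
    by (intro lat.lat_gen lat_gen subrD[OF A] assms)
  thus ?case by (simp add: smult_add_right)
next
  case (lat_mod f k)
  from lat.lat_mod[OF this(2), of "smult c k"] show ?case by (simp add: smult_add_right)
qed (auto intro: lat.lat_0)

lemma lat_base:
  assumes "subr A" "v \<in> V"
  shows "v \<in> lat A V h"
  using lat_gen[OF lat_0 assms(2) subrD(1)[OF assms(1)]] by simp

lemma lat_uminus: "subr A \<Longrightarrow> f \<in> lat A V h \<Longrightarrow> - f \<in> lat A V h"
  using lat_smult[of A "-1" f V h] subrD(1,5)[of A] by simp

lemma lat_diff: "subr A \<Longrightarrow> f \<in> lat A V h \<Longrightarrow> g \<in> lat A V h \<Longrightarrow> f - g \<in> lat A V h"
  using lat_add[of f A V h "- g"] lat_uminus by (metis add_uminus_conv_diff)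

lemma lat_sum:
  "(\<And>i. i \<in> I \<Longrightarrow> f i \<in> lat A V h) \<Longrightarrow> sum f I \<in> lat A V h"
  by (induction I rule: infinite_finite_induct) (auto intro: lat_0 lat_add)

lemma lat_dvd: "h dvd g \<Longrightarrow> g \<in> lat A V h"
  using lat_mod[OF lat_0] by (auto simp: dvd_def)

lemma lat_times:
  assumes A: "subr A" and "\<And>v. v \<in> V \<Longrightarrow> g * v \<in> lat A V h" and "f \<in> lat A V h"
  shows "g * f \<in> lat A V h"
  using assms(3)
proof induction
  case lat_0
  show ?case by (simp add: lat.lat_0)
next
  case (lat_gen f v d)
  have "smult d (g * v) + g * f \<in> lat A V h"
    by (intro lat_add lat_smult A lat_gen assms)
  thus ?case by (simp add: algebra_simps)
next
  case (lat_mod f k)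
  from lat.lat_mod[OF this(2), of "g * k"] show ?case by (simp add: algebra_simps)
qed

text \<open>Reduction modulo \<open>h\<close> removes the multiples of \<open>h\<close>. What is
  left is an \<open>A\<close>-combination of the remainders of finitely many generators, which have
  a common denominator.\<close>

lemma lat_bounded:
  fixes A :: "'k::field set"
  assumes A: "subr A" and frac: "\<And>x. \<exists>s\<in>A. s \<noteq> 0 \<and> s * x \<in> A" and V: "finite V"
  shows "\<exists>s\<in>A. s \<noteq> 0 \<and> (\<forall>f \<in> lat A V h. \<forall>i. s * coeff (f mod h) i \<in> A)"
proof -
  let ?X = "insert 0 (\<Union>v\<in>V. coeff (v mod h) ` {..degree (v mod h)})"
  have "finite ?X" using V by auto
  from common_denominator[OF A frac this] obtain s where
    s: "s \<in> A" "s \<noteq> 0" "\<And>x. x \<in> ?X \<Longrightarrow> s * x \<in> A" by blast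
  have sv: "s * coeff (v mod h) i \<in> A" if "v \<in> V" for v i
    using that by (cases "i \<le> degree (v mod h)") (auto intro!: s(3) simp: coeff_eq_0 subrD[OF A])
  have "s * coeff (f mod h) i \<in> A" if "f \<in> lat A V h" for f i
    using that
  proof induction
    case (lat_gen f v c)
    have "c * (s * coeff (v mod h) i) + s * coeff (f mod h) i \<in> A"
      by (intro subrD[OF A] lat_gen sv)
    thus ?case by (simp add: poly_mod_add_left mod_smult_left algebra_simps)
  qed (auto simp: subrD[OF A])
  thus ?thesis using s by blast
qed

section \<open>Stability of a lattice under multiplication by the orbit\<close>

lemma smult_sum_right: "smult c (sum f A) = (\<Sum>i\<in>A. smult c (f i))"
  by (induction A rule: infinite_finite_induct) (auto simp: smult_add_right)

lemma multiset_count_ge: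
  assumes "set_mset M \<subseteq> {..<n::nat}" "size M > n * k"
  obtains i where "i < n" "count M i > k"
proof (rule ccontr)
  assume "\<not> thesis"
  hence le: "\<And>i. i < n \<Longrightarrow> count M i \<le> k" using that by force
  have "size M = (\<Sum>i\<in>set_mset M. count M i)" by (simp add: size_multiset_overloaded_eq)
  also have "\<dots> \<le> (\<Sum>i<n. count M i)" by (rule sum_mono2) (use assms in auto)
  also have "\<dots> \<le> (\<Sum>i<n. k)" by (rule sum_mono) (use le in auto)
  finally show False using assms(2) by simp
qed

lemma finite_msets_bounded: "finite I \<Longrightarrow> finite {M. set_mset M \<subseteq> I \<and> size M \<le> D}"
proof -
  assume "finite I"
  hence "finite (mset ` {xs. set xs \<subseteq> I \<and> length xs \<le> D})" by (intro finite_imageI finite_lists_length_le)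
  moreover have "{M. set_mset M \<subseteq> I \<and> size M \<le> D} \<subseteq> mset ` {xs. set xs \<subseteq> I \<and> length xs \<le> D}"
  proof
    fix M assume M: "M \<in> {M. set_mset M \<subseteq> I \<and> size M \<le> D}"
    obtain xs where "M = mset xs" by (metis ex_mset)
    thus "M \<in> mset ` {xs. set xs \<subseteq> I \<and> length xs \<le> D}" using M by auto
  qed
  ultimately show ?thesis by (rule finite_subset[rotated])
qed

text \<open>The recursion is solved for the \<open>Q\<close>-th power, and \<open>l\<close> is
  eliminated through \<open>x1\<close>, which is linear in \<open>l\<close>. In the scaled points
  the right side has degree at most \<open>q + 1 < Q\<close>; the spare factors \<open>s\<close>
  clear the denominators of the coefficients.\<close>

lemma scaled_power_relation:
  fixes x x' x1 l :: "'k::field poly"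
  assumes x': "x' = [:t:] * x + l * x ^ q + x ^ Q" and l: "smult b x1 = l + [:b * c:]" and qQ: "q + 2 \<le> Q"
  shows "smult s x ^ Q = smult (s ^ (Q - 1)) (smult s x') - smult (s ^ (Q - 1) * t) (smult s x)
     - smult (s ^ (Q - q - 1) * b) (smult s x1 * smult s x ^ q)
     + smult (s ^ (Q - q - 1) * b * (s * c)) (smult s x ^ q)"
proof -
  have s1: "s ^ (Q - 1) * s = s ^ Q" "s ^ (Q - q - 1) * s * s ^ q = s ^ Q"
    using qQ by (simp_all flip: power_Suc power_Suc2 power_add)
  have e: "x ^ Q = x' - [:t:] * x - (smult b x1 - [:b * c:]) * x ^ q" unfolding x' l by (simp add: algebra_simps)
  have 1: "smult (s ^ (Q - 1)) (smult s x') = smult (s ^ Q) x'" by (simp only: smult_smult s1)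
  have "smult (s ^ (Q - 1) * t) (smult s x) = smult (s ^ (Q - 1) * s * t) x" by (simp add: mult_ac)
  hence 2: "smult (s ^ (Q - 1) * t) (smult s x) = smult (s ^ Q * t) x" by (simp only: s1)
  have "smult (s ^ (Q - q - 1) * b) (smult s x1 * smult s x ^ q)
      = smult ((s ^ (Q - q - 1) * s * s ^ q) * b) (x1 * x ^ q)" by (simp add: smult_power mult_ac)
  hence 3: "smult (s ^ (Q - q - 1) * b) (smult s x1 * smult s x ^ q) = smult (s ^ Q * b) (x1 * x ^ q)"
    by (simp only: s1)
  have "smult (s ^ (Q - q - 1) * b * (s * c)) (smult s x ^ q)
      = smult ((s ^ (Q - q - 1) * s * s ^ q) * (b * c)) (x ^ q)" by (simp add: smult_power mult_ac)
  hence 4: "smult (s ^ (Q - q - 1) * b * (s * c)) (smult s x ^ q) = smult (s ^ Q * (b * c)) (x ^ q)"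
    by (simp only: s1)
  have 0: "smult s x ^ Q = smult (s ^ Q) (x' - [:t:] * x - (smult b x1 - [:b * c:]) * x ^ q)"
    by (simp only: smult_power e)
  show ?thesis unfolding 0 1 2 3 4
    by (simp add: algebra_simps smult_add_right smult_diff_right)
qed

lemma orbp_power_relation:
  fixes a s t :: "'k::field"
  assumes a: "a \<noteq> 0" and qQ: "q + 2 \<le> Q"
  defines "y \<equiv> \<lambda>i. smult s (orbp q Q t a i)"
  shows "y i ^ Q = smult (s ^ (Q - 1)) (y (Suc i)) - smult (s ^ (Q - 1) * t) (y i)
     - smult (s ^ (Q - q - 1) * inverse a ^ q) (y (Suc 0) * y i ^ q)
     + smult (s ^ (Q - q - 1) * inverse a ^ q * (s * (t * a + a ^ Q))) (y i ^ q)"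
  unfolding y_def
proof (rule scaled_power_relation[OF _ _ qQ])
  have "orbp q Q t a (Suc 0) = [:t * a + a ^ Q, a ^ q:]" by (simp add: poly_const_pow algebra_simps)
  thus "smult (inverse a ^ q) (orbp q Q t a (Suc 0)) = [:0, 1:] + [:inverse a ^ q * (t * a + a ^ Q):]"
    using a by (simp add: field_simps)
qed (rule orb.simps)

text \<open>
  The witness \<open>V\<close> consists of the monomials of bounded total degree in the first \<open>n\<close> points: a monomial
  of larger degree contains a \<open>Q\<close>-th power, which \<open>orbp_power_relation\<close> rewrites into terms of lower degree.
\<close>

lemma orbp_stable_lattice:
  fixes a s t :: "'k::field"
  assumes A: "subr A" and nz: "a \<noteq> 0" "s \<noteq> 0" and qQ: "q + 2 \<le> Q" and n: "n > 0"
    and sA: "s \<in> A" "s * t \<in> A" "s * a \<in> A" "s * t * a \<in> A" "s * a ^ Q \<in> A" "s * inverse a ^ q \<in> A"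
    and red: "\<And>k. \<exists>c. (\<forall>i. c i \<in> A) \<and> h dvd (orbp q Q t a (n + k) - (\<Sum>i<n. smult (c i) (orbp q Q t a (i + k))))"
  shows "\<exists>V. finite V \<and> 1 \<in> V \<and> (\<forall>i. \<forall>f \<in> lat A V h. smult s (orbp q Q t a i) * f \<in> lat A V h)"
proof -
  define y where "y = (\<lambda>i. smult s (orbp q Q t a i))"
  define P where "P = (\<lambda>M. prod_mset (image_mset y M))"
  \<comment> \<open>By pigeonhole, a monomial of degree \<open>D + 1\<close> in \<open>n\<close>
    variables contains some variable at least \<open>Q\<close> times.\<close>
  define D where "D = n * Q + Q"
  define V where "V = P ` {M. set_mset M \<subseteq> {..<n} \<and> size M \<le> D}"
  let ?L = "lat A V h"
  have finV: "finite V" unfolding V_def by (intro finite_imageI finite_msets_bounded) simp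
  have V1: "1 \<in> V" unfolding V_def by (rule image_eqI[of _ _ "{#}"]) (auto simp: P_def)
  have PV: "P M \<in> ?L" if "set_mset M \<subseteq> {..<n}" "size M \<le> D" for M
    by (rule lat_base[OF A]) (use that in \<open>auto simp: V_def\<close>)
  have P_add: "P (add_mset i M) = y i * P M" for i M by (simp add: P_def)
  have P_rep: "P (replicate_mset k i + M) = y i ^ k * P M" for i k M by (simp add: P_def)
  have red_y: "\<exists>c. (\<forall>i. c i \<in> A) \<and> h dvd (y (n + k) - (\<Sum>i<n. smult (c i) (y (i + k))))" for k
  proof -
    obtain c where c: "\<forall>i. c i \<in> A" "h dvd (orbp q Q t a (n + k) - (\<Sum>i<n. smult (c i) (orbp q Q t a (i + k))))"
      using red by blast
    have "y (n + k) - (\<Sum>i<n. smult (c i) (y (i + k)))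
        = smult s (orbp q Q t a (n + k) - (\<Sum>i<n. smult (c i) (orbp q Q t a (i + k))))"
      by (simp add: y_def smult_diff_right smult_sum_right mult.commute)
    moreover have "h dvd smult s (orbp q Q t a (n + k) - (\<Sum>i<n. smult (c i) (orbp q Q t a (i + k))))"
      by (rule dvd_smult[OF c(2)])
    ultimately show ?thesis using c(1) by (intro exI[of _ c]) simp
  qed
  \<comment> \<open>The case \<open>j = n\<close> is included because rewriting a power of
    \<open>y i\<close> produces \<open>y (Suc i)\<close>; there \<open>y n\<close> is replaced by
    earlier points modulo \<open>h\<close>.\<close>
  have yP: "y j * P M \<in> ?L" if M: "set_mset M \<subseteq> {..<n}" "size M < D" and j: "j \<le> n" for j M
  proof (cases "j < n")
    case True
    thus ?thesis using PV[of "add_mset j M"] M by (simp add: P_add)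
  next
    case False
    obtain c where c: "\<forall>i. c i \<in> A" "h dvd (y n - (\<Sum>i<n. smult (c i) (y i)))" using red_y[of 0] by auto
    have "h dvd (y n - (\<Sum>i<n. smult (c i) (y i))) * P M" using c(2) by (rule dvd_mult2)
    hence "(y n - (\<Sum>i<n. smult (c i) (y i))) * P M \<in> ?L" by (rule lat_dvd)
    moreover have "(\<Sum>i<n. smult (c i) (y i * P M)) \<in> ?L"
    proof (intro lat_sum lat_smult A)
      fix i assume "i \<in> {..<n}"
      thus "y i * P M \<in> ?L" using PV[of "add_mset i M"] M by (simp add: P_add)
    qed (use c in auto)
    ultimately have "(y n - (\<Sum>i<n. smult (c i) (y i))) * P M + (\<Sum>i<n. smult (c i) (y i * P M)) \<in> ?L"
      by (rule lat_add)
    moreover have "j = n" using False j by simp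
    ultimately show ?thesis by (simp add: left_diff_distrib sum_distrib_right)
  qed
  have rel: "y i ^ Q = smult (s ^ (Q - 1)) (y (Suc i)) - smult (s ^ (Q - 1) * t) (y i)
     - smult (s ^ (Q - q - 1) * inverse a ^ q) (y (Suc 0) * y i ^ q)
     + smult (s ^ (Q - q - 1) * inverse a ^ q * (s * (t * a + a ^ Q))) (y i ^ q)" for i
    unfolding y_def by (rule orbp_power_relation[OF nz(1) qQ])
  have c: "s * (t * a + a ^ Q) \<in> A"
    using subrD(3)[OF A sA(4,5)] by (simp add: algebra_simps)
  \<comment> \<open>Since \<open>q + 2 \<le> Q\<close>, one factor \<open>s\<close> remains to
    absorb the denominator of \<open>inverse a ^ q\<close>.\<close>
  have w: "s ^ (Q - q - 1) * inverse a ^ q \<in> A"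
  proof -
    have "s ^ (Q - q - 1) = s ^ (Q - q - 2) * s" using qQ by (simp flip: power_Suc2 add: Suc_diff_Suc numeral_2_eq_2)
    hence "s ^ (Q - q - 1) * inverse a ^ q = s ^ (Q - q - 2) * (s * inverse a ^ q)" by simp
    moreover have "\<dots> \<in> A" by (intro subrD[OF A] sA)
    ultimately show ?thesis by (simp only:)
  qed
  have st: "s ^ (Q - 1) * t \<in> A"
  proof -
    have "s ^ (Q - 1) = s ^ (Q - 2) * s" using qQ by (simp flip: power_Suc2 add: Suc_diff_Suc numeral_2_eq_2)
    hence "s ^ (Q - 1) * t = s ^ (Q - 2) * (s * t)" by simp
    moreover have "\<dots> \<in> A" by (intro subrD[OF A] sA)
    ultimately show ?thesis by (simp only:)
  qed
  have yV: "y j * P M \<in> ?L" if M: "set_mset M \<subseteq> {..<n}" "size M \<le> D" and j: "j < n" for j M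
  proof (cases "size M < D")
    case True
    thus ?thesis using yP[of M j] M j by simp
  next
    case False
    let ?M = "add_mset j M"
    have "n * (Q - 1) \<le> n * Q" by (intro mult_left_mono) auto
    hence sz': "size ?M > n * (Q - 1)" using M False D_def unfolding size_add_mset by linarith
    have sub: "set_mset ?M \<subseteq> {..<n}" using M j by auto
    obtain i where i: "i < n" "count ?M i > Q - 1" by (rule multiset_count_ge[OF sub sz'])
    define M' where "M' = ?M - replicate_mset Q i"
    have le: "replicate_mset Q i \<subseteq># ?M" using i by (simp add: count_le_replicate_mset_subset_eq[symmetric])
    hence eq: "?M = replicate_mset Q i + M'" unfolding M'_def by simp
    have sM': "set_mset M' \<subseteq> {..<n}" unfolding M'_def using sub in_diffD by fastforce
    have "size ?M = Q + size M'" using arg_cong[OF eq, of size] by simp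
    hence sz: "size M' + Q = D + 1" using M False by simp
    have DQ: "D \<ge> Q" "q + 2 \<le> Q" using D_def qQ by auto
    \<comment> \<open>After the replacement, every monomial that is multiplied by a further point
      has degree below \<open>D\<close>, so \<open>yP\<close> applies.\<close>
    have "P ?M = y i ^ Q * P M'" unfolding eq P_rep ..
    also have "\<dots> = smult (s ^ (Q - 1)) (y (Suc i) * P M') - smult (s ^ (Q - 1) * t) (y i * P M')
     - smult (s ^ (Q - q - 1) * inverse a ^ q) (y (Suc 0) * P (replicate_mset q i + M'))
     + smult (s ^ (Q - q - 1) * inverse a ^ q * (s * (t * a + a ^ Q))) (P (replicate_mset q i + M'))"
      unfolding rel P_rep by (simp add: algebra_simps)
    also have "\<dots> \<in> ?L"
      using sz DQ i sM' sA n
      by (intro lat_add lat_diff lat_smult A yP PV w st c subrD[OF A]) (auto split: if_splits)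
    finally show ?thesis by (simp add: P_add)
  qed
  \<comment> \<open>Points from index \<open>n\<close> on are \<open>A\<close>-combinations of the
    \<open>n\<close> points before them, up to multiples of \<open>h\<close>, which lie in the
    lattice.\<close>
  have "\<forall>f \<in> ?L. y i * f \<in> ?L" for i
  proof (induction i rule: less_induct)
    case (less i)
    show ?case
    proof (cases "i < n")
      case True
      show ?thesis
      proof
        fix f assume "f \<in> ?L"
        thus "y i * f \<in> ?L" by (rule lat_times[OF A, rotated]) (use yV True in \<open>auto simp: V_def\<close>)
      qed
    next
      case False
      define k where "k = i - n"
      have i: "i = n + k" using False k_def by simp
      obtain c where c: "\<forall>i. c i \<in> A" "h dvd (y (n + k) - (\<Sum>i<n. smult (c i) (y (i + k))))" using red_y by blast
      show ?thesis
      proof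
        fix f assume f: "f \<in> ?L"
        have "(y (n + k) - (\<Sum>i<n. smult (c i) (y (i + k)))) * f \<in> ?L"
          by (rule lat_dvd) (use c in auto)
        moreover have "(\<Sum>j<n. smult (c j) (y (j + k) * f)) \<in> ?L"
          using less.IH f c by (intro lat_sum lat_smult A) (auto simp: i)
        ultimately have "(y (n + k) - (\<Sum>i<n. smult (c i) (y (i + k)))) * f + (\<Sum>j<n. smult (c j) (y (j + k) * f)) \<in> ?L"
          by (rule lat_add)
        thus "y i * f \<in> ?L" unfolding i by (simp add: left_diff_distrib sum_distrib_right)
      qed
    qed
  qed
  thus ?thesis using finV V1 unfolding y_def by blast
qed

section \<open>Nilpotency of the auxiliary polynomial\<close>

lemma lat_times_power:
  assumes "\<And>f. f \<in> lat A V h \<Longrightarrow> g * f \<in> lat A V h" "f \<in> lat A V h"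
  shows "g ^ k * f \<in> lat A V h"
  using assms(2) by (induction k) (auto simp: mult.assoc intro: assms(1))

lemma lat_times_lincomb:
  assumes A: "subr A" and u: "\<And>f. f \<in> lat A V h \<Longrightarrow> u * f \<in> lat A V h"
    and v: "\<And>f. f \<in> lat A V h \<Longrightarrow> v * f \<in> lat A V h"
    and g: "g \<in> lincomb A (\<lambda>j. u ^ d j * v ^ e j) N" and f: "f \<in> lat A V h"
  shows "g * f \<in> lat A V h"
proof -
  obtain c where c: "g = (\<Sum>j<N. smult (c j) (u ^ d j * v ^ e j))" "\<forall>j. c j \<in> A"
    using g unfolding lincomb_def by blast
  have "u ^ d j * (v ^ e j * f) \<in> lat A V h" for j
    by (intro lat_times_power u v f)
  hence "(\<Sum>j<N. smult (c j) (u ^ d j * (v ^ e j * f))) \<in> lat A V h"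
    by (intro lat_sum lat_smult A) (use c in auto)
  thus ?thesis by (simp add: c sum_distrib_right mult.assoc)
qed

section \<open>Integrality at the finite places and at infinity\<close>

lemma subr_range_to_fract: "subr (range to_fract)"
  unfolding subr_def using rangeI[of to_fract 1]
  by (auto simp flip: to_fract_add to_fract_mult to_fract_uminus)

lemma frac_range_to_fract: "\<exists>s\<in>range to_fract. s \<noteq> 0 \<and> s * x \<in> range to_fract"
proof -
  obtain P Q where "x = Fract P Q" "Q \<noteq> 0" by (cases x)
  hence "to_fract Q * x = to_fract P" by (simp add: Fract_conv_to_fract)
  thus ?thesis using \<open>Q \<noteq> 0\<close> by (intro bexI[of _ "to_fract Q"]) auto
qed

lemma subr_ideg_le: "subr {x. ideg_le 0 x}"
  unfolding subr_def using ideg_le_to_fract[of 0 1] ideg_le_mult[of 0 _ 0] by (auto intro: ideg_le_add ideg_le_uminus)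

lemma ideg_le_inverse_monom: "ideg_le (- int m) (inverse (to_fract (monom 1 m)))"
proof -
  have "inverse (to_fract (monom 1 m)) = Fract 1 (monom 1 m :: 'a poly)"
    by (simp add: Fract_conv_to_fract inverse_eq_divide)
  thus ?thesis unfolding ideg_le_def
    by (intro exI[of _ 1] exI[of _ "monom 1 m"]) (auto simp: degree_monom_eq)
qed

lemma frac_ideg_le: "\<exists>s\<in>{x. ideg_le 0 x}. s \<noteq> 0 \<and> s * x \<in> {x. ideg_le 0 x}"
proof -
  obtain m where m: "m \<ge> 0" "ideg_le m x" by (rule ideg_le_ex)
  let ?s = "inverse (to_fract (monom 1 (nat m)))"
  have "ideg_le (- m) ?s" using ideg_le_inverse_monom[of "nat m"] m by simp
  hence "ideg_le 0 ?s" "ideg_le 0 (?s * x)" using ideg_le_mult[of "- m" ?s m x] m by (auto intro: ideg_le_mono)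
  thus ?thesis by (intro bexI[of _ ?s]) auto
qed

text \<open>Collects the integrality conditions of \<open>orbp_stable_lattice\<close>, for finite
  places and infinity alike.\<close>

lemma scaling_factor:
  fixes A :: "'k::field set"
  assumes A: "subr A" and frac: "\<And>x. \<exists>s\<in>A. s \<noteq> 0 \<and> s * x \<in> A"
  obtains s where "s \<in> A" "s \<noteq> 0" "s * t \<in> A" "s * a \<in> A" "s * t * a \<in> A" "s * a ^ Q \<in> A" "s * inverse a ^ q \<in> A"
proof -
  obtain s where "s \<in> A" "s \<noteq> 0" "\<forall>x \<in> {t, a, t * a, a ^ Q, inverse a ^ q}. s * x \<in> A"
    using common_denominator[OF A frac, of "{t, a, t * a, a ^ Q, inverse a ^ q}"] by blast
  thus ?thesis using that by (auto simp: mult.assoc)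
qed

lemma to_fract_monom: "to_fract (monom 1 k :: 'a::idom poly) = to_fract (monom 1 1) ^ k"
proof (induction k)
  case (Suc k)
  have "to_fract (monom 1 (Suc k) :: 'a poly) = to_fract (monom 1 1 * monom 1 k)" by (simp add: mult_monom)
  thus ?case by (simp only: to_fract_mult Suc power_Suc)
qed simp

text \<open>\<open>G\<close> is chosen before \<open>n\<close> and \<open>h\<close>. It preserves a
  lattice over the polynomials built from \<open>a\<close>, and its product with the indeterminate
  preserves one over the valuation ring at infinity built from \<open>b\<close>. Hence the
  coefficients of \<open>G ^ k mod h\<close> have bounded denominators at the finite places, while
  their degree bound at infinity decreases with \<open>k\<close>; for large \<open>k\<close> they
  vanish.\<close>

lemma ex_nilpotent_polynomial:
  fixes a b t :: "'a::{field,finite} poly fract"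
  assumes nz: "a \<noteq> 0" "b \<noteq> 0" and ab: "ideg_le (-1) (a / b)" and q: "1 \<le> q" "q + 2 \<le> Q"
  shows "\<exists>G. G \<noteq> 0 \<and> (\<forall>n h. n > 0 \<longrightarrow> h \<noteq> 0 \<longrightarrow>
    (\<forall>x\<in>{a, b}. \<forall>k. \<exists>c. h dvd (orbp q Q t x (n + k)
        - (\<Sum>i<n. smult (to_fract [:c i:]) (orbp q Q t x (i + k))))) \<longrightarrow> (\<exists>k. h dvd G ^ k))"
proof -
  let ?A = "range (to_fract :: 'a poly \<Rightarrow> _)" and ?B = "{x :: 'a poly fract. ideg_le 0 x}"
  note A = subr_range_to_fract[where ?'a = "'a poly"] and B = subr_ideg_le[where ?'a = 'a]
  obtain s where s: "s \<in> ?A" "s \<noteq> 0" "s * t \<in> ?A" "s * a \<in> ?A" "s * t * a \<in> ?A" "s * a ^ Q \<in> ?A" "s * inverse a ^ q \<in> ?A"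
    by (rule scaling_factor[OF A frac_range_to_fract])
  obtain s' where s': "s' \<in> ?B" "s' \<noteq> 0" "s' * t \<in> ?B" "s' * b \<in> ?B" "s' * t * b \<in> ?B" "s' * b ^ Q \<in> ?B" "s' * inverse b ^ q \<in> ?B"
    by (rule scaling_factor[OF B frac_ideg_le])
  obtain m where m: "m \<ge> 0" "ideg_le m (s / s')" by (rule ideg_le_ex)
  define c where "c = nat m"
  have c: "ideg_le (int c) (s / s')" using m c_def by simp
  \<comment> \<open>\<open>P\<close> is the degree of the orbit point with index
    \<open>Suc (2 * c)\<close>. Each factor of a basis element costs up to \<open>c\<close> at
    infinity through the scalars, so factors of degree \<open>P \<ge> 2 * c\<close> cost at most one
    half per degree.\<close>
  define P where "P = Q ^ (2 * c)"
  have P: "P > 0" "2 * c \<le> P"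
  proof -
    have "2 * c \<le> 2 ^ (2 * c)" by (simp add: less_imp_le)
    also have "\<dots> \<le> Q ^ (2 * c)" by (rule power_mono) (use q in auto)
    finally show "2 * c \<le> P" by (simp add: P_def)
    show "P > 0" using q by (simp add: P_def)
  qed
  define y where "y = (\<lambda>s a i. smult s (orbp q Q t a i))"
  \<comment> \<open>Products of only two orbit points, of degrees \<open>P\<close> and 1, realize
    every degree \<open>j\<close> with few factors. The same shape serves \<open>a\<close> with
    \<open>s\<close> and \<open>b\<close> with \<open>s'\<close>.\<close>
  define Y where "Y = (\<lambda>s a j. y s a (Suc (2 * c)) ^ (j div P) * y s a (Suc 0) ^ (j mod P))"
  have Y: "degree (Y s a j) = j" "lead_coeff (Y s a j) = s ^ (j div P + j mod P) * a ^ (q * j)"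
    if "s \<noteq> 0" "a \<noteq> 0" for s a j
  proof -
    have d: "degree (y s a (Suc i)) = Q ^ i" "lead_coeff (y s a (Suc i)) = s * a ^ (q * Q ^ i)" for i
      using degree_orbp[OF that(2) q, of t i] that by (auto simp: y_def simp del: orb.simps)
    have nz: "y s a (Suc i) \<noteq> 0" for i using d[of i] that
      by (metis leading_coeff_0_iff mult_eq_0_iff power_not_zero)
    have "degree (Y s a j) = (j div P) * P + j mod P"
      unfolding Y_def using nz d(1) by (simp add: degree_mult_eq degree_power_eq P_def)
    thus "degree (Y s a j) = j" by simp
    have "lead_coeff (Y s a j) = (s * a ^ (q * P)) ^ (j div P) * (s * a ^ q) ^ (j mod P)"
      unfolding Y_def lead_coeff_mult lead_coeff_power d(2) by (simp add: P_def)
    also have "\<dots> = s ^ (j div P + j mod P) * a ^ (q * (P * (j div P) + j mod P))"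
    proof -
      have "(s * a ^ (q * P)) ^ u * (s * a ^ q) ^ v = s ^ (u + v) * a ^ (q * (P * u + v))" for u v
        by (simp add: power_mult_distrib power_add distrib_left mult_ac flip: power_mult)
      thus ?thesis .
    qed
    also have "P * (j div P) + j mod P = j" by simp
    finally show "lead_coeff (Y s a j) = s ^ (j div P + j mod P) * a ^ (q * j)" .
  qed
  define U where "U = (\<lambda>j. (s / s') ^ (j div P + j mod P) * (a / b) ^ (q * j))"
  \<comment> \<open>The scalars lose \<open>c\<close> per factor, while each of the
    \<open>q * j\<close> factors \<open>a / b\<close> gains at least 1; for large \<open>j\<close>
    the gain wins.\<close>
  define \<beta> where "\<beta> = (\<lambda>j. int c * int (j div P + j mod P) - int (q * j))"
  have dU: "ideg_le (\<beta> j) (U j)" for j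
    using ideg_le_mult[OF ideg_le_power[OF c, of "j div P + j mod P"] ideg_le_power[OF ab, of "q * j"]]
    by (simp add: U_def \<beta>_def)
  have \<beta>: "\<beta> j \<le> -1" if j: "j \<ge> 2 * c * P + 2" for j
  proof -
    have "2 * c * (j div P) \<le> P * (j div P)" by (rule mult_right_mono) (use P in auto)
    also have "\<dots> \<le> j" by simp
    finally have 1: "2 * c * (j div P) \<le> j" .
    have "2 * c * (j mod P) \<le> 2 * c * P" by (rule mult_left_mono) (use P less_imp_le in auto)
    hence "2 * c * (j div P + j mod P) + 2 \<le> j + j" using 1 j unfolding distrib_left by linarith
    also have "\<dots> \<le> 2 * (q * j)" using mult_le_mono1[OF q(1), of j] by linarith
    finally have "int (2 * c * (j div P + j mod P) + 2) \<le> int (2 * (q * j))" by (simp only: of_nat_le_iff)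
    thus ?thesis unfolding \<beta>_def by (simp add: algebra_simps)
  qed
  have Z0: "lead_coeff (Y s' b j) \<noteq> 0" for j using Y(2)[OF s'(2) nz(2)] s' nz by simp
  have U: "lead_coeff (Y s a j) = U j * lead_coeff (Y s' b j)" "U j \<noteq> 0" for j
    unfolding Y(2)[OF s(2) nz(1)] Y(2)[OF s'(2) nz(2)] U_def using s s' nz by (auto simp: power_divide)
  obtain N G where G: "G \<noteq> 0" "G \<in> lincomb ?A (Y s a) N" "G \<in> lincomb {x. ideg_le (-1) x} (Y s' b) N"
    using auxiliary_polynomial[OF Y(1)[OF s(2) nz(1)] Y(1)[OF s'(2) nz(2)] Z0 U dU \<beta>] by blast
  show ?thesis
  proof (rule exI[of _ G], intro conjI allI impI G(1))
    fix n :: nat and h :: "'a poly fract poly"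
    assume n: "n > 0" and h: "h \<noteq> 0" and red: "\<forall>x\<in>{a, b}. \<forall>k. \<exists>c. h dvd (orbp q Q t x (n + k)
        - (\<Sum>i<n. smult (to_fract [:c i:]) (orbp q Q t x (i + k))))"
    have redA: "\<exists>c. (\<forall>i. c i \<in> ?A) \<and> h dvd (orbp q Q t a (n + k) - (\<Sum>i<n. smult (c i) (orbp q Q t a (i + k))))" for k
    proof -
      obtain c where "h dvd (orbp q Q t a (n + k) - (\<Sum>i<n. smult (to_fract [:c i:]) (orbp q Q t a (i + k))))"
        using red by blast
      thus ?thesis by (intro exI[of _ "\<lambda>i. to_fract [:c i:]"]) auto
    qed
    have redB: "\<exists>c. (\<forall>i. c i \<in> ?B) \<and> h dvd (orbp q Q t b (n + k) - (\<Sum>i<n. smult (c i) (orbp q Q t b (i + k))))" for k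
    proof -
      obtain c where "h dvd (orbp q Q t b (n + k) - (\<Sum>i<n. smult (to_fract [:c i:]) (orbp q Q t b (i + k))))"
        using red by blast
      thus ?thesis by (intro exI[of _ "\<lambda>i. to_fract [:c i:]"]) (auto simp: ideg_le_to_fract)
    qed
    obtain V where V: "finite V" "1 \<in> V" "\<And>i f. f \<in> lat ?A V h \<Longrightarrow> y s a i * f \<in> lat ?A V h"
      using orbp_stable_lattice[OF A nz(1) s(2) q(2) n s(1,3-) redA] unfolding y_def by blast
    obtain W where W: "finite W" "1 \<in> W" "\<And>i f. f \<in> lat ?B W h \<Longrightarrow> y s' b i * f \<in> lat ?B W h"
      using orbp_stable_lattice[OF B nz(2) s'(2) q(2) n s'(1,3-) redB] unfolding y_def by blast
    have "G * f \<in> lat ?A V h" if "f \<in> lat ?A V h" for f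
      by (rule lat_times_lincomb[OF A V(3) V(3) _ that]) (use G(2) in \<open>auto simp: Y_def\<close>)
    from lat_times_power[OF this lat_base[OF A V(2)]] have GA: "G ^ k \<in> lat ?A V h" for k by simp
    let ?t = "to_fract (monom 1 1) :: 'a poly fract"
    \<comment> \<open>The coefficients of \<open>G\<close> in this basis have degree at most -1 at
      infinity, which leaves room for one factor of the indeterminate.\<close>
    have "smult ?t G \<in> lincomb ?B (Y s' b) N"
    proof -
      obtain r where r: "G = (\<Sum>j<N. smult (r j) (Y s' b j))" "\<forall>j. ideg_le (-1) (r j)"
        using G(3) unfolding lincomb_def by blast
      have "ideg_le 1 ?t" by (simp add: ideg_le_to_fract degree_monom_eq)
      hence "ideg_le 0 (?t * r j)" for j using ideg_le_mult[of 1 ?t "-1" "r j"] r(2) by simp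
      thus ?thesis unfolding lincomb_def r(1)
        by (intro CollectI exI[of _ "\<lambda>j. ?t * r j"]) (simp add: smult_sum_right)
    qed
    hence "smult ?t G * f \<in> lat ?B W h" if "f \<in> lat ?B W h" for f
      by (intro lat_times_lincomb[OF B W(3) W(3) _ that]) (auto simp: Y_def)
    from lat_times_power[OF this lat_base[OF B W(2)]] 
    have GB: "smult (?t ^ k) (G ^ k) \<in> lat ?B W h" for k by (simp add: smult_power)
    from lat_bounded[OF A frac_range_to_fract V(1), of h]
    obtain d where d: "d \<in> ?A" "d \<noteq> 0" "\<forall>f \<in> lat ?A V h. \<forall>i. d * coeff (f mod h) i \<in> ?A"
      by (elim bexE conjE)
    from lat_bounded[OF B frac_ideg_le W(1), of h]
    obtain e where e: "e \<in> ?B" "e \<noteq> 0" "\<forall>f \<in> lat ?B W h. \<forall>i. e * coeff (f mod h) i \<in> ?B"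
      by (elim bexE conjE)
    obtain m where m: "m \<ge> 0" "ideg_le m (d / e)" by (rule ideg_le_ex)
    \<comment> \<open>\<open>m\<close> bounds the loss at infinity when the denominator
      \<open>e\<close> is exchanged for \<open>d\<close>. With one power more, the polynomial
      \<open>p\<close> below has degree bound -1 and is zero.\<close>
    define k where "k = Suc (nat m)"
    have "coeff (G ^ k mod h) i = 0" for i
    proof -
      let ?x = "coeff (G ^ k mod h) i"
      obtain p where p: "d * ?x = to_fract p" using d(3)[rule_format, OF GA, of k i] by auto
      have "ideg_le 0 (e * (?t ^ k * ?x))" using e(3)[rule_format, OF GB, of k i] by (simp add: mod_smult_left)
      from ideg_le_mult[OF m(2) this] have "ideg_le m (?t ^ k * (d * ?x))" using e(2) by (simp add: mult_ac)
      from ideg_le_mult[OF ideg_le_inverse_monom this] have "ideg_le (m - int k) (inverse (to_fract (monom 1 k)) * (?t ^ k * (d * ?x)))"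
        by simp
      moreover have "to_fract (monom 1 k) = ?t ^ k" by (rule to_fract_monom)
      moreover have "?t ^ k \<noteq> 0" by simp
      ultimately have "ideg_le (m - int k) (to_fract p)" by (simp only: p) (simp add: mult.assoc[symmetric])
      hence "p = 0" unfolding ideg_le_to_fract using m(1) by (auto simp: k_def)
      thus ?thesis using p d(2) by simp
    qed
    hence "G ^ k mod h = 0" by (intro poly_eqI) simp
    thus "\<exists>k. h dvd G ^ k" by (auto simp: dvd_eq_mod_eq_0)
  qed
qed

section \<open>A greatest common divisor of small height\<close>

lemma poly_bezout:
  fixes f g :: "'k::field poly"
  assumes "f \<noteq> 0"
  obtains h \<alpha> \<beta> f1 g1 where "h \<noteq> 0" "f = h * f1" "g = h * g1" "\<alpha> * f1 + \<beta> * g1 = 1"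
proof -
  define I where "I = {\<alpha> * f + \<beta> * g | \<alpha> \<beta>. True}"
  have "f \<in> I" unfolding I_def by (intro CollectI exI[of _ 1] exI[of _ 0]) simp
  moreover have "g \<in> I" unfolding I_def by (intro CollectI exI[of _ 0] exI[of _ 1]) simp
  ultimately obtain h where h: "h \<in> I" "h \<noteq> 0" "\<And>k. k \<in> I \<Longrightarrow> k \<noteq> 0 \<Longrightarrow> degree h \<le> degree k"
    using ex_has_least_nat[of "\<lambda>h. h \<in> I \<and> h \<noteq> 0" f degree] assms by blast
  from h(1) obtain \<alpha> \<beta> where hab: "h = \<alpha> * f + \<beta> * g" unfolding I_def by blast
  have "h dvd k" if "k \<in> I" for k
  proof -
    from that obtain u v where uv: "k = u * f + v * g" unfolding I_def by blast
    have "k mod h = (u - (k div h) * \<alpha>) * f + (v - (k div h) * \<beta>) * g"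
      unfolding minus_div_mult_eq_mod[symmetric] by (subst uv, subst hab) (simp add: uv[symmetric] algebra_simps)
    hence "k mod h \<in> I" unfolding I_def by blast
    hence "k mod h = 0" using h(3)[of "k mod h"] degree_mod_less[OF h(2), of k] by force
    thus ?thesis by (simp add: dvd_eq_mod_eq_0)
  qed
  with \<open>f \<in> I\<close> \<open>g \<in> I\<close> obtain f1 g1 where fg: "f = h * f1" "g = h * g1" by (meson dvdE)
  have "h * (\<alpha> * f1 + \<beta> * g1) = h * 1" using hab fg by (simp add: algebra_simps)
  hence "\<alpha> * f1 + \<beta> * g1 = 1" using h(2) by (simp only: mult_cancel_left) simp
  with that h(2) fg show ?thesis by blast
qed

lemma degree_fract_poly: "degree (fract_poly f) = degree f"
  by (simp add: degree_map_poly)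

section \<open>Degrees in t of polynomials in \<lambda>\<close>

definition cdeg_le :: "nat \<Rightarrow> 'a::comm_ring_1 poly poly \<Rightarrow> bool" where
  "cdeg_le d F \<longleftrightarrow> (\<forall>i. degree (coeff F i) \<le> d)"

lemma cdeg_le_mono: "cdeg_le d F \<Longrightarrow> d \<le> d' \<Longrightarrow> cdeg_le d' F"
  unfolding cdeg_le_def by (meson order_trans)

lemma cdeg_le_add: "cdeg_le d F \<Longrightarrow> cdeg_le d G \<Longrightarrow> cdeg_le d (F + G)"
  unfolding cdeg_le_def by (auto intro: degree_add_le)

lemma cdeg_le_sum: "(\<And>i. i \<in> I \<Longrightarrow> cdeg_le d (F i)) \<Longrightarrow> cdeg_le d (sum F I)"
  by (induction I rule: infinite_finite_induct) (auto intro!: cdeg_le_add simp: cdeg_le_def[of _ 0])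

lemma cdeg_le_mult:
  assumes "cdeg_le d F" "cdeg_le d' G"
  shows "cdeg_le (d + d') (F * G)"
  unfolding cdeg_le_def
proof
  fix i
  have "degree (coeff F j * coeff G (i - j)) \<le> d + d'" for j
    using degree_mult_le[of "coeff F j" "coeff G (i - j)"] assms unfolding cdeg_le_def
    by (meson add_mono order_trans)
  thus "degree (coeff (F * G) i) \<le> d + d'" unfolding coeff_mult by (intro degree_sum_le) auto
qed

lemma cdeg_le_const: "cdeg_le (degree p) [:p:]"
  unfolding cdeg_le_def by (auto simp: coeff_pCons split: nat.splits)

lemma cdeg_le_power: "cdeg_le d F \<Longrightarrow> cdeg_le (d * k) (F ^ k)"
proof (induction k)
  case 0
  show ?case using cdeg_le_const[of 1] by (simp add: one_pCons)
next
  case (Suc k)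
  from cdeg_le_mult[OF Suc.prems Suc.IH[OF Suc.prems]] show ?case by (simp add: algebra_simps)
qed

definition pol2 :: "nat \<Rightarrow> nat \<Rightarrow> (nat \<Rightarrow> nat \<Rightarrow> 'a) \<Rightarrow> 'a::comm_ring_1 poly poly" where
  "pol2 m n c = (\<Sum>j<m. monom (\<Sum>x<n. monom (c j x) x) j)"

lemma coeff_sum_monom_if: "coeff (\<Sum>x<n. monom (d x) x) y = (if y < n then d y else 0)"
  by (simp add: coeff_sum)

lemma coeff_pol2: "coeff (coeff (pol2 m n c) j) x = (if j < m \<and> x < n then c j x else 0)"
  by (simp add: pol2_def coeff_sum_monom_if)

lemma cdeg_le_pol2: "cdeg_le n (pol2 m (Suc n) c)"
  unfolding cdeg_le_def by (intro allI degree_le) (simp add: coeff_pol2)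

lemma coeff_pol2_eq_0: "j \<ge> m \<Longrightarrow> coeff (pol2 m n c) j = 0"
  by (rule poly_eqI) (simp add: coeff_pol2)

text \<open>A nonzero combination of \<open>f\<close> and \<open>g\<close> whose degree does not
  exceed that of their gcd \<open>h\<close> equals \<open>h\<close> up to a factor in the field.
  Bounding the degree imposes linear conditions on the coefficients of \<open>u\<close> and
  \<open>w\<close> over the finite field, and there is one unknown more than conditions.\<close>

lemma small_gcd:
  fixes f g :: "'a::{field,finite} poly poly"
  assumes fg: "f \<noteq> 0" "g \<noteq> 0" and \<delta>: "cdeg_le \<delta> f" "cdeg_le \<delta> g" and d: "degree f \<le> d" "degree g \<le> d"
  shows "\<exists>u w. u * f + w * g \<noteq> 0 \<and> cdeg_le ((2 * d + 1) * \<delta>) (u * f + w * g) \<and>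
    fract_poly (u * f + w * g) dvd fract_poly f \<and> fract_poly (u * f + w * g) dvd fract_poly g"
proof -
  have "fract_poly f \<noteq> 0" using fg by simp
  then obtain h \<alpha> \<beta> f1 g1 where
    h: "h \<noteq> 0" "fract_poly f = h * f1" "fract_poly g = h * g1" "\<alpha> * f1 + \<beta> * g1 = 1"
    by (rule poly_bezout[of "fract_poly f" "fract_poly g"])
  have nz: "f1 \<noteq> 0" "g1 \<noteq> 0" using h fg by auto
  have deg: "degree f = degree h + degree f1" "degree g = degree h + degree g1"
    using degree_mult_eq[OF h(1) nz(1)] degree_mult_eq[OF h(1) nz(2)]
    by (simp_all add: degree_fract_poly flip: h(2,3))
  define m1 m2 where "m1 = degree g1" and "m2 = degree f1"
  define \<mu> where "\<mu> = m1 + m2"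
  \<comment> \<open>For this \<open>n\<close> there are \<open>(\<mu> + 1) * (n + 1)\<close>
    unknowns and \<open>\<mu> * (n + 1 + \<delta>)\<close> conditions; the difference is exactly
    1.\<close>
  define n where "n = \<mu> * \<delta>"
  define u where "u = (\<lambda>v :: nat \<times> nat \<Rightarrow> 'a. pol2 (Suc m1) (Suc n) (\<lambda>j x. v (j, x)))"
  \<comment> \<open>\<open>u\<close> and \<open>w\<close> share one array of
    \<open>Suc \<mu>\<close> rows. The degree of a nonzero \<open>w\<close> is strictly below
    \<open>m2\<close>, which is what prevents a trivial relation in \<open>k0\<close>.\<close>
  define w where "w = (\<lambda>v :: nat \<times> nat \<Rightarrow> 'a. pol2 m2 (Suc n) (\<lambda>j x. v (Suc m1 + j, x)))"
  define F where "F = (\<lambda>v. u v * f + w v * g)"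
  define D where "D = {..<Suc \<mu>} \<times> {..<Suc n}"
  define D' where "D' = {..<\<mu>} \<times> {..<Suc n + \<delta>}"
  \<comment> \<open>Records the coefficients of \<open>F v\<close> in the degrees above
    \<open>degree h\<close> that are to be cancelled.\<close>
  define \<phi> where "\<phi> = (\<lambda>v. restrict (\<lambda>(p, x). coeff (coeff (F v) (Suc (degree h + p))) x) D')"
  have tF: "cdeg_le (n + \<delta>) (F v)" for v
    unfolding F_def u_def w_def by (intro cdeg_le_add cdeg_le_mult cdeg_le_pol2 \<delta>)
  have dF: "coeff (F v) i = 0" if i: "i > degree h + \<mu>" for v i
  proof -
    have du: "u v = 0 \<or> degree (u v) \<le> m1" unfolding u_def
      by (rule disjI2, rule degree_le) (simp add: coeff_pol2_eq_0)
    have "w v = 0 \<or> degree (w v) < m2"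
    proof (cases "m2 = 0")
      case False
      have "degree (w v) \<le> m2 - 1" unfolding w_def
        by (rule degree_le) (use False in \<open>auto simp: coeff_pol2_eq_0\<close>)
      thus ?thesis using False by linarith
    qed (simp add: w_def pol2_def)
    hence "degree (u v * f) \<le> degree h + \<mu>" "degree (w v * g) \<le> degree h + \<mu>"
      using du degree_mult_le[of "u v" f] degree_mult_le[of "w v" g]
      by (auto simp: deg \<mu>_def m1_def m2_def)
    hence "degree (F v) \<le> degree h + \<mu>" unfolding F_def by (rule degree_add_le)
    thus ?thesis using i by (intro coeff_eq_0) simp
  qed
  have "\<not> inj_on \<phi> (PiE D (\<lambda>_. UNIV))"
  proof
    assume inj: "inj_on \<phi> (PiE D (\<lambda>_. UNIV))"
    have "\<phi> ` PiE D (\<lambda>_. UNIV) \<subseteq> PiE D' (\<lambda>_. UNIV)" by (auto simp: \<phi>_def)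
    moreover have "finite (PiE D' (\<lambda>_. UNIV :: 'a set))" by (intro finite_PiE) (auto simp: D'_def)
    ultimately have "card (PiE D (\<lambda>_. UNIV :: 'a set)) \<le> card (PiE D' (\<lambda>_. UNIV :: 'a set))"
      using inj by (intro card_inj_on_le)
    hence "CARD('a) ^ (Suc \<mu> * Suc n) \<le> CARD('a) ^ (\<mu> * (Suc n + \<delta>))"
      by (simp add: card_PiE D_def D'_def card_cartesian_product del: mult_Suc mult_Suc_right)
    moreover have "CARD('a) > 1" using card_mono[of "UNIV :: 'a set" "{0, 1}"] by simp
    ultimately have "Suc \<mu> * Suc n \<le> \<mu> * (Suc n + \<delta>)" by (simp only: power_increasing_iff)
    thus False by (simp add: n_def algebra_simps)
  qed
  then obtain v v' where v: "v \<in> PiE D (\<lambda>_. UNIV)" "v' \<in> PiE D (\<lambda>_. UNIV)" "v \<noteq> v'" "\<phi> v = \<phi> v'"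
    unfolding inj_on_def by blast
  define a where "a = u v - u v'"
  define b where "b = w v - w v'"
  let ?H = "a * f + b * g"
  have H: "?H = F v - F v'" unfolding a_def b_def F_def by (simp add: algebra_simps)
  have ab: "a \<noteq> 0 \<or> b \<noteq> 0"
  proof (rule ccontr)
    assume "\<not> ?thesis"
    hence eq: "u v = u v'" "w v = w v'" by (auto simp: a_def b_def)
    have "v (j, x) = v' (j, x)" if "j < Suc \<mu>" "x < Suc n" for j x
    proof (cases "j < Suc m1")
      case True
      thus ?thesis using arg_cong[OF eq(1), of "\<lambda>p. coeff (coeff p j) x"] that by (simp add: u_def coeff_pol2)
    next
      case False
      then obtain i where "j = Suc m1 + i" using le_Suc_ex[of "Suc m1" j] by auto
      thus ?thesis using arg_cong[OF eq(2), of "\<lambda>p. coeff (coeff p i) x"] that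
        by (simp add: w_def coeff_pol2 \<mu>_def)
    qed
    hence "v = v'" using v(1,2) by (intro PiE_ext[of v D _ v']) (auto simp: D_def)
    thus False using v(3) by blast
  qed
  have degH: "degree ?H \<le> degree h"
  proof (rule degree_le, intro allI impI)
    fix i assume i: "degree h < i"
    show "coeff ?H i = 0"
    proof (cases "i \<le> degree h + \<mu>")
      case False
      thus ?thesis unfolding H by (simp add: dF)
    next
      case True
      define p where "p = i - Suc (degree h)"
      have p: "p < \<mu>" "i = Suc (degree h + p)" using i True by (auto simp: p_def)
      have "coeff (coeff (F v) i) x = coeff (coeff (F v') i) x" for x
      proof (cases "x < Suc n + \<delta>")
        case True
        have "\<phi> v (p, x) = \<phi> v' (p, x)" using v(4) by simp
        thus ?thesis using True p by (simp add: \<phi>_def D'_def)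
      next
        case False
        have "degree (coeff (F v) i) \<le> n + \<delta>" "degree (coeff (F v') i) \<le> n + \<delta>" using tF by (auto simp: cdeg_le_def)
        thus ?thesis using False by (simp add: coeff_eq_0)
      qed
      hence "coeff (F v) i = coeff (F v') i" by (rule poly_eqI)
      thus ?thesis unfolding H by simp
    qed
  qed
  let ?a = "fract_poly a" and ?b = "fract_poly b"
  define k where "k = ?a * f1 + ?b * g1"
  have Hk: "fract_poly ?H = h * k" by (simp add: k_def h algebra_simps)
  \<comment> \<open>If the combination vanished, coprimality would give \<open>?a = g1 * c\<close>
    and \<open>?b = - c * f1\<close>. The degree of \<open>b\<close> is too small for this unless
    \<open>c = 0\<close>, and then \<open>a\<close> and \<open>b\<close> both vanish.\<close>
  have k0: "k \<noteq> 0"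
  proof
    assume "k = 0"
    hence e: "?a * f1 = - ?b * g1" by (simp add: k_def add_eq_0_iff2)
    have "?a = ?a * (\<alpha> * f1 + \<beta> * g1)" by (simp add: h)
    also have "\<dots> = \<alpha> * (?a * f1) + ?a * \<beta> * g1" by (simp add: algebra_simps)
    also have "\<dots> = g1 * (?a * \<beta> - \<alpha> * ?b)" unfolding e by (simp add: algebra_simps)
    finally obtain c where c: "?a = g1 * c" by blast
    have "?b * g1 = (- c * f1) * g1" using e c by (simp add: algebra_simps)
    hence c2: "?b = - c * f1" using nz(2) by (simp only: mult_cancel_right) simp
    have "c = 0"
    proof (rule ccontr)
      assume c0: "c \<noteq> 0"
      have "degree ?b = degree c + degree f1" unfolding c2 using c0 nz by (simp add: degree_mult_eq)
      hence "degree b \<ge> m2" by (simp add: degree_fract_poly m2_def)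
      moreover have "?b \<noteq> 0" unfolding c2 using c0 nz by simp
      hence "b \<noteq> 0" by auto
      ultimately have "coeff b (degree b) = 0" unfolding b_def w_def by (simp add: coeff_pol2_eq_0)
      thus False using \<open>b \<noteq> 0\<close> by simp
    qed
    thus False using c c2 ab by simp
  qed
  have "fract_poly ?H \<noteq> 0" unfolding Hk using k0 h(1) by simp
  hence Hnz: "?H \<noteq> 0" by (metis map_poly_0)
  have "degree h + degree k \<le> degree h"
    using degH degree_mult_eq[OF h(1) k0] unfolding Hk[symmetric] degree_fract_poly by simp
  then obtain c where c: "k = [:c:]" by (metis add_le_same_cancel1 degree_eq_zeroE le_zero_eq)
  hence "c \<noteq> 0" using k0 by auto
  hence "h = fract_poly ?H * [:inverse c:]" unfolding Hk c by simp
  hence "fract_poly ?H dvd h" by (rule dvdI)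
  hence dv: "fract_poly ?H dvd fract_poly f" "fract_poly ?H dvd fract_poly g" by (simp_all only: h(2,3) dvd_mult2)
  have "n + \<delta> \<le> (2 * d + 1) * \<delta>"
  proof -
    have "\<mu> \<le> 2 * d" using d deg by (simp add: \<mu>_def m1_def m2_def)
    hence "\<mu> * \<delta> \<le> 2 * d * \<delta>" by (rule mult_right_mono) simp
    thus ?thesis by (simp add: n_def)
  qed
  moreover have "cdeg_le (n + \<delta>) ?H" unfolding H cdeg_le_def using tF
    by (auto simp: cdeg_le_def intro: degree_diff_le)
  ultimately have "cdeg_le ((2 * d + 1) * \<delta>) ?H" by (rule cdeg_le_mono[rotated])
  with Hnz dv show ?thesis by blast
qed

section \<open>Evaluation\<close>

lemma map_poly_hom_add:
  assumes "h 0 = 0" "\<And>x y. h (x + y) = h x + h y"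
  shows "map_poly h (p + q) = map_poly h p + map_poly h q"
  by (rule poly_eqI) (simp add: coeff_map_poly assms)

lemma map_poly_hom_mult:
  assumes "h 0 = 0" "\<And>x y. h (x + y) = h x + h y" "\<And>x y. h (x * y) = h x * h y"
  shows "map_poly h (p * q) = map_poly h p * map_poly h q"
proof (rule poly_eqI)
  fix n
  have "h (sum f I) = (\<Sum>i\<in>I. h (f i))" for f and I :: "nat set"
    by (induction I rule: infinite_finite_induct) (auto simp: assms)
  thus "coeff (map_poly h (p * q)) n = coeff (map_poly h p * map_poly h q) n"
    by (simp add: coeff_map_poly coeff_mult assms)
qed

lemma eval_ac_add: "eval_ac (p + q) \<tau> = eval_ac p \<tau> + eval_ac q \<tau>"
  and eval_ac_mult: "eval_ac (p * q) \<tau> = eval_ac p \<tau> * eval_ac q \<tau>"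
  by (simp_all add: eval_ac_def map_poly_hom_add map_poly_hom_mult)

lemma eval_ac_const [simp]: "eval_ac [:c:] \<tau> = to_ac c"
  and eval_ac_0 [simp]: "eval_ac 0 \<tau> = 0"
  and eval_ac_1 [simp]: "eval_ac 1 \<tau> = 1"
  and eval_ac_X [simp]: "eval_ac [:0, 1:] \<tau> = \<tau>"
  by (simp_all add: eval_ac_def map_poly_pCons)

definition ev :: "'a::field alg_closure \<Rightarrow> 'a alg_closure \<Rightarrow> 'a poly poly \<Rightarrow> 'a alg_closure" where
  "ev \<tau> lam F = poly (map_poly (\<lambda>p. eval_ac p \<tau>) F) lam"

lemma ev_add: "ev \<tau> lam (F + G) = ev \<tau> lam F + ev \<tau> lam G"
  and ev_mult: "ev \<tau> lam (F * G) = ev \<tau> lam F * ev \<tau> lam G"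
  by (simp_all add: ev_def map_poly_hom_add map_poly_hom_mult eval_ac_add eval_ac_mult)

lemma ev_const [simp]: "ev \<tau> lam [:p:] = eval_ac p \<tau>"
  and ev_0 [simp]: "ev \<tau> lam 0 = 0"
  and ev_1 [simp]: "ev \<tau> lam 1 = 1"
  and ev_X [simp]: "ev \<tau> lam [:0, 1:] = lam"
  by (simp_all add: ev_def map_poly_pCons)

lemma ev_smult: "ev \<tau> lam (smult p F) = eval_ac p \<tau> * ev \<tau> lam F"
  using ev_mult[of \<tau> lam "[:p:]" F] by simp

lemma ev_power: "ev \<tau> lam (F ^ k) = ev \<tau> lam F ^ k"
  by (induction k) (auto simp: ev_mult)

lemma eval_ac_power: "eval_ac (p ^ k) \<tau> = eval_ac p \<tau> ^ k"
  by (induction k) (auto simp: eval_ac_mult)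

lemma ev_sum: "ev \<tau> lam (sum F I) = (\<Sum>i\<in>I. ev \<tau> lam (F i))"
  by (induction I rule: infinite_finite_induct) (auto simp: ev_add)

section \<open>Numerators of the action on a rational point\<close>

abbreviation (input) frac_orb :: "nat \<Rightarrow> nat \<Rightarrow> 'a::field poly fract \<Rightarrow> nat \<Rightarrow> 'a poly fract poly" where
  "frac_orb q Q \<equiv> orbp q Q (to_fract [:0, 1:])"

text \<open>This is \<open>C ^ (Q ^ degree L)\<close> times the image of \<open>A / C\<close> under
  the Drinfeld module at \<open>L\<close>, made polynomial in t and \<lambda>;
  \<open>fract_poly_num\<close> and \<open>ev_num\<close> express this before and after
  specialization.\<close>

definition num :: "nat \<Rightarrow> nat \<Rightarrow> 'a::field poly \<Rightarrow> 'a poly \<Rightarrow> 'a poly \<Rightarrow> 'a poly poly" where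
  "num q Q C A L = (\<Sum>i\<le>degree L. [:[:coeff L i:]:] * [:C:] ^ (Q ^ degree L - Q ^ i)
     * hom_orb q Q [:[:0, 1:]:] [:0, 1:] [:C:] [:A:] i)"

lemma fract_poly_power: "fract_poly (p ^ k) = fract_poly p ^ k"
  by (induction k) auto

lemma fract_poly_sum: "fract_poly (sum f I) = (\<Sum>i\<in>I. fract_poly (f i))"
  by (induction I rule: infinite_finite_induct) auto

lemma fract_poly_num:
  assumes C: "C \<noteq> 0" and q: "q \<le> Q" "0 < Q"
  shows "fract_poly (num q Q C A L) = smult (to_fract C ^ (Q ^ degree L))
    (\<Sum>i\<le>degree L. smult (to_fract [:coeff L i:]) (frac_orb q Q (Fract A C) i))"
proof -
  let ?C = "[:to_fract C:]"
  have A: "[:to_fract A:] = ?C * [:Fract A C:]" using C by (simp add: Fract_conv_to_fract)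
  have "fract_poly (hom_orb q Q [:[:0, 1:]:] [:0, 1:] [:C:] [:A:] i)
     = hom_orb q Q [:to_fract [:0, 1:]:] [:0, 1:] ?C [:to_fract A:] i" for i
    by (subst hom_orb_hom[of fract_poly]) (auto simp: map_poly_pCons)
  hence h: "fract_poly (hom_orb q Q [:[:0, 1:]:] [:0, 1:] [:C:] [:A:] i) 
     = ?C ^ (Q ^ i) * frac_orb q Q (Fract A C) i" for i
    unfolding A by (simp only: hom_orb_eq[OF q])
  have p: "?C ^ (Q ^ degree L - Q ^ i) * (?C ^ (Q ^ i) * x) = ?C ^ (Q ^ degree L) * x" 
    if "i \<le> degree L" for i x
    using power_increasing[OF that, of Q] q by (simp add: mult.assoc[symmetric] flip: power_add)
  have "fract_poly (num q Q C A L) = (\<Sum>i\<le>degree L. [:to_fract [:coeff L i:]:] * ?C ^ (Q ^ degree L - Q ^ i)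
     * (?C ^ (Q ^ i) * frac_orb q Q (Fract A C) i))"
    unfolding num_def fract_poly_sum fract_poly_mult fract_poly_power h
    by (simp add: map_poly_pCons)
  also have "\<dots> = (\<Sum>i\<le>degree L. ?C ^ (Q ^ degree L) * smult (to_fract [:coeff L i:]) (frac_orb q Q (Fract A C) i))"
    by (rule sum.cong) (auto simp: mult.assoc p)
  also have "\<dots> = smult (to_fract C ^ (Q ^ degree L))
    (\<Sum>i\<le>degree L. smult (to_fract [:coeff L i:]) (frac_orb q Q (Fract A C) i))"
    by (simp add: poly_const_pow smult_sum_right mult_ac)
  finally show ?thesis .
qed

lemma orb_drinfeld_T:
  fixes \<tau> lam :: "'a::finite_field alg_closure"
  shows "orb CARD('a) (CARD('a) ^ r) \<tau> lam x i = (poly (drinfeld_T r \<tau> lam) ^^ i) x"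
  by (induction i) (auto simp: drinfeld_T_def poly_monom)

lemma ev_num:
  fixes \<tau> lam :: "'a::finite_field alg_closure"
  defines "q \<equiv> CARD('a)"
  assumes C: "eval_ac C \<tau> \<noteq> 0" and r: "r > 0"
  shows "ev \<tau> lam (num q (q ^ r) C A L) = eval_ac C \<tau> ^ ((q ^ r) ^ degree L)
    * poly (drinfeld (drinfeld_T r \<tau> lam) L) (eval_ac A \<tau> / eval_ac C \<tau>)"
proof -
  let ?Q = "q ^ r" and ?c = "eval_ac C \<tau>"
  have q0: "q > 0" by (simp add: q_def)
  have q: "q \<le> ?Q" "0 < ?Q" using q0 r self_le_power[of q r] by auto
  have A: "eval_ac A \<tau> = ?c * (eval_ac A \<tau> / ?c)" using C by simp
  have "ev \<tau> lam (hom_orb q ?Q [:[:0, 1:]:] [:0, 1:] [:C:] [:A:] i)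
     = hom_orb q ?Q \<tau> lam ?c (eval_ac A \<tau>) i" for i
    by (subst hom_orb_hom[of "ev \<tau> lam"]) (auto simp: ev_add ev_mult)
  hence h: "ev \<tau> lam (hom_orb q ?Q [:[:0, 1:]:] [:0, 1:] [:C:] [:A:] i)
     = ?c ^ (?Q ^ i) * orb q ?Q \<tau> lam (eval_ac A \<tau> / ?c) i" for i
    by (subst (asm) A) (simp only: hom_orb_eq[OF q])
  have p: "?c ^ (?Q ^ degree L - ?Q ^ i) * (?c ^ (?Q ^ i) * x) = ?c ^ (?Q ^ degree L) * x" 
    if "i \<le> degree L" for i x
    using power_increasing[OF that, of ?Q] q by (simp add: mult.assoc[symmetric] flip: power_add)
  have "ev \<tau> lam (num q ?Q C A L) = (\<Sum>i\<le>degree L. to_ac (coeff L i) * ?c ^ (?Q ^ degree L - ?Q ^ i)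
     * (?c ^ (?Q ^ i) * orb q ?Q \<tau> lam (eval_ac A \<tau> / ?c) i))"
    unfolding num_def ev_sum ev_mult ev_power h by simp
  also have "\<dots> = (\<Sum>i\<le>degree L. ?c ^ (?Q ^ degree L) * (to_ac (coeff L i) * orb q ?Q \<tau> lam (eval_ac A \<tau> / ?c) i))"
  proof (rule sum.cong[OF refl])
    fix i assume "i \<in> {..degree L}"
    hence "?c ^ (?Q ^ degree L - ?Q ^ i) * (?c ^ (?Q ^ i) * (to_ac (coeff L i) * orb q ?Q \<tau> lam (eval_ac A \<tau> / ?c) i))
      = ?c ^ (?Q ^ degree L) * (to_ac (coeff L i) * orb q ?Q \<tau> lam (eval_ac A \<tau> / ?c) i)" by (intro p) simp
    thus "to_ac (coeff L i) * ?c ^ (?Q ^ degree L - ?Q ^ i) * (?c ^ (?Q ^ i) * orb q ?Q \<tau> lam (eval_ac A \<tau> / ?c) i)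
      = ?c ^ (?Q ^ degree L) * (to_ac (coeff L i) * orb q ?Q \<tau> lam (eval_ac A \<tau> / ?c) i)" by (simp only: mult_ac)
  qed
  also have "\<dots> = ?c ^ (?Q ^ degree L) * poly (drinfeld (drinfeld_T r \<tau> lam) L) (eval_ac A \<tau> / ?c)"
    unfolding q_def orb_drinfeld_T by (simp add: poly_drinfeld[OF order_refl] sum_distrib_left)
  finally show ?thesis .
qed

text \<open>In every summand the weights of \<open>C\<close> and of the previous point add up to
  \<open>Q ^ Suc i\<close>. The extra factor t comes with at least one factor \<open>C\<close>, so
  the strict bound on \<open>degree C\<close> absorbs it.\<close>

lemma hom_orb_bounds:
  assumes q: "1 \<le> q" "q < Q" and k: "degree A \<le> k" "degree C < k"
  defines "H \<equiv> hom_orb q Q [:[:0, 1:]:] [:0, 1:] [:C:] [:A :: 'a::field poly:]"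
  shows "cdeg_le (k * Q ^ i) (H i) \<and> degree (H i) \<le> Q ^ i"
proof (induction i)
  case 0
  show ?case using cdeg_le_mono[OF cdeg_le_const k(1)] by (simp add: H_def)
next
  case (Suc i)
  define x where "x = Q ^ i"
  have x: "x > 0" using q by (simp add: x_def)
  have le: "x < Q * x" "q * x < Q * x" using q x by auto
  have H: "H (Suc i) = [:[:0, 1:]:] * [:C:] ^ (Q * x - x) * H i
     + [:0, 1:] * [:C:] ^ (Q * x - q * x) * H i ^ q + H i ^ Q"
    by (simp only: H_def hom_orb.simps x_def power_Suc)
  have IH: "cdeg_le (k * x) (H i)" "degree (H i) \<le> x" using Suc by (auto simp: x_def)
  note C = cdeg_le_power[OF cdeg_le_const[of C]]
  have t: "cdeg_le 1 [:[:0, 1 :: 'a:]:]" using cdeg_le_const[of "[:0, 1 :: 'a:]"] by simp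
  have l: "cdeg_le 0 [:0, 1 :: 'a poly:]" by (auto simp: cdeg_le_def coeff_pCons split: nat.splits)
  have 1: "1 + degree C * (Q * x - x) + k * x \<le> k * (Q * x)"
  proof -
    have "1 \<le> Q * x - x" using le by linarith
    hence "1 + degree C * (Q * x - x) \<le> (degree C + 1) * (Q * x - x)" unfolding add_mult_distrib by linarith
    also have "\<dots> \<le> k * (Q * x - x)" by (rule mult_right_mono) (use k in auto)
    also have "\<dots> + k * x = k * (Q * x)" using le by (simp flip: distrib_left)
    finally show ?thesis by simp
  qed
  have 2: "0 + degree C * (Q * x - q * x) + k * x * q \<le> k * (Q * x)"
  proof -
    have "degree C * (Q * x - q * x) \<le> k * (Q * x - q * x)" by (rule mult_right_mono) (use k in auto)
    also have "\<dots> + k * x * q = k * (Q * x)" using le by (simp add: mult_ac flip: distrib_left)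
    finally show ?thesis by simp
  qed
  have "cdeg_le (k * (Q * x)) (H (Suc i))" unfolding H
  proof (intro cdeg_le_add)
    show "cdeg_le (k * (Q * x)) ([:[:0, 1:]:] * [:C:] ^ (Q * x - x) * H i)"
      by (rule cdeg_le_mono[OF cdeg_le_mult[OF cdeg_le_mult[OF t C] IH(1)] 1])
    show "cdeg_le (k * (Q * x)) ([:0, 1:] * [:C:] ^ (Q * x - q * x) * H i ^ q)"
      by (rule cdeg_le_mono[OF cdeg_le_mult[OF cdeg_le_mult[OF l C] cdeg_le_power[OF IH(1)]] 2])
    show "cdeg_le (k * (Q * x)) (H i ^ Q)" using cdeg_le_power[OF IH(1), of Q] by (simp add: mult_ac)
  qed
  moreover have "degree (H (Suc i)) \<le> Q * x" unfolding H
  proof (intro degree_add_le)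
    show "degree ([:[:0, 1:]:] * [:C:] ^ (Q * x - x) * H i) \<le> Q * x"
      using order_trans[OF IH(2) less_imp_le[OF le(1)]]
      by (intro order_trans[OF degree_mult_le]) (simp add: poly_const_pow)
    have "degree ([:0, 1:] * [:C:] ^ (Q * x - q * x)) \<le> 1" by (simp add: poly_const_pow)
    moreover have "degree (H i ^ q) \<le> q * x"
      using order_trans[OF degree_power_le mult_le_mono1[OF IH(2)], of q] by (simp only: mult.commute)
    ultimately show "degree ([:0, 1:] * [:C:] ^ (Q * x - q * x) * H i ^ q) \<le> Q * x"
      using le(2) degree_mult_le[of "[:0, 1:] * [:C:] ^ (Q * x - q * x)" "H i ^ q"] by linarith
    show "degree (H i ^ Q) \<le> Q * x"
      using order_trans[OF degree_power_le mult_le_mono1[OF IH(2)], of Q] by (simp only: mult.commute)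
  qed
  ultimately show ?case by (simp add: x_def)
qed

lemma num_bounds:
  assumes q: "1 \<le> q" "q < Q" and k: "degree A \<le> k" "degree C < k"
  shows "cdeg_le (k * Q ^ degree L) (num q Q C A L)" "degree (num q Q C A L) \<le> Q ^ degree L"
proof -
  note H = hom_orb_bounds[OF q k]
  have le: "Q ^ i \<le> Q ^ degree L" if "i \<le> degree L" for i by (rule power_increasing[OF that]) (use q in simp)
  show "cdeg_le (k * Q ^ degree L) (num q Q C A L)" unfolding num_def
  proof (rule cdeg_le_sum)
    fix i assume i: "i \<in> {..degree L}"
    have "cdeg_le (degree [:coeff L i:] + degree C * (Q ^ degree L - Q ^ i) + k * Q ^ i)
      ([:[:coeff L i:]:] * [:C:] ^ (Q ^ degree L - Q ^ i) * hom_orb q Q [:[:0, 1:]:] [:0, 1:] [:C:] [:A:] i)"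
      by (intro cdeg_le_mult cdeg_le_power cdeg_le_const conjunct1[OF H])
    moreover have "degree C * (Q ^ degree L - Q ^ i) \<le> k * (Q ^ degree L - Q ^ i)"
      by (rule mult_right_mono) (use k in auto)
    moreover have "k * (Q ^ degree L - Q ^ i) + k * Q ^ i = k * Q ^ degree L"
      using le[of i] i by (simp flip: distrib_left)
    moreover have "degree [:coeff L i:] = 0" by simp
    ultimately show "cdeg_le (k * Q ^ degree L)
      ([:[:coeff L i:]:] * [:C:] ^ (Q ^ degree L - Q ^ i) * hom_orb q Q [:[:0, 1:]:] [:0, 1:] [:C:] [:A:] i)"
      by (elim cdeg_le_mono) linarith
  qed
  show "degree (num q Q C A L) \<le> Q ^ degree L" unfolding num_def
  proof (rule degree_sum_le)
    fix i assume i: "i \<in> {..degree L}"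
    have "degree (hom_orb q Q [:[:0, 1:]:] [:0, 1:] [:C:] [:A:] i) \<le> Q ^ degree L"
      using conjunct2[OF H, of i] le[of i] i by simp
    thus "degree ([:[:coeff L i:]:] * [:C:] ^ (Q ^ degree L - Q ^ i) * hom_orb q Q [:[:0, 1:]:] [:0, 1:] [:C:] [:A:] i)
      \<le> Q ^ degree L" by (intro order_trans[OF degree_mult_le]) (simp add: poly_const_pow)
  qed simp
qed

section \<open>Specialization of common annihilators\<close>

lemma CHAR_fract: "CHAR('a::idom fract) = CHAR('a)"
proof (rule CHAR_eqI)
  have of_nat: "of_nat n = to_fract (of_nat n :: 'a)" for n by (induction n) auto
  show "of_nat CHAR('a) = (0 :: 'a fract)" by (simp add: of_nat)
  show "CHAR('a) dvd n" if "of_nat n = (0 :: 'a fract)" for n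
    using that by (simp add: of_nat of_nat_eq_0_iff_char_dvd)
qed

lemma sum_power_card:
  fixes f :: "nat \<Rightarrow> 'a::finite_field poly fract poly"
  shows "sum f I ^ (CARD('a) ^ k) = (\<Sum>i\<in>I. f i ^ (CARD('a) ^ k))"
proof -
  obtain n where n: "CARD('a) = CHAR('a) ^ n" by (rule finite_field_card)
  have char: "CHAR('a poly fract) = CHAR('a)" by (simp add: CHAR_fract)
  have "prime CHAR('a)" by (simp add: prime_CHAR_semidom finite_imp_CHAR_pos)
  thus ?thesis
    by (intro freshmans_dream_sum'[of _ "n * k"]) (simp_all add: char n power_mult)
qed

text \<open>If e is the sum for shift \<open>k\<close>, the sum for the next shift is t e +
  \<lambda> e^q + e^(q^r), which is a multiple of e.\<close>

lemma orbp_annihilated_shift: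
  fixes x :: "'a::finite_field poly fract" and L :: "'a poly"
  defines "q \<equiv> CARD('a)"
  assumes h: "h dvd (\<Sum>i\<le>n. smult (to_fract [:coeff L i:]) (orbp q (q ^ r) t x i))"
  shows "h dvd (\<Sum>i\<le>n. smult (to_fract [:coeff L i:]) (orbp q (q ^ r) t x (i + k)))"
proof (induction k)
  case 0
  show ?case using h by simp
next
  case (Suc k)
  let ?c = "\<lambda>i. [:to_fract [:coeff L i:]:]"
  have pw: "?c i ^ (q ^ m) = ?c i" for i m
  proof -
    have "to_fract p ^ e = to_fract (p ^ e)" for p :: "'a poly" and e by (induction e) auto
    thus ?thesis by (simp add: poly_const_pow q_def finite_field_power_card_power_eq_same)
  qed
  have "(\<Sum>i\<le>n. ?c i * orbp q (q ^ r) t x (Suc (i + k))) =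
    (let e = \<Sum>i\<le>n. ?c i * orbp q (q ^ r) t x (i + k) in [:t:] * e + [:0, 1:] * e ^ q + e ^ (q ^ r))"
    using sum_power_card[where ?'a = 'a, of _ _ 1] sum_power_card[where ?'a = 'a, of _ _ r] pw[of _ 1] pw[of _ r]
    by (intro orb_sum) (simp_all add: q_def)
  moreover have "h dvd (\<Sum>i\<le>n. ?c i * orbp q (q ^ r) t x (i + k))" using Suc by simp
  moreover have "q > 0" "q ^ r > 0" by (simp_all add: q_def)
  ultimately have "h dvd (\<Sum>i\<le>n. ?c i * orbp q (q ^ r) t x (Suc (i + k)))"
    unfolding Let_def by (simp only:) (intro dvd_add dvd_mult; simp add: dvd_power_le dvd_trans[OF _ dvd_power])
  thus ?case by (simp del: orb.simps)
qed

text \<open>Division by the leading coefficient of \<open>L\<close> turns annihilation into a linear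
  recursion over the constant field, the hypothesis of
  \<open>ex_nilpotent_polynomial\<close>.\<close>

lemma orbp_reduction:
  fixes x :: "'a::finite_field poly fract" and L :: "'a poly"
  defines "q \<equiv> CARD('a)"
  assumes L: "L \<noteq> 0" and h: "h dvd (\<Sum>i\<le>degree L. smult (to_fract [:coeff L i:]) (orbp q (q ^ r) t x i))"
  shows "\<exists>c. h dvd (orbp q (q ^ r) t x (degree L + k)
    - (\<Sum>i<degree L. smult (to_fract [:c i:]) (orbp q (q ^ r) t x (i + k))))"
proof -
  let ?o = "orbp q (q ^ r) t x" and ?l = "inverse (lead_coeff L)"
  have "h dvd (\<Sum>i\<le>degree L. smult (to_fract [:coeff L i:]) (?o (i + k)))"
    using orbp_annihilated_shift h unfolding q_def by blast
  hence "h dvd smult (to_fract [:?l:]) (\<Sum>i\<le>degree L. smult (to_fract [:coeff L i:]) (?o (i + k)))"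
    by (rule dvd_smult)
  also have "smult (to_fract [:?l:]) (\<Sum>i\<le>degree L. smult (to_fract [:coeff L i:]) (?o (i + k)))
    = (\<Sum>i\<le>degree L. smult (to_fract [:?l * coeff L i:]) (?o (i + k)))"
    by (simp add: smult_sum_right mult.commute flip: to_fract_mult)
  also have "\<dots> = (\<Sum>i<degree L. smult (to_fract [:?l * coeff L i:]) (?o (i + k))) + ?o (degree L + k)"
    using L by (simp add: lessThan_Suc_atMost[symmetric] one_pCons[symmetric])
  also have "\<dots> = ?o (degree L + k) - (\<Sum>i<degree L. smult (to_fract [:- (?l * coeff L i):]) (?o (i + k)))"
  proof -
    have "to_fract [:- (?l * coeff L i):] = - to_fract [:?l * coeff L i:]" for i
      by (simp flip: to_fract_uminus)
    thus ?thesis by (simp add: sum_negf)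
  qed
  finally show ?thesis by (intro exI[of _ "\<lambda>i. - (?l * coeff L i)"])
qed

lemma clear_denominators:
  fixes G :: "'a::field poly fract poly"
  obtains s F where "s \<noteq> 0" "fract_poly F = smult s G"
proof -
  have "\<exists>s\<in>range to_fract. s \<noteq> 0 \<and> (\<forall>x \<in> coeff G ` {..degree G}. s * x \<in> range to_fract)"
    by (intro common_denominator subr_range_to_fract frac_range_to_fract) simp
  then obtain s where s: "s \<noteq> 0" "\<forall>x \<in> coeff G ` {..degree G}. s * x \<in> range to_fract" by (elim bexE conjE)
  hence "\<forall>i. \<exists>p. i \<le> degree G \<longrightarrow> s * coeff G i = to_fract p" by blast
  then obtain g where g: "\<And>i. i \<le> degree G \<Longrightarrow> s * coeff G i = to_fract (g i)" by metis
  define F where "F = (\<Sum>i<Suc (degree G). monom (g i) i)"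
  have "fract_poly F = smult s G"
  proof (rule poly_eqI)
    fix i
    show "coeff (fract_poly F) i = coeff (smult s G) i"
      using g[of i] by (simp add: coeff_map_poly F_def coeff_sum_monom_if coeff_eq_0 del: sum.lessThan_Suc)
  qed
  with s(1) that show ?thesis by blast
qed

text \<open>The last orbit point, of index \<open>degree L\<close>, has strictly the largest degree
  in \<lambda>, so its leading term cannot cancel.\<close>

lemma num_nonzero:
  assumes A: "A \<noteq> 0" "C \<noteq> 0" and q: "1 \<le> q" "q + 2 \<le> Q" and L: "degree L > 0"
  shows "num q Q C A (L :: 'a::field poly) \<noteq> 0"
proof
  assume n0: "num q Q C A L = 0"
  let ?o = "frac_orb q Q (Fract A C)"
  have x: "Fract A C \<noteq> 0" using A by (simp add: Fract_conv_to_fract)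
  obtain n where n: "degree L = Suc n" using L by (cases "degree L") auto
  have "fract_poly (num q Q C A L) = 0" using n0 by simp
  hence "(\<Sum>i\<le>degree L. smult (to_fract [:coeff L i:]) (?o i)) = 0"
    using fract_poly_num[OF A(2), of q Q A L] q A(2) by simp
  hence "coeff (\<Sum>i\<le>degree L. smult (to_fract [:coeff L i:]) (?o i)) (Q ^ n) = 0" by simp
  moreover have "coeff (?o i) (Q ^ n) = 0" if "i \<le> n" for i
  proof (rule coeff_eq_0)
    show "degree (?o i) < Q ^ n"
    proof (cases i)
      case 0
      thus ?thesis using q by simp
    next
      case (Suc j)
      hence "Q ^ j < Q ^ n" using that q by (intro power_strict_increasing) auto
      thus ?thesis using degree_orbp[OF x q, of "to_fract [:0, 1:]" j] Suc by (simp del: orb.simps)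
    qed
  qed
  hence "coeff (\<Sum>i\<le>degree L. smult (to_fract [:coeff L i:]) (?o i)) (Q ^ n)
    = to_fract [:lead_coeff L:] * coeff (?o (Suc n)) (Q ^ n)"
    unfolding n by (simp add: coeff_sum del: orb.simps)
  moreover have "coeff (?o (Suc n)) (Q ^ n) \<noteq> 0"
    using degree_orbp[OF x q, of "to_fract [:0, 1:]" n] x by (metis power_not_zero)
  ultimately show False using L by auto
qed

text \<open>\<open>G\<close> and \<open>M\<close> are fixed before \<tau>, \<lambda> and
  \<open>L\<close>. The gcd of the two numerators is represented by a combination \<open>F\<close>
  of small height, and \<open>F\<close> divides a power of \<open>G\<close> over the field of
  fractions. The relation survives specialization because the leading coefficient of
  \<open>F\<close> has degree below \<open>l\<close> and so does not vanish at \<tau>.\<close>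

lemma common_annihilator_imp_root:
  fixes A B C :: "'a::finite_field poly"
  defines "q \<equiv> CARD('a)"
  assumes r: "r \<ge> 2" and nz: "A \<noteq> 0" "B \<noteq> 0" "C \<noteq> 0" and deg: "degree A < degree B"
  shows "\<exists>G M. G \<noteq> 0 \<and> M > degree C \<and> (\<forall>l \<tau> lam L. (\<forall>p. p \<noteq> 0 \<longrightarrow> degree p < l \<longrightarrow> eval_ac p \<tau> \<noteq> 0) \<longrightarrow>
    degree L > 0 \<longrightarrow> M * ((q ^ r) ^ degree L)\<^sup>2 < l \<longrightarrow>
    poly (drinfeld (drinfeld_T r \<tau> lam) L) (eval_ac A \<tau> / eval_ac C \<tau>) = 0 \<longrightarrow>
    poly (drinfeld (drinfeld_T r \<tau> lam) L) (eval_ac B \<tau> / eval_ac C \<tau>) = 0 \<longrightarrow> ev \<tau> lam G = 0)"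
proof -
  let ?Q = "q ^ r" and ?t = "to_fract [:0, 1 :: 'a:]"
  have q2: "q \<ge> 2" unfolding q_def using card_mono[of "UNIV :: 'a set" "{0, 1}"] by simp
  have "q + 2 \<le> q * q" using q2 mult_le_mono1[OF q2, of q] by linarith
  also have "q * q = q ^ 2" by (simp add: power2_eq_square)
  also have "\<dots> \<le> ?Q" by (rule power_increasing) (use r q2 in auto)
  finally have q: "1 \<le> q" "q + 2 \<le> ?Q" using q2 by auto
  let ?a = "Fract A C" and ?b = "Fract B C"
  have ab0: "?a \<noteq> 0" "?b \<noteq> 0" using nz by (auto simp: Fract_conv_to_fract)
  have "?a / ?b = Fract A B" using nz by (simp add: Fract_conv_to_fract)
  hence ab: "ideg_le (-1) (?a / ?b)" unfolding ideg_le_def using nz deg by (intro exI[of _ A] exI[of _ B]) auto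
  obtain G0 where G0: "G0 \<noteq> 0" and nil: "\<And>n h. n > 0 \<Longrightarrow> h \<noteq> 0 \<Longrightarrow>
    (\<forall>x\<in>{?a, ?b}. \<forall>k. \<exists>c. h dvd (orbp q ?Q ?t x (n + k)
        - (\<Sum>i<n. smult (to_fract [:c i:]) (orbp q ?Q ?t x (i + k))))) \<Longrightarrow> \<exists>k. h dvd G0 ^ k"
    using ex_nilpotent_polynomial[OF ab0 ab q, of ?t] by blast
  obtain s G where G: "s \<noteq> 0" "fract_poly G = smult s G0" by (rule clear_denominators)
  have Gnz: "G \<noteq> 0" using G G0 by auto
  \<comment> \<open>Strictly larger than \<open>degree C\<close>, as \<open>num_bounds\<close>
    demands. The numerators then have degree at most \<open>\<kappa> * d\<close> in t and
    \<open>d\<close> in \<lambda>, and the bound of \<open>small_gcd\<close> is at most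
    \<open>3 * \<kappa> * d ^ 2\<close>.\<close>
  define \<kappa> where "\<kappa> = Suc (max (max (degree A) (degree B)) (degree C))"
  show ?thesis
  proof (intro exI[of _ G] exI[of _ "3 * \<kappa>"] conjI allI impI Gnz)
    show "3 * \<kappa> > degree C" by (simp add: \<kappa>_def)
    fix l \<tau> lam L
    assume \<tau>: "\<forall>p. p \<noteq> 0 \<longrightarrow> degree p < l \<longrightarrow> eval_ac p \<tau> \<noteq> 0" and L: "degree L > 0"
      and l: "3 * \<kappa> * (?Q ^ degree L)\<^sup>2 < l"
      and ann: "poly (drinfeld (drinfeld_T r \<tau> lam) L) (eval_ac A \<tau> / eval_ac C \<tau>) = 0"
        "poly (drinfeld (drinfeld_T r \<tau> lam) L) (eval_ac B \<tau> / eval_ac C \<tau>) = 0"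
    define d where "d = ?Q ^ degree L"
    have d1: "d \<ge> 1" using q by (simp add: d_def)
    define f where "f = num q ?Q C A L"
    define g where "g = num q ?Q C B L"
    have fg: "f \<noteq> 0" "g \<noteq> 0" unfolding f_def g_def by (intro num_nonzero nz q L)+
    have \<kappa>: "degree A \<le> \<kappa>" "degree B \<le> \<kappa>" "degree C < \<kappa>" and q': "q < ?Q"
      using q by (simp_all add: \<kappa>_def)
    have t: "cdeg_le (\<kappa> * d) f" "cdeg_le (\<kappa> * d) g" and dfg: "degree f \<le> d" "degree g \<le> d"
      unfolding f_def g_def d_def by (rule num_bounds[OF q(1) q' _ \<kappa>(3)], rule \<kappa>)+
    obtain u w where uw: "u * f + w * g \<noteq> 0" "cdeg_le ((2 * d + 1) * (\<kappa> * d)) (u * f + w * g)"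
      "fract_poly (u * f + w * g) dvd fract_poly f" "fract_poly (u * f + w * g) dvd fract_poly g"
      using small_gcd[OF fg t dfg] by blast
    define F where "F = u * f + w * g"
    let ?h = "fract_poly F"
    have F: "F \<noteq> 0" "?h dvd fract_poly f" "?h dvd fract_poly g" using uw by (auto simp only: F_def)
    have l': "(2 * d + 1) * (\<kappa> * d) < l"
    proof -
      have "(2 * d + 1) * (\<kappa> * d) \<le> (3 * d) * (\<kappa> * d)" by (rule mult_le_mono1) (use d1 in simp)
      also have "\<dots> = 3 * \<kappa> * d\<^sup>2" by (simp add: power2_eq_square mult_ac)
      finally show ?thesis using l unfolding d_def by linarith
    qed
    have C\<tau>: "eval_ac C \<tau> \<noteq> 0"
    proof -
      have "degree C < \<kappa>" by (simp add: \<kappa>_def)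
      also have "\<kappa> = \<kappa> * 1" by simp
      also have "\<dots> \<le> \<kappa> * (3 * d\<^sup>2)" by (rule mult_le_mono2) (use d1 in simp)
      also have "\<dots> < l" using l unfolding d_def by (simp add: mult_ac)
      finally show ?thesis using \<tau> nz by blast
    qed
    have h0: "?h \<noteq> 0" using F(1) by simp
    have red: "\<exists>c. ?h dvd (orbp q ?Q ?t x (degree L + k) - (\<Sum>i<degree L. smult (to_fract [:c i:]) (orbp q ?Q ?t x (i + k))))"
      if "x = Fract D C" "?h dvd fract_poly (num q ?Q C D L)" for x D k
    proof -
      have Q: "q \<le> ?Q" "0 < ?Q" using q by auto
      have "to_fract C ^ (?Q ^ degree L) \<noteq> 0" using nz by simp
      hence "?h dvd (\<Sum>i\<le>degree L. smult (to_fract [:coeff L i:]) (orbp q ?Q ?t x i))"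
        using that(2) unfolding fract_poly_num[OF nz(3) Q] that(1) by (simp add: dvd_smult_iff)
      thus ?thesis unfolding q_def using L by (intro orbp_reduction) auto
    qed
    have "\<exists>k. ?h dvd G0 ^ k"
      using red[OF refl, of A] red[OF refl, of B] F(2,3) unfolding f_def g_def by (intro nil[OF L h0]) blast
    then obtain k where "?h dvd G0 ^ k" by blast
    hence "?h dvd smult (s ^ k) (G0 ^ k)" by (rule dvd_smult)
    also have "\<dots> = fract_poly (G ^ k)" by (simp add: fract_poly_power G smult_power)
    finally have hG: "?h dvd fract_poly (G ^ k)" .
    \<comment> \<open>Pseudo-division keeps all coefficients polynomial in t at the price of a power
      of \<open>lead_coeff F\<close>, so the identity can be evaluated at \<tau>.\<close>
    obtain W R where WR: "pseudo_divmod (G ^ k) F = (W, R)" by (cases "pseudo_divmod (G ^ k) F")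
    define e where "e = Suc (degree (G ^ k)) - degree F"
    have eq: "smult (lead_coeff F ^ e) (G ^ k) = F * W + R" 
      using pseudo_divmod(1)[OF F(1) WR] by (simp add: e_def)
    have "fract_poly R = smult (to_fract (lead_coeff F ^ e)) (fract_poly (G ^ k)) - ?h * fract_poly W"
      using arg_cong[OF eq, of fract_poly] by simp
    hence "?h dvd fract_poly R" using hG by (auto intro!: dvd_diff dvd_smult)
    moreover have "R = 0 \<or> degree R < degree F" by (rule pseudo_divmod(2)[OF F(1) WR])
    ultimately have "R = 0" using dvd_imp_degree_le[of ?h "fract_poly R"]
      by (cases "R = 0") (auto simp: degree_fract_poly)
    have "ev \<tau> lam f = 0" "ev \<tau> lam g = 0"
      unfolding f_def g_def q_def using C\<tau> r ann by (simp_all add: ev_num)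
    hence "ev \<tau> lam F = 0" by (simp add: F_def ev_add ev_mult)
    hence "eval_ac (lead_coeff F) \<tau> ^ e * ev \<tau> lam G ^ k = 0"
      using arg_cong[OF eq, of "ev \<tau> lam"] \<open>R = 0\<close> by (simp add: ev_smult ev_mult ev_power eval_ac_power)
    moreover have "degree (lead_coeff F) < l" using uw(2) l' unfolding F_def cdeg_le_def by (meson le_less_trans)
    hence "eval_ac (lead_coeff F) \<tau> \<noteq> 0" using \<tau> F(1) by simp
    ultimately show "ev \<tau> lam G = 0" by simp
  qed
qed

section \<open>Generators of finite fields\<close>

text \<open>X^(q^l) - X splits in the algebraic closure, and its derivative is -1, so all its roots
  are simple.\<close>

lemma card_fin_ext:
  assumes "l > 0"
  shows "finite (fin_ext l :: 'a::finite_field alg_closure set)"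
    and "card (fin_ext l :: 'a::finite_field alg_closure set) = CARD('a) ^ l"
proof -
  let ?n = "CARD('a) ^ l"
  have q: "CARD('a) > 1" using card_mono[of "UNIV :: 'a set" "{0, 1}"] by simp
  have n: "?n > 1" by (rule one_less_power[OF q assms])
  define f :: "'a alg_closure poly" where "f = monom 1 ?n - monom 1 1"
  have df: "degree f = ?n" unfolding f_def
    using n by (subst diff_conv_add_uminus, subst degree_add_eq_left) (auto simp: degree_monom_eq)
  hence f0: "f \<noteq> 0" using n by auto
  have roots: "{x. poly f x = 0} = fin_ext l" by (auto simp: f_def fin_ext_def poly_monom)
  thus fin: "finite (fin_ext l :: 'a alg_closure set)" using poly_roots_finite[OF f0] by simp
  obtain k where k: "CARD('a) = CHAR('a) ^ k" "k > 0" by (metis finite_field_card)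
  have z: "of_nat ?n = (0 :: 'a alg_closure)"
    using k assms by (simp add: of_nat_eq_0_iff_char_dvd dvd_power flip: power_mult)
  have "pderiv f = - 1" unfolding f_def pderiv_diff pderiv_monom z by (simp add: monom_0 one_pCons)
  have ord: "order x f \<le> 1" for x
  proof (rule ccontr)
    assume "\<not> order x f \<le> 1"
    hence "[:-x, 1:] ^ 2 dvd f" using f0 by (simp add: order_divides)
    then obtain g where g: "f = [:-x, 1:] ^ 2 * g" by (rule dvdE)
    have "poly (pderiv ([:-x, 1:] * ([:-x, 1:] * g))) x = 0"
      unfolding pderiv_mult poly_add poly_mult by simp
    hence "poly (pderiv f) x = 0" unfolding g power2_eq_square mult.assoc .
    thus False using \<open>pderiv f = - 1\<close> by simp
  qed
  obtain M where M: "size M = degree f" "f = smult (lead_coeff f) (\<Prod>x\<in>#M. [:-x, 1:])"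
    using alg_closed_imp_factorization[OF f0] by blast
  have "count M x \<le> 1" for x
  proof -
    have "[:-x, 1:] ^ count M x dvd (\<Prod>x\<in>#M. [:-x, 1:])"
    proof -
      have "replicate_mset (count M x) x \<subseteq># M" by (simp add: count_le_replicate_mset_subset_eq[symmetric])
      then obtain M' where M': "M = replicate_mset (count M x) x + M'" by (metis subset_mset.le_iff_add)
      show ?thesis by (subst (2) M') simp
    qed
    hence "[:-x, 1:] ^ count M x dvd f" by (subst M(2)) (rule dvd_smult)
    hence "count M x \<le> order x f" using f0 by (simp add: order_divides)
    thus ?thesis using ord[of x] by simp
  qed
  hence "M = mset_set (set_mset M)"
    by (intro multiset_eqI) (metis count_mset_set(1) count_mset_set(3) finite_set_mset le_antisym not_in_iff count_greater_eq_one_iff)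
  hence "size M = card (set_mset M)" by (metis size_mset_set)
  moreover have "set_mset M \<subseteq> fin_ext l"
  proof
    fix x assume "x \<in># M"
    hence "poly (\<Prod>x\<in>#M. [:-x, 1:]) x = 0" by (auto simp: poly_prod_mset prod_mset_zero_iff)
    hence "poly f x = 0" by (subst M(2)) simp
    thus "x \<in> fin_ext l" using roots by blast
  qed
  hence "card (set_mset M) \<le> card (fin_ext l :: 'a alg_closure set)" by (rule card_mono[OF fin])
  moreover have "card (fin_ext l :: 'a alg_closure set) \<le> ?n"
    using card_poly_roots_bound[OF f0] roots df by simp
  ultimately show "card (fin_ext l :: 'a alg_closure set) = ?n" using M(1) df by simp
qed

text \<open>In a finite set closed under multiplication the powers of a nonzero element repeat, so
  its inverse is one of them.\<close>

lemma generate_field_finite_subset: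
  fixes S :: "'b::field set"
  assumes S: "finite S" "1 \<in> S" "\<And>x y. x \<in> S \<Longrightarrow> y \<in> S \<Longrightarrow> x + y \<in> S"
    "\<And>x y. x \<in> S \<Longrightarrow> y \<in> S \<Longrightarrow> x * y \<in> S" "\<And>x. x \<in> S \<Longrightarrow> - x \<in> S" and H: "H \<subseteq> S"
  shows "generate_field ring_of_type_algebra H \<subseteq> S"
proof
  let ?R = "ring_of_type_algebra :: 'b ring"
  interpret R: field ?R by (rule field_from_type_algebra)
  have inv: "inverse x \<in> S" if x: "x \<in> S" "x \<noteq> 0" for x
  proof -
    have pw: "x ^ k \<in> S" for k using S x by (induction k) auto
    hence "range (\<lambda>k. x ^ k) \<subseteq> S" by auto
    hence "finite (range (\<lambda>k :: nat. x ^ k))" using S(1) finite_subset by blast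
    hence "\<not> inj (\<lambda>k :: nat. x ^ k)" using range_inj_infinite by blast
    then obtain i j :: nat where "i < j" "x ^ i = x ^ j" unfolding inj_def by (metis linorder_neqE_nat)
    then obtain k where "j = i + Suc k" using less_imp_Suc_add by auto
    hence "x ^ i * (x * x ^ k) = x ^ i * 1" using \<open>x ^ i = x ^ j\<close> by (simp add: power_add)
    hence "x * x ^ k = 1" using x(2) by (simp only: mult_cancel_left) simp
    hence "inverse x = x ^ k" by (rule inverse_unique)
    thus ?thesis using pw by simp
  qed
  fix x assume "x \<in> generate_field ?R H"
  thus "x \<in> S"
  proof induction
    case (a_inv h)
    have "\<ominus>\<^bsub>?R\<^esub> h = - h"
      by (rule R.add.inv_equality[unfolded a_inv_def[symmetric]]) (auto simp: ring_of_type_algebra_def)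
    thus ?case using S(5) a_inv by simp
  next
    case (m_inv h)
    hence h: "h \<noteq> 0" by (simp add: ring_of_type_algebra_def)
    have "inv\<^bsub>?R\<^esub> h = inverse h" 
      by (rule R.comm_inv_char) (use h in \<open>auto simp: ring_of_type_algebra_def\<close>)
    thus ?case using inv[OF m_inv.IH h] by simp
  qed (use S H in \<open>auto simp: ring_of_type_algebra_def\<close>)
qed

text \<open>If \<open>p\<close> vanished at \<tau>, every value u(\<tau>) would be that of a
  remainder modulo \<open>p\<close>. These values would form a finite ring of at most q^(degree p)
  elements containing the q^l elements of the generated field.\<close>

lemma generator_degree:
  fixes \<tau> :: "'a::finite_field alg_closure"
  assumes gen: "is_generator l \<tau>" and p: "p \<noteq> 0" "degree p < l"
  shows "eval_ac p \<tau> \<noteq> 0"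
proof
  assume 0: "eval_ac p \<tau> = 0"
  define d where "d = degree p"
  have d: "d > 0"
  proof (rule ccontr)
    assume "\<not> d > 0"
    then obtain c where "p = [:c:]" unfolding d_def by (metis degree_eq_zeroE gr0I)
    thus False using 0 p by simp
  qed
  define S where "S = range (\<lambda>u. eval_ac u \<tau>)"
  have red: "S = (\<lambda>u. eval_ac u \<tau>) ` {u. degree u < d}"
  proof -
    have "eval_ac u \<tau> \<in> (\<lambda>u. eval_ac u \<tau>) ` {u. degree u < d}" for u
    proof (rule image_eqI)
      have "eval_ac u \<tau> = eval_ac (u div p * p + u mod p) \<tau>" by simp
      also have "\<dots> = eval_ac (u mod p) \<tau>" using 0 unfolding eval_ac_add eval_ac_mult by simp
      finally show "eval_ac u \<tau> = eval_ac (u mod p) \<tau>" .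
      show "u mod p \<in> {u. degree u < d}" using degree_mod_less[OF p(1), of u] d by (auto simp: d_def)
    qed
    thus ?thesis unfolding S_def by blast
  qed
  have "{u :: 'a poly. degree u < d} \<subseteq> (\<lambda>c. \<Sum>i<d. monom (c i) i) ` (PiE {..<d} (\<lambda>_. UNIV))"
  proof
    fix u :: "'a poly"
    assume u: "u \<in> {u. degree u < d}"
    have "u = (\<Sum>i<d. monom (restrict (coeff u) {..<d} i) i)"
      by (rule poly_eqI) (use u in \<open>auto simp: coeff_sum_monom_if coeff_eq_0\<close>)
    thus "u \<in> (\<lambda>c. \<Sum>i<d. monom (c i) i) ` (PiE {..<d} (\<lambda>_. UNIV))"
      by (intro image_eqI[of _ _ "restrict (coeff u) {..<d}"]) auto
  qed
  moreover have finP: "finite (PiE {..<d} (\<lambda>_. UNIV :: 'a set))" by (intro finite_PiE) auto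
  ultimately have finu: "finite {u :: 'a poly. degree u < d}" and
    "card {u :: 'a poly. degree u < d} \<le> card (PiE {..<d} (\<lambda>_. UNIV :: 'a set))"
    by (auto intro: finite_subset surj_card_le)
  hence "card {u :: 'a poly. degree u < d} \<le> CARD('a) ^ d" by (simp add: card_PiE)
  hence card: "card S \<le> CARD('a) ^ d" and fin: "finite S"
    unfolding red using card_image_le[OF finu, of "\<lambda>u. eval_ac u \<tau>"] finu by auto
  have S: "x + y \<in> S" "x * y \<in> S" "- x \<in> S" if xy: "x \<in> S" "y \<in> S" for x y
  proof -
    obtain u v where uv: "x = eval_ac u \<tau>" "y = eval_ac v \<tau>" using xy unfolding S_def by blast
    have "x + y = eval_ac (u + v) \<tau>" "x * y = eval_ac (u * v) \<tau>" "- x = eval_ac (smult (-1) u) \<tau>"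
      unfolding uv eval_ac_add eval_ac_mult eval_ac_smult by simp_all
    thus "x + y \<in> S" "x * y \<in> S" "- x \<in> S" unfolding S_def by blast+
  qed
  have "insert \<tau> (range to_ac) \<subseteq> S" unfolding S_def
    using eval_ac_X[of \<tau>] eval_ac_const[of _ \<tau>] by (auto simp del: eval_ac_X eval_ac_const intro!: rangeI) (metis rangeI)+
  hence "generate_field ring_of_type_algebra (insert \<tau> (range to_ac)) \<subseteq> S"
    using S fin eval_ac_1[of \<tau>] by (intro generate_field_finite_subset) (auto simp: S_def simp del: eval_ac_1)
  hence "card (fin_ext l :: 'a alg_closure set) \<le> card S"
    using gen fin unfolding is_generator_def by (metis card_mono)
  hence "CARD('a) ^ l \<le> CARD('a) ^ d" using card p(2) by (simp add: card_fin_ext)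
  moreover have "CARD('a) > 1" using card_mono[of "UNIV :: 'a set" "{0, 1}"] by simp
  ultimately show False using p(2) by (simp add: d_def power_increasing_iff)
qed

section \<open>Every point is torsion\<close>

lemma ac_power_add:
  fixes x y :: "'a::finite_field alg_closure"
  shows "(x + y) ^ (CARD('a) ^ k) = x ^ (CARD('a) ^ k) + y ^ (CARD('a) ^ k)"
proof -
  obtain n where n: "CARD('a) = CHAR('a) ^ n" by (rule finite_field_card)
  show ?thesis
    using freshmans_dream'[of "CHAR('a) ^ (n * k)" "n * k" x y] by (simp add: n power_mult)
qed

lemma ac_power_diff:
  fixes x y :: "'a::finite_field alg_closure"
  shows "(x - y) ^ (CARD('a) ^ k) = x ^ (CARD('a) ^ k) - y ^ (CARD('a) ^ k)"
  using ac_power_add[of "x - y" y k] by simp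

text \<open>Frobenius over the constant field maps the finite root set of an annihilating polynomial
  of \<open>x\<close> to itself, so two of its iterates agree at \<open>x\<close>; additivity
  cancels the common iterate.\<close>

lemma in_fin_ext:
  fixes x :: "'a::finite_field alg_closure"
  obtains m where "m > 0" "x \<in> fin_ext m"
proof -
  let ?q = "CARD('a)"
  obtain p :: "'a poly" where p: "p \<noteq> 0" "poly (map_poly to_ac p) x = 0" by (rule alg_closure_algebraic)
  have fr: "poly (map_poly to_ac p) y ^ (?q ^ k) = poly (map_poly to_ac p) (y ^ (?q ^ k))" for y k
  proof (induction p rule: pCons_induct)
    case (pCons c p)
    have "to_ac c ^ (?q ^ k) = to_ac c" by (metis finite_field_power_card_power_eq_same to_ac_power)
    thus ?case using pCons by (simp add: map_poly_pCons ac_power_add power_mult_distrib)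
  qed simp
  have "poly (map_poly to_ac p) (x ^ (?q ^ k)) = 0" for k
    unfolding fr[symmetric] p(2) by simp
  hence "range (\<lambda>k. x ^ (?q ^ k)) \<subseteq> {y. poly (map_poly to_ac p) y = 0}" by blast
  moreover have "finite {y. poly (map_poly to_ac p) y = 0}"
    by (rule poly_roots_finite) (use p(1) in \<open>simp add: map_poly_eq_0_iff\<close>)
  ultimately have "finite (range (\<lambda>k. x ^ (?q ^ k)))" by (rule finite_subset)
  hence "\<not> inj (\<lambda>k :: nat. x ^ (?q ^ k))" using range_inj_infinite by blast
  then obtain i j where ij: "i < j" "x ^ (?q ^ i) = x ^ (?q ^ j)" unfolding inj_def by (metis linorder_neqE_nat)
  have "(x ^ (?q ^ (j - i)) - x) ^ (?q ^ i) = x ^ (?q ^ (j - i) * ?q ^ i) - x ^ (?q ^ i)"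
    by (simp add: ac_power_diff power_mult)
  also have "?q ^ (j - i) * ?q ^ i = ?q ^ j" using ij(1) by (simp flip: power_add)
  finally have "x ^ (?q ^ (j - i)) - x = 0" using ij(2) by simp
  thus ?thesis using that[of "j - i"] ij(1) by (simp add: fin_ext_def)
qed

lemma fin_ext_mult:
  fixes x :: "'a::finite_field alg_closure"
  assumes "x \<in> fin_ext m"
  shows "x \<in> fin_ext (m * k)"
proof -
  have "x ^ (CARD('a) ^ (m * k)) = x"
  proof (induction k)
    case (Suc k)
    have "x ^ (CARD('a) ^ (m * Suc k)) = (x ^ (CARD('a) ^ m)) ^ (CARD('a) ^ (m * k))"
      by (simp add: power_add flip: power_mult)
    thus ?case using Suc assms by (simp add: fin_ext_def)
  qed simp
  thus ?thesis by (simp add: fin_ext_def)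
qed

lemma poly_drinfeld_monom: "poly (drinfeld \<phi> (monom 1 i)) x = (poly \<phi> ^^ i) x"
proof -
  have "poly (drinfeld \<phi> (monom 1 i)) x = (\<Sum>k\<le>i. to_ac (coeff (monom 1 i) k) * (poly \<phi> ^^ k) x)"
    by (rule poly_drinfeld) (rule degree_monom_le)
  also have "\<dots> = (\<Sum>k\<le>i. if k = i then (poly \<phi> ^^ i) x else 0)" by (rule sum.cong) auto
  finally show ?thesis by simp
qed

text \<open>\<tau>, \<lambda> and \<open>c\<close> lie in one finite subfield, so the orbit of
  \<open>c\<close> repeats. If iterates \<open>i\<close> and \<open>j\<close> agree, T^i - T^j
  annihilates \<open>c\<close>.\<close>

lemma is_torsion_drinfeld_T:
  fixes \<tau> lam c :: "'a::finite_field alg_closure"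
  shows "is_torsion (drinfeld (drinfeld_T r \<tau> lam)) c"
proof -
  let ?\<phi> = "drinfeld_T r \<tau> lam" and ?q = "CARD('a)"
  obtain m1 m2 m3 where m: "m1 > 0" "\<tau> \<in> fin_ext m1" "m2 > 0" "lam \<in> fin_ext m2" "m3 > 0" "c \<in> fin_ext m3"
    by (meson in_fin_ext)
  define m where "m = m1 * m2 * m3"
  have m0: "m > 0" using m by (simp add: m_def)
  have mem: "\<tau> \<in> fin_ext m" "lam \<in> fin_ext m" "c \<in> fin_ext m"
    using fin_ext_mult[OF m(2), of "m2 * m3"] fin_ext_mult[OF m(4), of "m1 * m3"] fin_ext_mult[OF m(6), of "m1 * m2"]
    by (simp_all add: m_def mult_ac)
  have add: "x + y \<in> fin_ext m" if "x \<in> fin_ext m" "y \<in> fin_ext m" for x y :: "'a alg_closure"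
    using that by (simp add: fin_ext_def ac_power_add)
  have mult: "x * y \<in> fin_ext m" if "x \<in> fin_ext m" "y \<in> fin_ext m" for x y :: "'a alg_closure"
    using that by (simp add: fin_ext_def power_mult_distrib)
  have pw: "x ^ k \<in> fin_ext m" if "x \<in> fin_ext m" for x :: "'a alg_closure" and k
    using that by (simp add: fin_ext_def flip: power_mult) (metis mult.commute power_mult)
  have orb: "(poly ?\<phi> ^^ i) c \<in> fin_ext m" for i
  proof (induction i)
    case (Suc i)
    thus ?case using mem by (auto simp: drinfeld_T_def poly_monom intro!: add mult pw)
  qed (use mem in simp)
  hence "range (\<lambda>i. (poly ?\<phi> ^^ i) c) \<subseteq> fin_ext m" by blast
  hence "finite (range (\<lambda>i. (poly ?\<phi> ^^ i) c))" using card_fin_ext(1)[OF m0] by (rule finite_subset)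
  hence "\<not> inj (\<lambda>i. (poly ?\<phi> ^^ i) c)" using range_inj_infinite by blast
  then obtain i j where ij: "i \<noteq> j" "(poly ?\<phi> ^^ i) c = (poly ?\<phi> ^^ j) c" unfolding inj_def by blast
  define P :: "'a poly" where "P = monom 1 i + smult (-1) (monom 1 j)"
  have "coeff P i \<noteq> 0" using ij(1) by (simp add: P_def)
  hence "P \<noteq> 0" by auto
  moreover have "poly (drinfeld ?\<phi> P) c = 0"
    unfolding P_def poly_drinfeld_add poly_drinfeld_smult poly_drinfeld_monom using ij(2) by simp
  ultimately show ?thesis unfolding is_torsion_def by blast
qed

section \<open>The main theorem\<close>

lemma ev_roots_bound:
  fixes \<tau> :: "'a::field alg_closure"
  assumes "eval_ac (lead_coeff G) \<tau> \<noteq> 0"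
  shows "finite {lam. ev \<tau> lam G = 0}" "card {lam. ev \<tau> lam G = 0} \<le> degree G"
proof -
  let ?g = "map_poly (\<lambda>p. eval_ac p \<tau>) G"
  have "coeff ?g (degree G) \<noteq> 0" using assms by (simp add: coeff_map_poly)
  hence g: "?g \<noteq> 0" by auto
  show "finite {lam. ev \<tau> lam G = 0}" unfolding ev_def by (rule poly_roots_finite[OF g])
  have "card {lam. ev \<tau> lam G = 0} \<le> degree ?g" unfolding ev_def by (rule card_poly_roots_bound[OF g])
  also have "\<dots> \<le> degree G" by (rule degree_le) (simp add: coeff_map_poly coeff_eq_0)
  finally show "card {lam. ev \<tau> lam G = 0} \<le> degree G" .
qed

text \<open>If the degrees agree, cancelling leading terms lowers one of them, and independence
  keeps the result nonzero. Over a common denominator this separates the degrees at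
  infinity.\<close>

lemma distinct_degree_combination:
  fixes A B :: "'a::field poly"
  assumes indep: "\<And>c d. smult c A + smult d B = 0 \<Longrightarrow> c = 0 \<and> d = 0"
  obtains A' B' c d e f where "A' = smult c A + smult d B" "B' = smult e A + smult f B"
    "A' \<noteq> 0" "B' \<noteq> 0" "degree A' < degree B'"
proof -
  have A: "A \<noteq> 0" using indep[of 1 0] by auto
  have B: "B \<noteq> 0" using indep[of 0 1] by auto
  consider "degree A < degree B" | "degree B < degree A" | "degree A = degree B" by linarith
  thus ?thesis
  proof cases
    case 1
    thus ?thesis using that[of A 1 0 B 0 1] A B by simp
  next
    case 2
    thus ?thesis using that[of B 0 1 A 1 0] A B by simp
  next
    case 3
    define k where "k = lead_coeff A / lead_coeff B"
    define A' where "A' = smult 1 A + smult (- k) B"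
    have A': "A' \<noteq> 0" unfolding A'_def using indep[of 1 "- k"] by (metis zero_neq_one)
    have "coeff A' (degree B) = 0" using 3 B by (simp add: A'_def k_def)
    moreover have "degree A' \<le> degree B" unfolding A'_def
      using 3 by (intro degree_add_le order_trans[OF degree_smult_le]) auto
    ultimately have "degree A' < degree B" using A' by (metis leading_coeff_0_iff le_neq_implies_less)
    thus ?thesis using that[OF A'_def, of B 0 1] A' B by simp
  qed
qed

lemma lin_indep_pair_Fract:
  assumes "lin_indep_pair (Fract A C) (Fract B C)" "C \<noteq> 0" "smult c A + smult d B = 0"
  shows "c = 0 \<and> d = 0"
proof -
  have k: "const_fract k * Fract P C = Fract (smult k P) C" for k P
    by (simp add: const_fract_def)
  have "const_fract c * Fract A C + const_fract d * Fract B C = to_fract (smult c A + smult d B) / to_fract C"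
    unfolding k by (simp add: Fract_conv_to_fract add_divide_distrib)
  also have "\<dots> = 0" by (simp only: assms(3)) simp
  finally show ?thesis using assms(1) unfolding lin_indep_pair_def by blast
qed

lemma finite_rat_degree: "finite {a :: 'a::{finite,field} poly fract. rat_degree a \<le> n}"
proof (rule finite_subset)
  let ?P = "{p :: 'a poly. degree p \<le> n}"
  show "{a :: 'a poly fract. rat_degree a \<le> n} \<subseteq> (\<lambda>(P, Q). Fract P Q) ` (?P \<times> ?P)"
  proof
    fix a :: "'a poly fract"
    assume a: "a \<in> {a. rat_degree a \<le> n}"
    obtain P Q where PQ: "a = Fract P Q" "coprime P Q" "Q \<noteq> 0" by (rule ex_coprime_Fract)
    hence "(P, Q) \<in> ?P \<times> ?P" using a by (simp add: rat_degree_Fract)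
    thus "a \<in> (\<lambda>(P, Q). Fract P Q) ` (?P \<times> ?P)" using PQ by force
  qed
  show "finite ((\<lambda>(P, Q). Fract P Q) ` (?P \<times> ?P))" using finite_degree_le by blast
qed

section \<open>From the size condition on the annihilator to the double logarithm\<close>

lemma eventually_ln_bound:
  fixes K :: real
  assumes "K > 0"
  obtains N :: nat where "N \<ge> 3" "\<And>l. l \<ge> N \<Longrightarrow> K * ln (real l) < real l"
proof -
  have "eventually (\<lambda>x::real. ln x / x < 1 / K) at_top"
    using order_tendstoD(2)[OF ln_x_over_x_tendsto_0] assms by simp
  then obtain x0 where x0: "\<And>x. x \<ge> x0 \<Longrightarrow> ln x / x < 1 / K" by (auto simp: eventually_at_top_linorder)
  show ?thesis
  proof (rule that[of "max 3 (nat \<lceil>x0\<rceil>)"])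
    fix l assume l: "l \<ge> max 3 (nat \<lceil>x0\<rceil>)"
    hence "real l > 0" "real l \<ge> x0" by linarith+
    thus "K * ln (real l) < real l" using x0[of "real l"] assms by (simp add: field_simps)
  qed simp
qed

text \<open>The conclusion for one pair and one \<tau>, isolated so that the bound on the
  exceptional set can be enlarged to one common to finitely many pairs.\<close>

definition large_order :: "nat \<Rightarrow> 'a::finite_field poly fract \<Rightarrow> 'a poly fract \<Rightarrow> nat \<Rightarrow> real \<Rightarrow> nat \<Rightarrow> 'a alg_closure \<Rightarrow> bool" where
  "large_order r a b N0 c0 l \<tau> \<longleftrightarrow> specializable a \<tau> \<and> specializable b \<tau> \<and>
    (\<exists>E :: 'a alg_closure set. finite E \<and> card E \<le> N0 \<and>
      (\<forall>lam. lam \<notin> E \<longrightarrow>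
        (\<exists>c \<in> {specialize a \<tau>, specialize b \<tau>}.
           is_torsion (drinfeld (drinfeld_T r \<tau> lam)) c \<and>
           real (degree (torsion_order (drinfeld (drinfeld_T r \<tau> lam)) c)) \<ge> c0 * ln (ln (real l)))))"

lemma large_order_mono: "large_order r a b N c l \<tau> \<Longrightarrow> N \<le> N' \<Longrightarrow> large_order r a b N' c l \<tau>"
  unfolding large_order_def by (meson order_trans)

text \<open>If both orders have degree below \<open>c0 * ln (ln l)\<close>, a common multiple
  \<open>L\<close> has degree below \<open>1 + 2 * c0 * ln (ln l)\<close>. As
  \<open>4 * c0 * ln Q = 1\<close>, it follows that
  \<open>Q ^ (2 * degree L) < Q ^ 2 * ln l\<close>, the size condition holds for large
  \<open>l\<close>, and \<lambda> is a root of the fixed polynomial \<open>G\<close> at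
  \<tau>.\<close>

lemma large_order_pair:
  fixes a b :: "'a::finite_field poly fract" and r :: nat
  defines "Q \<equiv> CARD('a) ^ r"
  assumes r: "r \<ge> 2" and indep: "lin_indep_pair a b"
  shows "\<exists>N. \<forall>l \<ge> N. \<forall>\<tau>. is_generator l \<tau> \<longrightarrow> large_order r a b N (1 / (4 * ln (real Q))) l \<tau>"
proof -
  let ?c0 = "1 / (4 * ln (real Q))"
  have "CARD('a) > 1" using card_mono[of "UNIV :: 'a set" "{0, 1}"] by simp
  hence "Q > 1" unfolding Q_def using r by (intro one_less_power) auto
  hence Q: "real Q > 1" "ln (real Q) > 0" by simp_all
  obtain A1 D1 where a: "a = Fract A1 D1" "coprime A1 D1" "D1 \<noteq> 0" by (rule ex_coprime_Fract)
  obtain B1 D2 where b: "b = Fract B1 D2" "coprime B1 D2" "D2 \<noteq> 0" by (rule ex_coprime_Fract)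
  define A B C where "A = A1 * D2" and "B = B1 * D1" and "C = D1 * D2"
  have C: "C \<noteq> 0" using a b by (simp add: C_def)
  have ab: "a = Fract A C" "b = Fract B C" using a b by (simp_all add: A_def B_def C_def eq_fract)
  obtain A' B' c d e f where comb: "A' = smult c A + smult d B" "B' = smult e A + smult f B"
    and nz: "A' \<noteq> 0" "B' \<noteq> 0" and deg: "degree A' < degree B'"
    by (rule distinct_degree_combination[of A B, OF lin_indep_pair_Fract[OF indep[unfolded ab] C]])
  obtain G M where G: "G \<noteq> 0" and M: "M > degree C"
    and ann: "\<And>l \<tau> lam L. (\<forall>p. p \<noteq> 0 \<longrightarrow> degree p < l \<longrightarrow> eval_ac p \<tau> \<noteq> 0) \<Longrightarrow>
      degree L > 0 \<Longrightarrow> M * (Q ^ degree L)\<^sup>2 < l \<Longrightarrow>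
      poly (drinfeld (drinfeld_T r \<tau> lam) L) (eval_ac A' \<tau> / eval_ac C \<tau>) = 0 \<Longrightarrow>
      poly (drinfeld (drinfeld_T r \<tau> lam) L) (eval_ac B' \<tau> / eval_ac C \<tau>) = 0 \<Longrightarrow> ev \<tau> lam G = 0"
    using common_annihilator_imp_root[OF r nz C deg] unfolding Q_def by blast
  have M0: "M > 0" using M by simp
  have "real M * (real Q)\<^sup>2 > 0" using M0 Q by simp
  then obtain N1 :: nat where N1: "N1 \<ge> 3" "\<And>l. l \<ge> N1 \<Longrightarrow> real M * (real Q)\<^sup>2 * ln (real l) < real l"
    by (rule eventually_ln_bound) blast
  \<comment> \<open>The summands provide for the growth condition, the nonvanishing of
    \<open>C\<close> and of \<open>lead_coeff G\<close> at \<tau>, and the number of roots; the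
    final 1 makes the degree bounds strict.\<close>
  define N where "N = N1 + degree C + degree (lead_coeff G) + degree G + 1"
  show ?thesis
  proof (intro exI[of _ N] allI impI)
    fix l and \<tau> :: "'a alg_closure"
    assume l: "N \<le> l" and gen: "is_generator l \<tau>"
    have \<tau>: "\<forall>p. p \<noteq> 0 \<longrightarrow> degree p < l \<longrightarrow> eval_ac p \<tau> \<noteq> 0" using generator_degree[OF gen] by blast
    have "eval_ac C \<tau> \<noteq> 0" using \<tau> C l by (simp add: N_def)
    hence D: "eval_ac D1 \<tau> \<noteq> 0" "eval_ac D2 \<tau> \<noteq> 0" by (auto simp: C_def eval_ac_mult)
    have spec: "specializable a \<tau>" "specializable b \<tau>"
      using D a b by (simp_all add: specializable_Fract)
    have val: "specialize a \<tau> = eval_ac A \<tau> / eval_ac C \<tau>" "specialize b \<tau> = eval_ac B \<tau> / eval_ac C \<tau>"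
      using D a b by (simp_all add: specialize_Fract A_def B_def C_def eval_ac_mult)
    have "eval_ac (lead_coeff G) \<tau> \<noteq> 0" using \<tau> G l by (simp add: N_def)
    note E = ev_roots_bound[OF this]
    \<comment> \<open>\<open>N1 \<ge> 3\<close> gives \<open>l \<ge> 4\<close>, which exceeds e.
      Positivity of \<open>ln l\<close> is used when \<open>exp (ln (ln l))\<close> is simplified
      below.\<close>
    have ln3: "ln (real l) > 1"
    proof -
      have "real l \<ge> 4" using N1(1) l by (simp add: N_def)
      moreover from this have "exp 1 < real l" using exp_le by linarith
      ultimately have "ln (exp 1) < ln (real l)" by (intro ln_less_cancel_iff[THEN iffD2]) auto
      thus ?thesis by simp
    qed
    have main: "ev \<tau> lam G = 0"
      if small: "\<And>x. x \<in> {specialize a \<tau>, specialize b \<tau>} \<Longrightarrow>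
        real (degree (torsion_order (drinfeld (drinfeld_T r \<tau> lam)) x)) < ?c0 * ln (ln (real l))" for lam
    proof -
      let ?\<phi> = "drinfeld_T r \<tau> lam"
      let ?Pa = "torsion_order (drinfeld ?\<phi>) (specialize a \<tau>)" and ?Pb = "torsion_order (drinfeld ?\<phi>) (specialize b \<tau>)"
      note lin = fq_linear_drinfeld_T[of r \<tau> lam]
      note oa = torsion_order[OF is_torsion_drinfeld_T[of r \<tau> lam "specialize a \<tau>"]]
      note ob = torsion_order[OF is_torsion_drinfeld_T[of r \<tau> lam "specialize b \<tau>"]]
      have P0: "?Pa \<noteq> 0" "?Pb \<noteq> 0" using oa(1) ob(1) by force+
      \<comment> \<open>The factor T makes the degree positive even if both points are 0, with order
        the constant 1.\<close>
      define L where "L = [:0, 1:] * (?Pa * ?Pb)"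
      have dL: "degree L = 1 + degree ?Pa + degree ?Pb"
        unfolding L_def using P0 by (simp add: degree_mult_eq del: mult_pCons_left)
      have "[:0, 1:] * ?Pb * ?Pa = L" "[:0, 1:] * ?Pa * ?Pb = L" by (simp_all add: L_def mult_ac del: mult_pCons_left)
      hence kill: "poly (drinfeld ?\<phi> L) (specialize a \<tau>) = 0" "poly (drinfeld ?\<phi> L) (specialize b \<tau>) = 0"
        using oa(2) ob(2) drinfeld_mult[OF lin, of "[:0, 1:] * ?Pb" ?Pa] drinfeld_mult[OF lin, of "[:0, 1:] * ?Pa" ?Pb]
          fq_linear_zero[OF fq_linear_drinfeld[OF lin]]
        by (metis poly_pcompose)+
      note linL = fq_linear_drinfeld[OF lin, of L]
      \<comment> \<open>Annihilation passes to the modified pair \<open>A'\<close>,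
        \<open>B'\<close> by linearity over the constant field.\<close>
      have kill': "poly (drinfeld ?\<phi> L) (eval_ac (smult u A + smult v B) \<tau> / eval_ac C \<tau>) = 0" for u v
      proof -
        have "eval_ac (smult u A + smult v B) \<tau> / eval_ac C \<tau>
          = to_ac u * specialize a \<tau> + to_ac v * specialize b \<tau>"
          by (simp add: val eval_ac_add eval_ac_smult add_divide_distrib)
        thus ?thesis by (simp add: fq_linear_add[OF linL] fq_linear_scale[OF linL] kill)
      qed
      have "real (2 * degree L) * ln (real Q) < 2 * ln (real Q) + ln (ln (real l))"
      proof -
        have "real (degree ?Pa) + real (degree ?Pb) < 2 * (?c0 * ln (ln (real l)))"
          using small[of "specialize a \<tau>"] small[of "specialize b \<tau>"] by simp
        hence "2 * (real (degree ?Pa) + real (degree ?Pb)) * ln (real Q) < 4 * (?c0 * ln (ln (real l))) * ln (real Q)"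
          using Q(2) by (intro mult_strict_right_mono) auto
        also have "\<dots> = ln (ln (real l))" using Q(2) by simp
        finally show ?thesis by (simp add: dL algebra_simps)
      qed
      hence "exp (real (2 * degree L) * ln (real Q)) < exp (2 * ln (real Q) + ln (ln (real l)))" by simp
      also have "exp (real (2 * degree L) * ln (real Q)) = (real Q) ^ (2 * degree L)"
        using Q(1) by (simp only: exp_of_nat_mult) simp
      also have "exp (2 * ln (real Q) + ln (ln (real l))) = (real Q)\<^sup>2 * ln (real l)"
        using Q(1) ln3 exp_of_nat_mult[of 2 "ln (real Q)"] by (simp add: exp_add)
      finally have "real M * (real Q) ^ (2 * degree L) < real M * ((real Q)\<^sup>2 * ln (real l))"
        using M0 by (intro mult_strict_left_mono) auto
      also have "\<dots> < real l" using N1(2)[of l] l by (simp add: N_def mult.assoc)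
      finally have "real (M * (Q ^ degree L)\<^sup>2) < real l"
        by (simp add: power_mult[symmetric] mult.commute)
      hence "M * (Q ^ degree L)\<^sup>2 < l" by (simp only: of_nat_less_iff)
      thus ?thesis using ann[OF \<tau>, of L lam] kill' dL by (simp add: comb)
    qed
    have "\<exists>x \<in> {specialize a \<tau>, specialize b \<tau>}. is_torsion (drinfeld (drinfeld_T r \<tau> lam)) x \<and>
           real (degree (torsion_order (drinfeld (drinfeld_T r \<tau> lam)) x)) \<ge> ?c0 * ln (ln (real l))"
      if "lam \<notin> {lam. ev \<tau> lam G = 0}" for lam
      using main[of lam] that is_torsion_drinfeld_T[of r \<tau> lam] by (metis (mono_tags, lifting) mem_Collect_eq not_le)
    moreover have "card {lam. ev \<tau> lam G = 0} \<le> N" using E(2) by (simp add: N_def)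
    ultimately show "large_order r a b N ?c0 l \<tau>" unfolding large_order_def using spec E(1) by blast
  qed
qed

theorem theorem1p3:
  fixes r da db :: nat
  assumes "r \<ge> 2"
  shows "\<exists>(N0::nat) (c0::real). N0 > 0 \<and> c0 > 0 \<and>
    (\<forall>a b :: 'a::finite_field poly fract.
       rat_degree a = da \<and> rat_degree b = db \<and> lin_indep_pair a b \<longrightarrow>
       (\<forall>l \<ge> N0. \<forall>\<tau> :: 'a alg_closure. is_generator l \<tau> \<longrightarrow>
          specializable a \<tau> \<and> specializable b \<tau> \<and>
          (\<exists>E :: 'a alg_closure set. finite E \<and> card E \<le> N0 \<and>
             (\<forall>lam. lam \<notin> E \<longrightarrow>
                (\<exists>c \<in> {specialize a \<tau>, specialize b \<tau>}.
                   is_torsion (drinfeld (drinfeld_T r \<tau> lam)) c \<and>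
                   real (Polynomial.degree (torsion_order (drinfeld (drinfeld_T r \<tau> lam)) c))
                     \<ge> c0 * ln (ln (real l)))))))"
proof -
  define c0 where "c0 = 1 / (4 * ln (real (CARD('a) ^ r)))"
  have "CARD('a) > 1" using card_mono[of "UNIV :: 'a set" "{0, 1}"] by simp
  hence "CARD('a) ^ r > 1" using assms by (intro one_less_power) auto
  hence "real (CARD('a) ^ r) > 1" by linarith
  hence c0: "c0 > 0" by (simp add: c0_def)
  define S where "S = {a :: 'a poly fract. rat_degree a \<le> da} \<times> {b :: 'a poly fract. rat_degree b \<le> db}"
  have "finite S" unfolding S_def by (intro finite_cartesian_product finite_rat_degree)
  have "\<forall>x. \<exists>N. lin_indep_pair (fst x) (snd x) \<longrightarrow> (\<forall>l \<ge> N. \<forall>\<tau> :: 'a alg_closure. is_generator l \<tau> \<longrightarrow>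
      large_order r (fst x) (snd x) N c0 l \<tau>)"
    using large_order_pair[OF assms] unfolding c0_def by blast
  then obtain N where N: "\<And>x l \<tau>. lin_indep_pair (fst x) (snd x) \<Longrightarrow> l \<ge> N x \<Longrightarrow> is_generator l \<tau> \<Longrightarrow>
      large_order r (fst x) (snd x) (N x) c0 l (\<tau> :: 'a alg_closure)" by metis
  \<comment> \<open>The sum dominates each of its finitely many terms, so it serves both as
    threshold for \<open>l\<close> and as bound on the exceptional set; \<open>c0\<close> is already
    common to all pairs.\<close>
  define N0 where "N0 = Suc (\<Sum>x\<in>S. N x)"
  show ?thesis
  proof (intro exI[of _ N0] exI[of _ c0], fold large_order_def, intro conjI allI impI)
    show "N0 > 0" by (simp add: N0_def)
    show "c0 > 0" by (rule c0)
    fix a b :: "'a poly fract" and l and \<tau> :: "'a alg_closure"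
    assume ab: "rat_degree a = da \<and> rat_degree b = db \<and> lin_indep_pair a b" and l: "N0 \<le> l" and gen: "is_generator l \<tau>"
    have "(a, b) \<in> S" using ab by (simp add: S_def)
    hence "N (a, b) \<le> (\<Sum>x\<in>S. N x)" using \<open>finite S\<close> by (intro member_le_sum) auto
    hence le: "N (a, b) \<le> N0" by (simp add: N0_def)
    have "large_order r a b (N (a, b)) c0 l \<tau>" using N[of "(a, b)" l \<tau>] ab l le gen by simp
    thus "large_order r a b N0 c0 l \<tau>" using le by (rule large_order_mono)
  qed
qed

end
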